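(* Let $\nu\in\mathbb{R}$, $N\ge1$ an integer, $\beta>0$, and let $\mathbf{h}_N=(h_0,\dots,h_{N-1})$ be the vector of the first $N$ Hermite functions. If $\beta<\frac1N$, then $\mathcal{G}_\nu(\mathbf{h}_N,Z_\beta)=\{\Sigma_\nu(M_{\beta n}\mathbf{h}_N):n\in\mathbb{Z}\}$ is a Gabor superframe for $L^2_\nu[(0,1),\mathbb{C}^N]$.
   Context: $L^2_\nu(0,1)$ is the Hilbert space of measurable $f:\mathbb{R}\to\mathbb{C}$ with $f(t+k)=e^{2\pi ik\nu}f(t)$ for all $k\in\mathbb{Z}$ and $\int_0^1|f|^2<\infty$, with the inner product of $L^2(0,1)$. $L^2_\nu[(0,1),\mathbb{C}^N]$ is the Hilbert space of $\mathbf{f}=(f_0,\dots,f_{N-1})$ with $f_i\in L^2_\nu(0,1)$ and $\langle\mathbf{f},\mathbf{g}\rangle=\sum_{i=0}^{N-1}\langle f_i,g_i\rangle_{L^2_\nu(0,1)}$. $M_\xi f(t)=e^{2\pi i\xi t}f(t)$, $\Sigma_\nu g(t)=\sum_{k\in\mathbb{Z}}e^{2\pi ik\nu}g(t-k)$, both acting componentwise on vectors. $h_r(t)=c_re^{\pi t^2}\frac{d^r}{dt^r}(e^{-2\pi t^2})$ with $c_r$ chosen so that $\|h_r\|_{L^2(\mathbb{R})}=1$. $Z_\beta=\{(0,\beta n):n\in\mathbb{Z}\}$. For $\mathbf{g}=(g_0,\dots,g_{N-1})\in L^2(\mathbb{R},\mathbb{C}^N)$ with orthonormal entries, $\mathcal{G}_\nu(\mathbf{g},Z_\beta)=\{\Sigma_\nu(M_{\beta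 n}\mathbf{g}):n\in\mathbb{Z}\}$ is a Gabor superframe for $L^2_\nu[(0,1),\mathbb{C}^N]$ if there are $A,B>0$ such that for all $\mathbf{f}\in L^2_\nu[(0,1),\mathbb{C}^N]$, $A\|\mathbf{f}\|^2\le\sum_{n\in\mathbb{Z}}|\langle\mathbf{f},\Sigma_\nu M_{\beta n}\mathbf{g}\rangle|^2\le B\|\mathbf{f}\|^2$. *)

theory Defs
  imports "HOL-Analysis.Analysis"
begin

definition L2R :: "(real \<Rightarrow> complex) set" where
  "L2R = {f. f \<in> borel_measurable lebesgue \<and> integrable lebesgue (\<lambda>t. (cmod (f t))\<^sup>2)}"

definition inner_L2R :: "(real \<Rightarrow> complex) \<Rightarrow> (real \<Rightarrow> complex) \<Rightarrow> complex" where
  "inner_L2R f g = (LINT t|lebesgue. f t * cnj (g t))"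

definition norm_L2R :: "(real \<Rightarrow> complex) \<Rightarrow> real" where
  "norm_L2R f = sqrt (LINT t|lebesgue. (cmod (f t))\<^sup>2)"

(* Elements are functions rather than almost-everywhere classes; every class has an
   everywhere quasi-periodic representative. *)
definition L2nu :: "real \<Rightarrow> (real \<Rightarrow> complex) set" where
  "L2nu \<nu> = {f. f \<in> borel_measurable lebesgue \<and>
     (\<forall>t. \<forall>k::int. f (t + of_int k) = cis (2 * pi * of_int k * \<nu>) * f t) \<and>
     set_integrable lebesgue {0<..<1} (\<lambda>t. (cmod (f t))\<^sup>2)}"

definition inner_L2nu :: "(real \<Rightarrow> complex) \<Rightarrow> (real \<Rightarrow> complex) \<Rightarrow> complex" where
  "inner_L2nu f g = (LINT t:{0<..<1}|lebesgue. f t * cnj (g t))"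

(* Vectors (f_0, ..., f_{N-1}) are functions on nat; only the entries with index below N matter. *)
definition L2nu_vec :: "real \<Rightarrow> nat \<Rightarrow> (nat \<Rightarrow> real \<Rightarrow> complex) set" where
  "L2nu_vec \<nu> N = {f. \<forall>i<N. f i \<in> L2nu \<nu>}"

definition inner_L2nu_vec ::
  "nat \<Rightarrow> (nat \<Rightarrow> real \<Rightarrow> complex) \<Rightarrow> (nat \<Rightarrow> real \<Rightarrow> complex) \<Rightarrow> complex" where
  "inner_L2nu_vec N f g = (\<Sum>i<N. inner_L2nu (f i) (g i))"

definition norm_L2nu_vec :: "nat \<Rightarrow> (nat \<Rightarrow> real \<Rightarrow> complex) \<Rightarrow> real" where
  "norm_L2nu_vec N f = sqrt (Re (inner_L2nu_vec N f f))"

definition modulation :: "real \<Rightarrow> (real \<Rightarrow> complex) \<Rightarrow> real \<Rightarrow> complex" where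
  "modulation \<xi> f t = cis (2 * pi * \<xi> * t) * f t"

definition periodization :: "real \<Rightarrow> (real \<Rightarrow> complex) \<Rightarrow> real \<Rightarrow> complex" where
  "periodization \<nu> g t = (\<Sum>\<^sub>\<infinity>k::int. cis (2 * pi * of_int k * \<nu>) * g (t - of_int k))"

definition gabor_system ::
  "real \<Rightarrow> real \<Rightarrow> (nat \<Rightarrow> real \<Rightarrow> complex) \<Rightarrow> int \<Rightarrow> nat \<Rightarrow> real \<Rightarrow> complex" where
  "gabor_system \<nu> \<beta> g n i = periodization \<nu> (modulation (\<beta> * of_int n) (g i))"

(* The summability conjunct is needed because infsum is 0 for divergent families. *)
definition gabor_superframe ::
  "real \<Rightarrow> nat \<Rightarrow> (nat \<Rightarrow> real \<Rightarrow> complex) \<Rightarrow> real \<Rightarrow> bool" where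
  "gabor_superframe \<nu> N g \<beta> \<longleftrightarrow>
     (\<forall>i<N. g i \<in> L2R) \<and>
     (\<forall>i<N. \<forall>j<N. inner_L2R (g i) (g j) = (if i = j then 1 else 0)) \<and>
     (\<forall>n. gabor_system \<nu> \<beta> g n \<in> L2nu_vec \<nu> N) \<and>
     (\<exists>A>0. \<exists>B>0. \<forall>f\<in>L2nu_vec \<nu> N.
        (\<lambda>n. (cmod (inner_L2nu_vec N f (gabor_system \<nu> \<beta> g n)))\<^sup>2) summable_on UNIV \<and>
        A * (norm_L2nu_vec N f)\<^sup>2
          \<le> (\<Sum>\<^sub>\<infinity>n. (cmod (inner_L2nu_vec N f (gabor_system \<nu> \<beta> g n)))\<^sup>2) \<and>
        (\<Sum>\<^sub>\<infinity>n. (cmod (inner_L2nu_vec N f (gabor_system \<nu> \<beta> g n)))\<^sup>2)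
          \<le> B * (norm_L2nu_vec N f)\<^sup>2)"

(* The constants c r are left as a parameter: the condition that hermite c r has norm 1
   determines c r only up to a unimodular factor. *)
definition hermite :: "(nat \<Rightarrow> complex) \<Rightarrow> nat \<Rightarrow> real \<Rightarrow> complex" where
  "hermite c r t =
     c r * of_real (exp (pi * t\<^sup>2) * (deriv ^^ r) (\<lambda>x. exp (- 2 * pi * x\<^sup>2)) t)"

end

theory Submission
  imports Defs "HOL-Complex_Analysis.Complex_Analysis" "HOL-Probability.Probability"
begin

text \<open>Let \<open>d\<^sub>j(l)\<close> be the Fourier coefficients of \<open>f\<^sub>j\<close> with respect to the orthonormal basis
\<open>t \<mapsto> cis (2 * pi * (\<nu> + l) * t)\<close> of \<open>L2(0,1)\<close>. By Parseval the norm of \<open>f\<close> is the \<open>\<ell>2\<close> norm of \<open>d\<close>.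
Unfolding the periodization, the Fourier coefficient of \<open>\<Sigma>\<^sub>\<nu> M\<^bsub>\<beta> n\<^esub> h\<^sub>j\<close> with index \<open>l\<close> is the Fourier transform of
\<open>h\<^sub>j\<close> at \<open>\<nu> + l - \<beta> n\<close>, whose conjugate has the form \<open>q\<^sub>j(\<xi>) exp (- pi \<xi>\<^sup>2)\<close> with a polynomial \<open>q\<^sub>j\<close> of
degree exactly \<open>j\<close>. Hence the frame coefficients are the samples
\<open>Y(n) = \<Sum>\<^sub>j \<Sum>\<^sub>l d\<^sub>j(l) q\<^sub>j(\<nu> + l - \<beta> n) exp (- pi (\<nu> + l - \<beta> n)\<^sup>2)\<close>, and the claim is that
\<open>d \<mapsto> Y\<close> is bounded above and below in \<open>\<ell>2\<close>. The upper bound is Schur's test, because the kernel decays like a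
Gaussian in \<open>\<nu> + l - \<beta> n\<close>.

The lower bound comes from an explicit left inverse. Suppose \<open>a\<close> is a sequence with
\<open>|a(n)| \<le> C exp (- k n\<^sup>2)\<close> for some \<open>k > pi \<beta>\<^sup>2\<close>, whose Laurent series \<open>L(X) = \<Sum>\<^sub>n a(n) X\<^sup>n\<close> has zeros of order
at least \<open>N\<close> at the points \<open>exp (2 pi \<beta> l)\<close>, \<open>l \<noteq> 0\<close>, and does not vanish at \<open>1\<close>. For every \<open>l\<close> choose
\<open>m(l) = \<lfloor>(\<nu> + l) / \<beta>\<rfloor>\<close> and use the weights \<open>a(n - m(l)) exp (pi (\<nu> + l - \<beta> n)\<^sup>2)\<close>. The exponential cancels the
Gaussian in the sampling kernel up to a geometric factor, so that pairing the weights with the samples evaluates \<open>L\<close> and its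
derivatives at \<open>exp (2 pi \<beta> (l' - l))\<close>: everything with \<open>l' \<noteq> l\<close> disappears. Because \<open>k > pi \<beta>\<^sup>2\<close> the weights still decay
like a Gaussian, uniformly in \<open>l\<close>, and Schur's test bounds the pairing. Replacing \<open>a\<close> by its \<open>r\<close>-th differences,
\<open>r < N\<close>, kills all polynomials of degree below \<open>r\<close>, and the pairings form a triangular system for
\<open>d\<^sub>0(l), \<dots>, d\<^bsub>N-1\<^esub>(l)\<close> whose diagonal does not depend on \<open>l\<close> and whose entries are bounded
(\<open>samples_lower_bound\<close>).

The sequence \<open>a\<close> is where \<open>\<beta> < 1 / N\<close> enters (\<open>exists_dual_sequence\<close>). The coefficients of the Jacobi theta series
\<open>\<Sum>\<^sub>n (- 1)\<^sup>n q\<^bsup>n (n - 1) / 2\<^esup> X\<^sup>n\<close> with \<open>q = exp (- 2 pi \<beta>)\<close> decay at every rate below \<open>pi \<beta>\<close>, and the series vanishes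
at all the points \<open>exp (2 pi \<beta> l)\<close>. Dividing it by \<open>X - 1\<close> as often as possible keeps the decay and gives a series that
vanishes at these points for \<open>l \<noteq> 0\<close> only (\<open>exists_cardinal_laurent\<close>). Its \<open>N\<close>-th power has zeros of order \<open>N\<close>, and its
coefficients decay at any rate below \<open>pi \<beta> / N\<close>. Such a rate can exceed \<open>pi \<beta>\<^sup>2\<close> exactly when \<open>\<beta> < 1 / N\<close>.\<close>

section \<open>Gaussian sums over the integers\<close>

abbreviation gauss :: "real \<Rightarrow> real \<Rightarrow> real" where
  "gauss c x \<equiv> exp (- c * x^2)"

abbreviation square_summable :: "('a \<Rightarrow> complex) \<Rightarrow> bool" where
  "square_summable d \<equiv> (\<lambda>x. (norm (d x))\<^sup>2) summable_on UNIV"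

abbreviation square_sum :: "('a \<Rightarrow> complex) \<Rightarrow> real" where
  "square_sum d \<equiv> (\<Sum>\<^sub>\<infinity>x. (norm (d x))\<^sup>2)"

lemma summable_on_int_gaussian:
  fixes c :: real
  assumes "c > 0"
  shows "(\<lambda>n::int. gauss c (of_int n)) summable_on UNIV"
proof -
  have geo: "(\<lambda>n::nat. exp (-c) ^ n) summable_on UNIV"
    using assms by (intro summable_nonneg_imp_summable_on summable_geometric) auto
  have sq: "of_nat n \<le> (of_nat n :: real)^2" for n
    by (metis of_nat_le_iff of_nat_power self_le_power le_0_eq nat_le_linear not_less_eq_eq One_nat_def power_0_left zero_less_numeral zero_power numeral_2_eq_2 le_square power2_eq_square)
  have le: "gauss c (of_nat n) \<le> exp (-c) ^ n" for n :: nat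
    using sq[of n] assms by (simp flip: exp_of_nat_mult add: algebra_simps)
  have nat: "(\<lambda>n::nat. gauss c (of_nat n)) summable_on UNIV"
    by (rule summable_on_comparison_test[OF geo le]) auto
  have 1: "(\<lambda>n::int. gauss c (of_int n)) summable_on range int"
    using nat by (subst summable_on_reindex) (auto simp: o_def)
  have 2: "(\<lambda>n::int. gauss c (of_int n)) summable_on range (\<lambda>n. - int n)"
    using nat by (subst summable_on_reindex) (auto simp: o_def inj_on_def)
  have "range int \<union> range (\<lambda>n. - int n) = UNIV"
    by (auto simp: image_def) (metis nonneg_int_cases neg_int_cases not_less)
  with summable_on_union[OF 1 2] show ?thesis by simp
qed

text \<open>Moving \<open>x\<close> into a period of the lattice costs only a constant factor and half of the exponent, because
\<open>(m - e)\<^sup>2 \<ge> m\<^sup>2 / 2 - 1\<close> whenever \<open>0 \<le> e \<le> 1\<close>. This makes the bound independent of \<open>x\<close>, as Schur's test requires.\<close>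

lemma int_gaussian_lattice_sum:
  fixes c h :: real
  assumes "c > 0" "h > 0"
  obtains K where "K > 0"
    "\<And>x. (\<lambda>n::int. gauss c (x + h * of_int n)) summable_on UNIV"
    "\<And>x. (\<Sum>\<^sub>\<infinity>n::int. gauss c (x + h * of_int n)) \<le> K"
proof -
  define d where "d = c * h^2"
  have "d > 0" using assms by (simp add: d_def)
  define g where "g = (\<lambda>n::int. exp d * gauss (d/2) (of_int n))"
  have g: "g summable_on UNIV"
    unfolding g_def using \<open>d > 0\<close> by (intro summable_on_cmult_right summable_on_int_gaussian) auto
  define K where "K = infsum g UNIV"
  have le: "gauss c (x + h * of_int n) \<le> g (n - \<lfloor>- x / h\<rfloor>)" for x :: real and n :: int
  proof -
    define m where "m = n - \<lfloor>- x / h\<rfloor>"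
    define e where "e = (- x / h) - \<lfloor>- x / h\<rfloor>"
    have e: "0 \<le> e" "e < 1" unfolding e_def by linarith+
    have eq: "x + h * of_int n = h * (of_int m - e)"
      using \<open>h > 0\<close> by (simp add: m_def e_def field_simps)
    have "(of_int m - e)^2 \<ge> (of_int m)^2 / 2 - 1"
    proof -
      have "(of_int m - e)^2 - (of_int m)^2 / 2 + 1 = (of_int m - 2 * e)^2 / 2 + (1 - e^2)"
        by (simp add: power2_eq_square field_simps)
      moreover have "e^2 \<le> 1" using e by (simp add: abs_square_le_1)
      ultimately show ?thesis by (smt (verit) zero_le_power2 divide_nonneg_pos)
    qed
    then have "d * (of_int m - e)^2 \<ge> d * ((of_int m)^2 / 2 - 1)"
      using \<open>d > 0\<close> by (intro mult_left_mono) auto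
    then have "- c * (x + h * of_int n)^2 \<le> d - (d/2) * (of_int m)^2"
      unfolding eq power_mult_distrib by (simp add: d_def algebra_simps)
    then show ?thesis
      unfolding g_def m_def[symmetric] by (simp flip: exp_add)
  qed
  have bij: "bij_betw (\<lambda>n. n - k) UNIV UNIV" for k :: int
    by (rule bij_betwI[where g = "\<lambda>n. n + k"]) auto
  have s: "(\<lambda>n. g (n - k)) summable_on UNIV" for k
    using g summable_on_reindex_bij_betw[OF bij, of g k] by simp
  have i: "(\<Sum>\<^sub>\<infinity>n. g (n - k)) = K" for k
    using infsum_reindex_bij_betw[OF bij, of g k] by (simp add: K_def)
  have summ: "(\<lambda>n::int. gauss c (x + h * of_int n)) summable_on UNIV" for x
    by (rule summable_on_comparison_test[OF s le]) auto
  have "(\<Sum>\<^sub>\<infinity>n::int. gauss c (x + h * of_int n)) \<le> K" for x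
    using infsum_mono[OF summ s le] i by metis
  moreover have "K \<ge> 0" unfolding K_def g_def by (intro infsum_nonneg) auto
  ultimately show ?thesis
    using summ by (intro that[of "K + 1"]) (auto intro: add_increasing2)
qed

lemma exp_linear_le_gaussian:
  fixes s x e :: real
  assumes "e > 0"
  shows "exp (s * x) \<le> exp (s^2 / (4 * e)) * exp (e * x^2)"
proof -
  have "s^2 / (4 * e) + e * x^2 - s * x = e * (x - s / (2 * e))^2"
    using assms by (simp add: power2_eq_square field_simps)
  also have "\<dots> \<ge> 0" using assms by simp
  finally show ?thesis by (simp flip: exp_add)
qed

lemma poly_le_gaussian:
  fixes p :: "complex poly"
  assumes "e > 0"
  obtains C where "C > 0" "\<And>x::real. norm (poly p (of_real x)) \<le> C * exp (e * x^2)"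
proof -
  have "\<exists>C>0. \<forall>x::real. norm (poly p (of_real x)) \<le> C * exp (e * x^2)"
    using assms
  proof (induction p arbitrary: e)
    case 0
    then show ?case by (intro exI[of _ 1]) auto
  next
    case (pCons a p)
    obtain C where C: "C > 0" "\<And>x::real. norm (poly p (of_real x)) \<le> C * exp (e/2 * x^2)"
      using pCons.IH[of "e/2"] pCons.prems by auto
    define D where "D = 2 * exp (1 / (2 * e))"
    have x: "\<bar>x\<bar> \<le> D * exp (e/2 * x^2)" for x :: real
    proof -
      have "\<bar>x\<bar> \<le> exp (1 * \<bar>x\<bar>)" using exp_ge_add_one_self[of "\<bar>x\<bar>"] unfolding mult_1 by linarith
      also have "\<dots> \<le> exp (1^2 / (4 * (e/2))) * exp (e/2 * \<bar>x\<bar>^2)"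
        using pCons.prems by (intro exp_linear_le_gaussian) auto
      also have "\<dots> \<le> D * exp (e/2 * x^2)" by (simp add: D_def)
      finally show ?thesis .
    qed
    have "norm (poly (pCons a p) (of_real x)) \<le> (norm a + D * C) * exp (e * x^2)" for x :: real
    proof -
      have "norm (poly (pCons a p) (of_real x)) \<le> norm a + \<bar>x\<bar> * norm (poly p (of_real x))"
        by simp (metis norm_mult norm_of_real norm_triangle_ineq)
      also have "\<dots> \<le> norm a * exp (e * x^2) + (D * exp (e/2 * x^2)) * (C * exp (e/2 * x^2))"
        using pCons.prems C(1) by (intro add_mono mult_mono x C(2)) (auto simp: mult_le_cancel_left1 D_def)
      also have "\<dots> = (norm a + D * C) * exp (e * x^2)"
        by (simp add: algebra_simps flip: exp_add)
      finally show ?thesis .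
    qed
    moreover have "norm a + D * C > 0" using C by (simp add: D_def add_nonneg_pos)
    ultimately show ?case by blast
  qed
  then show ?thesis using that by blast
qed

lemma has_sum_finite_sum:
  fixes f :: "'i \<Rightarrow> 'a \<Rightarrow> 'b::topological_comm_monoid_add"
  assumes "\<And>i. i \<in> I \<Longrightarrow> (f i has_sum s i) A"
  shows "((\<lambda>x. \<Sum>i\<in>I. f i x) has_sum (\<Sum>i\<in>I. s i)) A"
  using assms by (induction I rule: infinite_finite_induct) (auto intro: has_sum_add)

lemma infsum_finite_sum:
  fixes f :: "'i \<Rightarrow> 'a \<Rightarrow> 'b::{topological_comm_monoid_add, t2_space}"
  assumes "\<And>i. i \<in> I \<Longrightarrow> f i summable_on A"
  shows "(\<lambda>x. \<Sum>i\<in>I. f i x) summable_on A"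
    and "(\<Sum>\<^sub>\<infinity>x\<in>A. \<Sum>i\<in>I. f i x) = (\<Sum>i\<in>I. infsum (f i) A)"
  using has_sum_finite_sum[of I f A "\<lambda>i. infsum (f i) A"] assms
  by (auto intro: has_sum_imp_summable infsumI)

lemma summable_on_abs_bound:
  fixes f :: "'a \<Rightarrow> complex"
  assumes "g summable_on A" "\<And>x. x \<in> A \<Longrightarrow> norm (f x) \<le> (g x :: real)"
  shows "(\<lambda>x. norm (f x)) summable_on A" "f summable_on A"
    "norm (infsum f A) \<le> infsum g A"
proof -
  show 1: "(\<lambda>x. norm (f x)) summable_on A"
    by (rule summable_on_comparison_test[OF assms(1)]) (use assms(2) in auto)
  then show "f summable_on A" by (rule abs_summable_summable)
  have "norm (infsum f A) \<le> infsum (\<lambda>x. norm (f x)) A" using 1 by (rule norm_infsum_bound)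
  also have "\<dots> \<le> infsum g A" by (rule infsum_mono[OF 1 assms])
  finally show "norm (infsum f A) \<le> infsum g A" .
qed

lemma summable_on_product_nonneg:
  fixes f :: "'a \<Rightarrow> real" and g :: "'b \<Rightarrow> real"
  assumes "f summable_on A" "g summable_on B" "\<And>x. f x \<ge> 0" "\<And>y. g y \<ge> 0"
  shows "(\<lambda>(x, y). f x * g y) summable_on A \<times> B"
proof (rule summable_on_SigmaI)
  show "((\<lambda>y. case (x, y) of (x, y) \<Rightarrow> f x * g y) has_sum f x * infsum g B) B" for x
    using assms by (auto intro!: has_sum_cmult_right)
  show "(\<lambda>x. f x * infsum g B) summable_on A"
    by (intro summable_on_cmult_left assms)
qed (use assms in auto)

section \<open>Moments of sequences with Gaussian decay\<close>

definition gaussian_decay :: "real \<Rightarrow> (int \<Rightarrow> complex) \<Rightarrow> bool" where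
  "gaussian_decay k a \<longleftrightarrow> (\<exists>C\<ge>0. \<forall>n. norm (a n) \<le> C * gauss k (of_int n))"

lemma norm_powi_le_gaussian:
  fixes X :: complex
  assumes "X \<noteq> 0" "e > 0"
  obtains C where "C > 0" "\<And>n::int. norm (X powi n) \<le> C * exp (e * (of_int n)^2)"
proof -
  have "norm (X powi n) \<le> exp ((ln (norm X))^2 / (4 * e)) * exp (e * (of_int n)^2)" for n :: int
  proof -
    have "norm (X powi n) = exp (ln (norm X)) powi n" using assms by (simp add: norm_power_int)
    also have "\<dots> = exp (ln (norm X) * of_int n)" by (simp add: exp_power_int mult.commute)
    also have "\<dots> \<le> exp ((ln (norm X))^2 / (4 * e)) * exp (e * (of_int n)^2)"
      by (rule exp_linear_le_gaussian[OF assms(2)])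
    finally show ?thesis .
  qed
  then show ?thesis using that by (metis exp_gt_zero)
qed

text \<open>With \<open>L(X) = \<Sum>\<^sub>n a(n) X\<^sup>n\<close> and the Euler operator \<open>D = X d/dX\<close>, this is \<open>(p(D) L)(X)\<close>. The vanishing of all moments with
\<open>degree p \<le> m\<close> therefore says that \<open>L\<close> has a zero of order greater than \<open>m\<close> at \<open>X\<close>; expressing it through coefficients
avoids derivatives of Laurent series.\<close>

definition moment :: "(int \<Rightarrow> complex) \<Rightarrow> complex poly \<Rightarrow> complex \<Rightarrow> complex" where
  "moment a p X = (\<Sum>\<^sub>\<infinity>n. a n * poly p (of_int n) * X powi n)"

lemma norm_moment_term_le:
  fixes X :: complex
  assumes "X \<noteq> 0" "e > 0"
  obtains C where "C > 0" "\<And>n::int. norm (poly p (of_int n) * X powi n) \<le> C * exp (e * (of_int n)^2)"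
proof -
  obtain C1 where C1: "C1 > 0" "\<And>x::real. norm (poly p (of_real x)) \<le> C1 * exp (e/2 * x^2)"
    using poly_le_gaussian[of "e/2" p] assms by auto
  obtain C2 where C2: "C2 > 0" "\<And>n::int. norm (X powi n) \<le> C2 * exp (e/2 * (of_int n)^2)"
    using norm_powi_le_gaussian[of X "e/2"] assms by auto
  have "norm (poly p (of_int n) * X powi n) \<le> (C1 * C2) * exp (e * (of_int n)^2)" for n :: int
  proof -
    have "norm (poly p (of_int n) * X powi n) \<le> (C1 * exp (e/2 * (of_int n)^2)) * (C2 * exp (e/2 * (of_int n)^2))"
      using C1(2)[of "of_int n"] C2(2)[of n] C1(1) unfolding norm_mult
      by (intro mult_mono) (auto simp: zero_le_mult_iff)
    also have "\<dots> = (C1 * C2) * exp (e * (of_int n)^2)" by (simp add: algebra_simps flip: exp_add)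
    finally show ?thesis .
  qed
  then show ?thesis using that[of "C1 * C2"] C1(1) C2(1) by simp
qed

lemma moment_abs_summable:
  assumes "gaussian_decay k a" "k > 0" "X \<noteq> 0"
  shows "(\<lambda>n. norm (a n * poly p (of_int n) * X powi n)) summable_on UNIV"
proof -
  obtain C where C: "C \<ge> 0" "\<And>n. norm (a n) \<le> C * gauss k (of_int n)"
    using assms(1) by (auto simp: gaussian_decay_def)
  obtain D where D: "D > 0" "\<And>n::int. norm (poly p (of_int n) * X powi n) \<le> D * exp (k/2 * (of_int n)^2)"
    using norm_moment_term_le[of X "k/2" p] assms by auto
  show ?thesis
  proof (rule summable_on_abs_bound(1))
    show "(\<lambda>n::int. C * D * gauss (k/2) (of_int n)) summable_on UNIV"
      using assms by (intro summable_on_cmult_right summable_on_int_gaussian) auto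
    fix n
    have "norm (a n * poly p (of_int n) * X powi n) = norm (a n) * norm (poly p (of_int n) * X powi n)"
      by (simp add: norm_mult)
    also have "\<dots> \<le> (C * gauss k (of_int n)) * (D * exp (k/2 * (of_int n)^2))"
      using C D by (intro mult_mono) auto
    also have "\<dots> = C * D * gauss (k/2) (of_int n)" by (simp add: algebra_simps flip: exp_add)
    finally show "norm (a n * poly p (of_int n) * X powi n) \<le> C * D * gauss (k/2) (of_int n)" .
  qed
qed

definition convolution :: "(int \<Rightarrow> complex) \<Rightarrow> (int \<Rightarrow> complex) \<Rightarrow> int \<Rightarrow> complex" where
  "convolution b c n = (\<Sum>\<^sub>\<infinity>m. b m * c (n - m))"

lemma complete_square_two_gaussians:
  fixes k l u v :: real
  assumes "k + l > 0"
  shows "- k * u^2 - l * (v - u)^2 = - (k * l / (k + l)) * v^2 - (k + l) * (u - l * v / (k + l))^2"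
proof -
  define w where "w = l * v / (k + l)"
  have w: "(k + l) * w = l * v" using assms by (simp add: w_def)
  have 1: "(k * l / (k + l)) * v^2 = k * v * w" by (simp add: w_def power2_eq_square[of v])
  have 2: "- k * u^2 - l * (v - u)^2 = - (k * v * w) - (k + l) * (u - w)^2"
    using w by algebra
  show ?thesis using 2 unfolding w_def[symmetric] mult_minus_left 1 .
qed

text \<open>The minimum of \<open>k * u\<^sup>2 + l * (v - u)\<^sup>2\<close> over \<open>u\<close> is \<open>k * l / (k + l) * v\<^sup>2\<close>. Starting from rate \<open>k\<close> this rate gives
\<open>k / N\<close> for an \<open>N\<close>-fold convolution, and this exact value is what leads to the condition \<open>\<beta> < 1 / N\<close>.\<close>

lemma gaussian_decay_convolution:
  assumes "gaussian_decay k b" "gaussian_decay l c" "k > 0" "l > 0"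
  shows "gaussian_decay (k * l / (k + l)) (convolution b c)"
proof -
  obtain B where B: "B \<ge> 0" "\<And>n. norm (b n) \<le> B * gauss k (of_int n)"
    using assms(1) by (auto simp: gaussian_decay_def)
  obtain C where C: "C \<ge> 0" "\<And>n. norm (c n) \<le> C * gauss l (of_int n)"
    using assms(2) by (auto simp: gaussian_decay_def)
  obtain K where K: "K > 0"
    "\<And>x. (\<lambda>n::int. exp (- (k + l) * (x + 1 * of_int n)^2)) summable_on UNIV"
    "\<And>x. (\<Sum>\<^sub>\<infinity>n::int. exp (- (k + l) * (x + 1 * of_int n)^2)) \<le> K"
    using int_gaussian_lattice_sum[of "k + l" 1] assms by auto
  let ?r = "k * l / (k + l)"
  have "norm (convolution b c n) \<le> (B * C * K) * gauss ?r (of_int n)" for n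
  proof -
    let ?x = "- (l * of_int n / (k + l))"
    let ?g = "\<lambda>m::int. (B * C * gauss ?r (of_int n)) * exp (- (k + l) * (?x + 1 * of_int m)^2)"
    have g: "?g summable_on UNIV" by (intro summable_on_cmult_right K)
    have le: "norm (b m * c (n - m)) \<le> ?g m" for m
    proof -
      have "norm (b m * c (n - m)) \<le> (B * gauss k (of_int m)) * (C * gauss l (of_int (n - m)))"
        unfolding norm_mult using B(1) by (intro mult_mono B(2) C(2)) auto
      also have "\<dots> = B * C * exp (- k * (of_int m)^2 - l * (of_int n - of_int m)^2)"
        by (simp add: algebra_simps flip: exp_add)
      also have "- k * (of_int m)^2 - l * (of_int n - of_int m)^2
          = - ?r * (of_int n)^2 - (k + l) * (?x + 1 * of_int m)^2"
        using complete_square_two_gaussians[of k l "of_int m" "of_int n"] assms by simp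
      also have "B * C * exp \<dots> = ?g m" unfolding mult.assoc by (simp add: algebra_simps flip: exp_add)
      finally show ?thesis .
    qed
    have "norm (convolution b c n) \<le> infsum ?g UNIV"
      unfolding convolution_def by (rule summable_on_abs_bound(3)[OF g le])
    also have "\<dots> = (B * C * gauss ?r (of_int n)) * (\<Sum>\<^sub>\<infinity>m::int. exp (- (k + l) * (?x + 1 * of_int m)^2))"
      by (rule infsum_cmult_right) (rule K(2))
    also have "\<dots> \<le> (B * C * gauss ?r (of_int n)) * K"
      using B C by (intro mult_left_mono K) auto
    finally show ?thesis by (simp add: mult_ac)
  qed
  moreover have "B * C * K \<ge> 0" using B C K by auto
  ultimately show ?thesis unfolding gaussian_decay_def by blast
qed

text \<open>Convolution multiplies the Laurent series; the polynomial factor is redistributed by \<open>p(m + n) = (p \<circ> [:m, 1:])(n)\<close>.\<close>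

lemma moment_convolution:
  assumes b: "gaussian_decay k b" and c: "gaussian_decay l c" and kl: "k > 0" "l > 0" and X: "X \<noteq> 0"
  shows "moment (convolution b c) p X
    = (\<Sum>\<^sub>\<infinity>m. b m * X powi m * moment c (pcompose p [:of_int m, 1:]) X)"
proof -
  obtain B where B: "B \<ge> 0" "\<And>n. norm (b n) \<le> B * gauss k (of_int n)"
    using b by (auto simp: gaussian_decay_def)
  obtain C where C: "C \<ge> 0" "\<And>n. norm (c n) \<le> C * gauss l (of_int n)"
    using c by (auto simp: gaussian_decay_def)
  define e where "e = min k l / 4"
  have e: "e > 0" "4 * e \<le> k" "4 * e \<le> l" using kl by (auto simp: e_def)
  obtain D where D: "D > 0" "\<And>n::int. norm (poly p (of_int n) * X powi n) \<le> D * exp (e * (of_int n)^2)"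
    using norm_moment_term_le[of X e p] X e by auto
  define F where "F = (\<lambda>(m, n). b m * c n * (poly p (of_int (m + n)) * X powi (m + n)))"
  have ab: "(\<lambda>x. norm (F x)) summable_on UNIV \<times> UNIV"
  proof (rule summable_on_abs_bound(1))
    have s: "(\<lambda>n::int. gauss (2 * e) (of_int n)) summable_on UNIV"
      using e by (intro summable_on_int_gaussian) auto
    have "(\<lambda>x. case x of (m::int, n::int) \<Rightarrow> gauss (2 * e) (of_int m) * gauss (2 * e) (of_int n)) summable_on UNIV \<times> UNIV"
      by (rule summable_on_product_nonneg[OF s s]) auto
    then show "(\<lambda>x. (B * C * D) * (case x of (m::int, n::int) \<Rightarrow> gauss (2 * e) (of_int m) * gauss (2 * e) (of_int n))) summable_on UNIV \<times> UNIV"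
      by (rule summable_on_cmult_right)
    fix x :: "int \<times> int"
    obtain m n where x: "x = (m, n)" by force
    have "norm (F x) \<le> (B * gauss k (of_int m)) * (C * gauss l (of_int n)) * (D * exp (e * (of_int (m + n))^2))"
      unfolding F_def x prod.case norm_mult[of "_ * _" "_ * _"] norm_mult[of "b m" "c n"]
      using B(1) C(1) D(1) by (intro mult_mono B(2) C(2) D(2)) auto
    also have "\<dots> = B * C * D * exp (- k * (of_int m)^2 - l * (of_int n)^2 + e * (of_int m + of_int n)^2)"
      by (simp add: algebra_simps flip: exp_add)
    also have "\<dots> \<le> B * C * D * exp (- (2 * e) * (of_int m)^2 - (2 * e) * (of_int n)^2)"
    proof -
      have "(of_int m + of_int n :: real)^2 \<le> 2 * (of_int m)^2 + 2 * (of_int n)^2"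
        using sum_squares_bound[of "of_int m :: real" "of_int n"] by (simp add: power2_sum)
      then have "e * (of_int m + of_int n :: real)^2 \<le> e * (2 * (of_int m)^2 + 2 * (of_int n)^2)"
        using e by (intro mult_left_mono) auto
      moreover have "4 * e * (of_int m)^2 \<le> k * (of_int m)^2" "4 * e * (of_int n)^2 \<le> l * (of_int n)^2"
        using e by (auto intro!: mult_right_mono)
      ultimately have "- k * (of_int m)^2 - l * (of_int n)^2 + e * (of_int m + of_int n)^2
         \<le> - (2 * e) * (of_int m)^2 - (2 * e) * (of_int n)^2" by (simp add: algebra_simps)
      then show ?thesis using B C D by (intro mult_left_mono) auto
    qed
    also have "\<dots> = B * C * D * (gauss (2 * e) (of_int m) * gauss (2 * e) (of_int n))"
      by (simp flip: exp_add)
    finally show "norm (F x) \<le> B * C * D * (case x of (m::int, n::int) \<Rightarrow> gauss (2 * e) (of_int m) * gauss (2 * e) (of_int n))"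
      by (simp add: x)
  qed
  then have sF: "F summable_on UNIV \<times> UNIV" by (rule abs_summable_summable)
  have bij: "bij_betw (\<lambda>(n, m). (m, n - m)) (UNIV \<times> UNIV) (UNIV \<times> (UNIV :: int set))"
    by (rule bij_betwI[where g = "\<lambda>(m, n). (m + n, m)"]) auto
  have sF': "(\<lambda>(n, m). F (m, n - m)) summable_on UNIV \<times> UNIV"
    using sF summable_on_reindex_bij_betw[OF bij, of F] by (simp add: case_prod_unfold)
  have "moment (convolution b c) p X = (\<Sum>\<^sub>\<infinity>n. \<Sum>\<^sub>\<infinity>m. F (m, n - m))"
    unfolding moment_def convolution_def F_def
    by (simp add: mult.assoc flip: infsum_cmult_left')
  also have "\<dots> = infsum (\<lambda>(n, m). F (m, n - m)) (UNIV \<times> UNIV)"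
    using infsum_Sigma'_banach[OF sF'] by simp
  also have "\<dots> = infsum F (UNIV \<times> UNIV)"
    using infsum_reindex_bij_betw[OF bij, of F] by (simp add: case_prod_unfold)
  also have "\<dots> = (\<Sum>\<^sub>\<infinity>m. \<Sum>\<^sub>\<infinity>n. F (m, n))"
    using infsum_Sigma_banach[OF sF] by simp
  also have "\<dots> = (\<Sum>\<^sub>\<infinity>m. b m * X powi m * moment c (pcompose p [:of_int m, 1:]) X)"
  proof (rule infsum_cong)
    fix m
    have "(\<Sum>\<^sub>\<infinity>n. F (m, n)) = (\<Sum>\<^sub>\<infinity>n. (b m * X powi m) * (c n * poly (pcompose p [:of_int m, 1:]) (of_int n) * X powi n))"
      using X by (intro infsum_cong) (simp add: F_def poly_pcompose power_int_add algebra_simps)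
    then show "(\<Sum>\<^sub>\<infinity>n. F (m, n)) = b m * X powi m * moment c (pcompose p [:of_int m, 1:]) X"
      by (simp add: moment_def infsum_cmult_right')
  qed
  finally show ?thesis .
qed

text \<open>The exponent is shifted by one: \<open>convolution_power b m\<close> holds the coefficients of \<open>L\<^bsup>m + 1\<^esup>\<close>.\<close>

primrec convolution_power :: "(int \<Rightarrow> complex) \<Rightarrow> nat \<Rightarrow> int \<Rightarrow> complex" where
  "convolution_power b 0 = b"
| "convolution_power b (Suc m) = convolution b (convolution_power b m)"

lemma gaussian_decay_convolution_power:
  assumes "gaussian_decay k b" "k > 0"
  shows "gaussian_decay (k / real (Suc m)) (convolution_power b m)"
proof (induction m)
  case (Suc m)
  have "gaussian_decay (k * (k / real (Suc m)) / (k + k / real (Suc m))) (convolution_power b (Suc m))"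
    unfolding convolution_power.simps
    by (rule gaussian_decay_convolution[OF assms(1) Suc]) (use assms in auto)
  also have "k * (k / real (Suc m)) / (k + k / real (Suc m)) = k / real (Suc (Suc m))"
  proof -
    have "k * real m + k * 2 > 0" using assms(2) by (simp add: add_nonneg_pos)
    then show ?thesis using assms(2) by (simp add: divide_simps) (simp add: algebra_simps)
  qed
  finally show ?case .
qed (use assms in simp)

lemma degree_shift_diff:
  fixes p :: "complex poly"
  assumes "degree p \<le> Suc r"
  shows "degree (pcompose p [:c, 1:] - p) \<le> r"
    and "coeff (pcompose p [:c, 1:] - p) r = of_nat (Suc r) * c * coeff p (Suc r)"
proof -
  have co: "coeff (pcompose p [:c, 1:]) j
      = (\<Sum>i\<le>Suc r. coeff p i * (of_nat (i choose j) * c ^ (i - j)))" if "j \<le> Suc r" for j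
  proof -
    have "pcompose p [:c, 1:] = (\<Sum>i\<le>Suc r. smult (coeff p i) ([:c, 1:] ^ i))"
    proof -
      have "p = (\<Sum>i\<le>Suc r. monom (coeff p i) i)"
        using assms by (rule poly_as_sum_of_monoms'[symmetric])
      then have "pcompose p [:c, 1:] = (\<Sum>i\<le>Suc r. pcompose (monom (coeff p i) i) [:c, 1:])"
        by (metis (no_types) pcompose_sum)
      moreover have "pcompose ([:0, 1:] ^ i) [:c, 1:] = [:c, 1:] ^ i" for i
        by (induction i) (simp_all add: pcompose_1 pcompose_mult pcompose_pCons)
      ultimately show ?thesis by (simp add: monom_altdef pcompose_smult)
    qed
    moreover have "coeff ([:c, 1:] ^ i) j = of_nat (i choose j) * c ^ (i - j)" for i
    proof (cases "j \<le> i")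
      case False
      then have "degree ([:c, 1:] ^ i) < j" by (simp add: degree_linear_power)
      with False show ?thesis by (simp add: coeff_eq_0 binomial_eq_0)
    qed (simp add: coeff_linear_poly_power)
    ultimately show ?thesis
      by (simp only: coeff_sum coeff_smult)
  qed
  have top: "coeff (pcompose p [:c, 1:]) (Suc r) = coeff p (Suc r)"
  proof -
    have "(\<Sum>i\<le>Suc r. coeff p i * (of_nat (i choose Suc r) * c ^ (i - Suc r)))
       = (\<Sum>i\<in>{Suc r}. coeff p i * (of_nat (i choose Suc r) * c ^ (i - Suc r)))"
      by (rule sum.mono_neutral_right) (auto simp: binomial_eq_0)
    then show ?thesis by (subst co) auto
  qed
  have nxt: "coeff (pcompose p [:c, 1:]) r = coeff p r + of_nat (Suc r) * c * coeff p (Suc r)"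
  proof -
    have "(\<Sum>i\<le>Suc r. coeff p i * (of_nat (i choose r) * c ^ (i - r)))
       = (\<Sum>i\<in>{r, Suc r}. coeff p i * (of_nat (i choose r) * c ^ (i - r)))"
      by (rule sum.mono_neutral_right) (auto simp: binomial_eq_0)
    then show ?thesis by (subst co) auto
  qed
  have "degree (pcompose p [:c, 1:]) \<le> Suc r"
    using assms by (simp add: degree_pcompose)
  then have "degree (pcompose p [:c, 1:] - p) \<le> Suc r"
    using assms by (intro degree_diff_le) auto
  moreover have "coeff (pcompose p [:c, 1:] - p) (Suc r) = 0" using top by simp
  ultimately show "degree (pcompose p [:c, 1:] - p) \<le> r"
    by (metis degree_le le_less_linear coeff_eq_0 le_antisym not_less_eq_eq less_le_trans le_degree nat_less_le leading_coeff_0_iff degree_0 le0)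
  show "coeff (pcompose p [:c, 1:] - p) r = of_nat (Suc r) * c * coeff p (Suc r)"
    using nxt by simp
qed

lemma moment_add_poly:
  assumes "gaussian_decay k a" "k > 0" "X \<noteq> 0"
  shows "moment a (p + q) X = moment a p X + moment a q X"
proof -
  have *: "(\<lambda>n. a n * poly r (of_int n) * X powi n) summable_on UNIV" for r
    by (rule abs_summable_summable[OF moment_abs_summable[OF assms]])
  show ?thesis
    unfolding moment_def infsum_add[OF * *, symmetric] by (simp add: algebra_simps)
qed

lemma moment_minus_poly: "moment a (- p) X = - moment a p X"
  unfolding moment_def by (simp add: infsum_uminus)

lemma moment_diff_poly:
  assumes "gaussian_decay k a" "k > 0" "X \<noteq> 0"
  shows "moment a (p - q) X = moment a p X - moment a q X"
  using moment_add_poly[OF assms, of p "- q"] moment_minus_poly[of a q X] by simp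

lemma moment_const: "moment a [:c:] X = c * moment a 1 X"
  unfolding moment_def infsum_cmult_right'[symmetric] by (simp add: mult_ac)

text \<open>If \<open>L(X) = 0\<close> then \<open>L\<^bsup>m + 1\<^esup>\<close> has a zero of order at least \<open>m + 1\<close> at \<open>X\<close>. In the induction step \<open>p(m' + n)\<close> differs from
\<open>p(n)\<close> by a polynomial in \<open>n\<close> of smaller degree, which the induction hypothesis annihilates, so that the inner sum does not
depend on \<open>m'\<close> and the outer sum produces a factor \<open>L(X) = 0\<close>.\<close>

lemma moment_convolution_power_eq_0:
  assumes b: "gaussian_decay k b" "k > 0" and X: "X \<noteq> 0" and 0: "moment b 1 X = 0"
    and "degree p \<le> m"
  shows "moment (convolution_power b m) p X = 0"
  using \<open>degree p \<le> m\<close>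
proof (induction m arbitrary: p)
  case 0
  then obtain c where "p = [:c:]" by (metis degree_eq_zeroE le_zero_eq)
  then show ?case using assms(4) by (simp add: moment_const)
next
  case (Suc m)
  let ?c = "convolution_power b m"
  have c: "gaussian_decay (k / real (Suc m)) ?c" "k / real (Suc m) > 0"
    using gaussian_decay_convolution_power[OF b] b by auto
  have shift: "moment ?c (pcompose p [:of_int n, 1:]) X = moment ?c p X" for n
    using Suc.IH[OF degree_shift_diff(1)[OF Suc.prems, of "of_int n"]]
      moment_diff_poly[OF c X, of "pcompose p [:of_int n, 1:]" p] by simp
  have "moment (convolution_power b (Suc m)) p X = (\<Sum>\<^sub>\<infinity>n. b n * X powi n * moment ?c p X)"
    unfolding convolution_power.simps moment_convolution[OF b(1) c(1) b(2) c(2) X] shift ..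
  also have "\<dots> = moment b 1 X * moment ?c p X"
    by (simp add: infsum_cmult_left' moment_def)
  finally show ?case using 0 by simp
qed

lemma moment_convolution_power_1:
  assumes b: "gaussian_decay k b" "k > 0" and X: "X \<noteq> 0"
  shows "moment (convolution_power b m) 1 X = moment b 1 X ^ Suc m"
proof (induction m)
  case (Suc m)
  have c: "gaussian_decay (k / real (Suc m)) (convolution_power b m)" "k / real (Suc m) > 0"
    using gaussian_decay_convolution_power[OF b] b by auto
  have "moment (convolution_power b (Suc m)) 1 X = (\<Sum>\<^sub>\<infinity>n. b n * X powi n * moment (convolution_power b m) 1 X)"
    unfolding convolution_power.simps moment_convolution[OF b(1) c(1) b(2) c(2) X] by (simp add: pcompose_1)
  also have "\<dots> = moment b 1 X * moment (convolution_power b m) 1 X"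
    by (simp add: infsum_cmult_left' moment_def)
  finally show ?case using Suc by simp
qed simp

text \<open>The coefficients of \<open>(X - 1)\<^sup>r L(X)\<close>. This series inherits the zeros of \<open>L\<close> and has in addition a zero of order exactly
\<open>r\<close> at \<open>1\<close> when \<open>L(1) \<noteq> 0\<close>; the values \<open>r < N\<close> serve to separate the \<open>N\<close> polynomial factors.\<close>

primrec backward_difference :: "nat \<Rightarrow> (int \<Rightarrow> complex) \<Rightarrow> int \<Rightarrow> complex" where
  "backward_difference 0 a = a"
| "backward_difference (Suc r) a = (\<lambda>n. backward_difference r a (n - 1) - backward_difference r a n)"

lemma gaussian_decay_shift_diff:
  assumes "gaussian_decay k a" "0 < l" "l < k"
  shows "gaussian_decay l (\<lambda>n. a (n - 1) - a n)"
proof -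
  obtain C where C: "C \<ge> 0" "\<And>n. norm (a n) \<le> C * gauss k (of_int n)"
    using assms(1) by (auto simp: gaussian_decay_def)
  define D where "D = exp ((2 * k)^2 / (4 * (k - l)))"
  have "norm (a (n - 1) - a n) \<le> (C * D + C) * gauss l (of_int n)" for n
  proof -
    have "gauss k (of_int (n - 1)) = exp (- k) * exp ((2 * k) * of_int n) * gauss k (of_int n)"
      by (simp add: algebra_simps power2_eq_square flip: exp_add)
    also have "\<dots> \<le> 1 * (D * exp ((k - l) * (of_int n)^2)) * gauss k (of_int n)"
      unfolding D_def using assms
      by (intro mult_mono exp_linear_le_gaussian) auto
    also have "\<dots> = D * gauss l (of_int n)"
      by (simp add: algebra_simps flip: exp_add)
    finally have "C * gauss k (of_int (n - 1)) \<le> C * D * gauss l (of_int n)"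
      using C(1) by (metis mult.assoc mult_left_mono)
    moreover have "C * gauss k (of_int n) \<le> C * gauss l (of_int n)"
      using C(1) assms by (intro mult_left_mono) (auto intro!: mult_right_mono)
    ultimately show ?thesis
      using norm_triangle_ineq4[of "a (n - 1)" "a n"] C(2)[of n] C(2)[of "n - 1"]
      by (simp add: algebra_simps)
  qed
  moreover have "C * D + C \<ge> 0" using C by (simp add: D_def)
  ultimately show ?thesis unfolding gaussian_decay_def by blast
qed

text \<open>Every single difference loses an arbitrarily small part of the rate, so the induction carries some rate strictly between
\<open>l\<close> and \<open>k\<close>.\<close>

lemma gaussian_decay_backward_difference:
  assumes "gaussian_decay k a" "0 < l" "l < k"
  shows "gaussian_decay l (backward_difference r a)"
proof -
  have "\<exists>l'>l. gaussian_decay l' (backward_difference r a)"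
  proof (induction r)
    case 0
    then show ?case using assms by auto
  next
    case (Suc r)
    then obtain l' where l': "l' > l" "gaussian_decay l' (backward_difference r a)" by auto
    then have "gaussian_decay ((l + l') / 2) (backward_difference (Suc r) a)"
      using assms by (simp add: gaussian_decay_shift_diff)
    then show ?case using l' by (intro exI[of _ "(l + l') / 2"]) auto
  qed
  then obtain l' C where l': "l' > l" and C: "C \<ge> 0" "\<And>n. norm (backward_difference r a n) \<le> C * exp (- l' * (of_int n)^2)"
    unfolding gaussian_decay_def by blast
  have "norm (backward_difference r a n) \<le> C * gauss l (of_int n)" for n
    using l' C(1) by (intro order_trans[OF C(2)] mult_left_mono) (auto intro!: mult_right_mono)
  then show ?thesis using C(1) unfolding gaussian_decay_def by blast
qed

lemma moment_shift_diff:
  assumes a: "gaussian_decay k a" "k > 0" and X: "X \<noteq> 0"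
  shows "moment (\<lambda>n. a (n - 1) - a n) p X = X * moment a (pcompose p [:1, 1:]) X - moment a p X"
proof -
  have s: "(\<lambda>n. a n * poly r (of_int n) * X powi n) summable_on UNIV" for r
    by (rule abs_summable_summable[OF moment_abs_summable[OF a X]])
  have bij: "bij_betw (\<lambda>n. n - 1) UNIV (UNIV :: int set)"
    by (rule bij_betwI[where g = "\<lambda>n. n + 1"]) auto
  define f where "f = (\<lambda>n. X * (a n * poly (pcompose p [:1, 1:]) (of_int n) * X powi n))"
  have f: "f summable_on UNIV" unfolding f_def by (intro summable_on_cmult_right s)
  have eq: "f (n - 1) = a (n - 1) * poly p (of_int n) * X powi n" for n
    using X by (simp add: f_def poly_pcompose power_int_diff)
  have f': "(\<lambda>n. f (n - 1)) summable_on UNIV"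
    using f summable_on_reindex_bij_betw[OF bij, of f] by simp
  have "infsum f UNIV = (\<Sum>\<^sub>\<infinity>n. f (n - 1))"
    using infsum_reindex_bij_betw[OF bij, of f] by simp
  moreover have "infsum f UNIV = X * moment a (pcompose p [:1, 1:]) X"
    unfolding f_def moment_def by (rule infsum_cmult_right')
  moreover have "moment (\<lambda>n. a (n - 1) - a n) p X = (\<Sum>\<^sub>\<infinity>n. f (n - 1) + - (a n * poly p (of_int n) * X powi n))"
    unfolding moment_def eq by (simp add: algebra_simps)
  moreover have "\<dots> = (\<Sum>\<^sub>\<infinity>n. f (n - 1)) + (\<Sum>\<^sub>\<infinity>n. - (a n * poly p (of_int n) * X powi n))"
    by (intro infsum_add f' summable_on_uminus[THEN iffD2] s)
  ultimately show ?thesis by (simp add: infsum_uminus moment_def)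
qed

lemma gaussian_decay_backward_difference_half:
  assumes "gaussian_decay k a" "k > 0"
  shows "gaussian_decay (k/2) (backward_difference r a)" "k / 2 > 0"
  using gaussian_decay_backward_difference[OF assms(1), of "k/2"] assms by auto

lemma moment_backward_difference_eq_0:
  assumes a: "gaussian_decay k a" "k > 0" and X: "X \<noteq> 0"
    and 0: "\<And>p. degree p \<le> m \<Longrightarrow> moment a p X = 0" and p: "degree p \<le> m"
  shows "moment (backward_difference r a) p X = 0"
  using p
proof (induction r arbitrary: p)
  case (Suc r)
  then show ?case
    using moment_shift_diff[OF gaussian_decay_backward_difference_half[OF a] X, of r p]
    by (simp add: degree_pcompose)
qed (use 0 in simp)

text \<open>Summation by parts moves the differences onto \<open>p\<close>, and the \<open>r\<close>-th difference of a polynomial of degree at most \<open>r\<close> is the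
constant \<open>r!\<close> times its coefficient of index \<open>r\<close>.\<close>

lemma moment_backward_difference_at_1:
  assumes a: "gaussian_decay k a" "k > 0" and p: "degree p \<le> r"
  shows "moment (backward_difference r a) p 1 = fact r * coeff p r * moment a 1 1"
  using p
proof (induction r arbitrary: p)
  case 0
  then obtain c where "p = [:c:]" by (metis degree_eq_zeroE le_zero_eq)
  then show ?case by (simp add: moment_const)
next
  case (Suc r)
  note d = gaussian_decay_backward_difference_half(1)[OF a, of r] gaussian_decay_backward_difference_half(2)[OF a]
  have "moment (backward_difference (Suc r) a) p 1 = moment (backward_difference r a) (pcompose p [:1, 1:] - p) 1"
    using moment_shift_diff[OF d, of 1 p] moment_diff_poly[OF d, of 1 "pcompose p [:1, 1:]" p] by simp
  also have "\<dots> = fact r * coeff (pcompose p [:1, 1:] - p) r * moment a 1 1"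
    by (rule Suc.IH[OF degree_shift_diff(1)[OF Suc.prems]])
  also have "\<dots> = fact (Suc r) * coeff p (Suc r) * moment a 1 1"
    unfolding degree_shift_diff(2)[OF Suc.prems] by simp
  finally show ?case .
qed

section \<open>A Laurent series vanishing on a geometric progression except at 1\<close>

lemma moment_1: "moment a 1 X = (\<Sum>\<^sub>\<infinity>n. a n * X powi n)"
  by (simp add: moment_def)

text \<open>The coefficients of the Jacobi theta series \<open>\<Sum>\<^sub>n (- 1)\<^sup>n q\<^bsup>n (n - 1) / 2\<^esup> X\<^sup>n\<close> with \<open>q = exp (- 2 * r)\<close>.\<close>

definition theta_coeff :: "real \<Rightarrow> int \<Rightarrow> complex" where
  "theta_coeff r n = (if even n then 1 else - 1) * of_real (exp (- r * ((of_int n)^2 - of_int n)))"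

lemma norm_theta_coeff: "norm (theta_coeff r n) = exp (- r * ((of_int n)^2 - of_int n))"
  by (simp add: theta_coeff_def norm_mult)

lemma theta_coeff_gaussian_decay:
  assumes "k < r"
  shows "gaussian_decay k (theta_coeff r)"
proof -
  have "norm (theta_coeff r n) \<le> exp (r^2 / (4 * (r - k))) * gauss k (of_int n)" for n
  proof -
    have "norm (theta_coeff r n) = exp (r * of_int n) * gauss r (of_int n)"
      unfolding norm_theta_coeff by (simp add: algebra_simps flip: exp_add)
    also have "\<dots> \<le> (exp (r^2 / (4 * (r - k))) * exp ((r - k) * (of_int n)^2)) * gauss r (of_int n)"
      using assms by (intro mult_right_mono exp_linear_le_gaussian) auto
    also have "\<dots> = exp (r^2 / (4 * (r - k))) * gauss k (of_int n)"
      by (simp add: algebra_simps flip: exp_add)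
    finally show ?thesis .
  qed
  then show ?thesis unfolding gaussian_decay_def by (intro exI[of _ "exp (r^2 / (4 * (r - k)))"]) auto
qed

lemma exp_powi_int: "(of_real (exp x) :: complex) powi n = of_real (exp (of_int n * x))"
  by (simp add: exp_power_int flip: of_real_power_int)

text \<open>At \<open>X = q\<^bsup>- l\<^esup>\<close> the exponent is symmetric under \<open>n \<mapsto> 2 * l + 1 - n\<close> while the sign changes, so the sum is its own negative.\<close>

lemma moment_theta_coeff_eq_0:
  "moment (theta_coeff r) 1 (of_real (exp (2 * r * of_int l))) = 0"
proof -
  define f where "f = (\<lambda>n. theta_coeff r n * (of_real (exp (2 * r * of_int l))) powi n)"
  have "f (2 * l + 1 - n) = - f n" for n
  proof -
    have "f n = (if even n then 1 else - 1) * of_real (exp (- r * ((of_int n)^2 - of_int n * (1 + 2 * of_int l))))" for n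
      unfolding f_def theta_coeff_def exp_powi_int mult.assoc of_real_mult[symmetric] exp_add[symmetric]
      by (simp add: algebra_simps)
    then show ?thesis by (simp add: algebra_simps power2_eq_square)
  qed
  moreover have "infsum f UNIV = infsum (\<lambda>n. f (2 * l + 1 - n)) UNIV"
  proof -
    have bij: "bij_betw (\<lambda>n. 2 * l + 1 - n) UNIV (UNIV :: int set)"
      by (rule bij_betwI[where g = "\<lambda>n. 2 * l + 1 - n"]) auto
    show ?thesis using infsum_reindex_bij_betw[OF bij, of f] by simp
  qed
  ultimately have "infsum f UNIV = - infsum f UNIV" by (simp add: infsum_uminus)
  then show ?thesis by (simp add: moment_1 f_def)
qed

text \<open>At \<open>X = - 1\<close> the signs cancel and all terms are positive.\<close>

lemma moment_theta_coeff_at_minus_1: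
  assumes "r > 0"
  shows "moment (theta_coeff r) 1 (- 1) \<noteq> 0"
proof -
  have dec: "gaussian_decay (r/2) (theta_coeff r)" using assms by (intro theta_coeff_gaussian_decay) auto
  have s: "(\<lambda>n. norm (theta_coeff r n)) summable_on UNIV"
    using moment_abs_summable[OF dec, of 1 1] assms by simp
  have "theta_coeff r n * (- 1) powi n = of_real (norm (theta_coeff r n))" for n
    unfolding norm_theta_coeff by (simp add: theta_coeff_def power_int_minus_left)
  then have "moment (theta_coeff r) 1 (- 1) = of_real (\<Sum>\<^sub>\<infinity>n. norm (theta_coeff r n))"
    unfolding moment_1 using has_sum_of_real[OF has_sum_infsum[OF s], where 'a = complex] by (simp add: infsumI)
  moreover have "(\<Sum>\<^sub>\<infinity>n. norm (theta_coeff r n)) \<noteq> 0"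
    using nonneg_infsum_le_0D[OF _ s, of 0] norm_theta_coeff[of r 0] by force
  ultimately show ?thesis by simp
qed

lemma gaussian_tail_le:
  fixes a :: "int \<Rightarrow> complex"
  assumes a: "\<And>m. norm (a m) \<le> C * gauss k (of_int m)" and k: "k > 0"
    and S: "\<And>m. m \<in> S \<Longrightarrow> n * (m - n) \<ge> 0"
  shows "norm (infsum a S) \<le> C * (\<Sum>\<^sub>\<infinity>m::int. gauss k (of_int m)) * gauss k (of_int n)"
proof -
  let ?g = "\<lambda>m::int. C * gauss k (of_int n) * gauss k (of_int (m - n))"
  have C: "C \<ge> 0" using a[of 0] by simp (metis norm_ge_zero order_trans)
  have bij: "bij_betw (\<lambda>m. m - n) UNIV UNIV"
    by (rule bij_betwI[where g = "\<lambda>m. m + n"]) auto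
  have s0: "(\<lambda>m::int. gauss k (of_int m)) summable_on UNIV" by (rule summable_on_int_gaussian[OF k])
  have s: "(\<lambda>m::int. gauss k (of_int (m - n))) summable_on UNIV"
    using s0 summable_on_reindex_bij_betw[OF bij, of "\<lambda>m::int. gauss k (of_int m)"] by simp
  have i: "(\<Sum>\<^sub>\<infinity>m::int. gauss k (of_int (m - n))) = (\<Sum>\<^sub>\<infinity>m::int. gauss k (of_int m))"
    using infsum_reindex_bij_betw[OF bij, of "\<lambda>m::int. gauss k (of_int m)"] by simp
  have g: "?g summable_on UNIV" by (intro summable_on_cmult_right s)
  have gS: "?g summable_on S" by (rule summable_on_subset[OF g]) auto
  have le: "norm (a m) \<le> ?g m" if "m \<in> S" for m
  proof -
    have "0 \<le> (of_int (n * (m - n)) :: real)" using S[OF that] by (simp only: of_int_0_le_iff)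
    then have "(of_int n)^2 + (of_int (m - n))^2 \<le> (of_int m :: real)^2"
      by (simp add: power2_eq_square algebra_simps)
    then have "k * ((of_int n)^2 + (of_int (m - n))^2) \<le> k * (of_int m :: real)^2"
      using k by (intro mult_left_mono) auto
    then have "gauss k (of_int m) \<le> gauss k (of_int n) * gauss k (of_int (m - n))"
      by (simp add: algebra_simps flip: exp_add)
    from mult_left_mono[OF this C] show ?thesis using a[of m] by (simp add: mult.assoc)
  qed
  have "norm (infsum a S) \<le> infsum ?g S" by (rule summable_on_abs_bound(3)[OF gS le])
  also have "\<dots> \<le> infsum ?g UNIV"
    using C by (intro infsum_mono_neutral[OF gS g]) auto
  also have "\<dots> = C * gauss k (of_int n) * (\<Sum>\<^sub>\<infinity>m::int. gauss k (of_int m))"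
    unfolding i[symmetric] by (rule infsum_cmult_right) (rule s)
  finally show ?thesis by (simp add: mult_ac)
qed

text \<open>The quotient by \<open>X - 1\<close> has the tail sums of \<open>a\<close> as coefficients. They can be taken over the right or, since the total is
\<open>0\<close>, over the left tail; choosing the one that points away from the origin preserves the rate \<open>k\<close> and multiplies the constant
by the fixed number \<open>K\<close>. The explicit constant is needed to iterate the division.\<close>

lemma laurent_divide_linear:
  fixes a :: "int \<Rightarrow> complex"
  assumes a: "\<And>m. norm (a m) \<le> C * gauss k (of_int m)" and k: "k > 0"
    and 0: "moment a 1 1 = 0"
  defines "K \<equiv> (\<Sum>\<^sub>\<infinity>m::int. gauss k (of_int m))"
  obtains b where "\<And>m. norm (b m) \<le> C * K * gauss k (of_int m)"
    and "\<And>X. X \<noteq> 0 \<Longrightarrow> moment a 1 X = (X - 1) * moment b 1 X"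
proof -
  define b where "b = (\<lambda>n. infsum a {n<..})"
  have C: "C \<ge> 0" using a[of 0] by simp (metis norm_ge_zero order_trans)
  have K: "K \<ge> 0" unfolding K_def by (intro infsum_nonneg) auto
  have da: "gaussian_decay k a" using a C unfolding gaussian_decay_def by blast
  have s: "a summable_on UNIV"
    using abs_summable_summable[OF moment_abs_summable[OF da k, of 1 1]] by simp
  have sS: "a summable_on S" for S by (rule summable_on_subset[OF s]) auto
  have "infsum a UNIV = 0" using 0 by (simp add: moment_1)
  moreover have "infsum a UNIV = infsum a {..n} + infsum a {n<..}" for n
  proof -
    have "{..n} \<union> {n<..} = UNIV" "{..n} \<inter> {n<..} = {}" by auto
    then show ?thesis using infsum_Un_disjoint[OF sS[of "{..n}"] sS[of "{n<..}"]] by auto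
  qed
  ultimately have b': "b n = - infsum a {..n}" for n by (simp add: b_def eq_neg_iff_add_eq_0 add.commute)
  have bnd: "norm (b n) \<le> C * K * gauss k (of_int n)" for n
  proof (cases "n \<ge> 0")
    case True
    then show ?thesis unfolding b_def K_def by (intro gaussian_tail_le a k) auto
  next
    case False
    then show ?thesis unfolding b' norm_minus_cancel K_def
      by (intro gaussian_tail_le a k) (auto intro: mult_nonpos_nonpos)
  qed
  have db: "gaussian_decay k b" using bnd C K unfolding gaussian_decay_def by (metis mult_nonneg_nonneg)
  have rec: "a n = b (n - 1) - b n" for n
  proof -
    have "{n - 1<..} = insert n {n<..}" by auto
    then have "b (n - 1) = a n + b n" unfolding b_def by (simp add: infsum_insert sS)
    then show ?thesis by simp
  qed
  have "moment a 1 X = (X - 1) * moment b 1 X" if "X \<noteq> 0" for X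
  proof -
    have "a = (\<lambda>n. b (n - 1) - b n)" using rec by auto
    then show ?thesis using moment_shift_diff[OF db k that, of 1] by (simp add: pcompose_1 algebra_simps)
  qed
  with bnd show ?thesis by (rule that)
qed

text \<open>Both halves of the series are entire, one in \<open>X\<close> and the other in \<open>1 / X\<close>.\<close>

lemma moment_holomorphic:
  assumes "gaussian_decay k a" "k > 0"
  shows "moment a 1 holomorphic_on - {0}"
proof -
  have s: "(\<lambda>n. a n * X powi n) summable_on S" if "X \<noteq> 0" for X S
    using summable_on_subset[OF abs_summable_summable[OF moment_abs_summable[OF assms that, of 1]], of S] by simp
  have entire: "(\<lambda>X. \<Sum>\<^sub>\<infinity>n. c n * X ^ n) holomorphic_on UNIV"
    if c: "\<And>X. X \<noteq> 0 \<Longrightarrow> (\<lambda>n. c n * X ^ n) summable_on UNIV" for c :: "nat \<Rightarrow> complex"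
  proof -
    have "(\<lambda>n. c n * X ^ n) summable_on UNIV" for X
    proof (cases "X = 0")
      case True
      have "(\<lambda>n. c n * 0 ^ n) summable_on {0}" by simp
      also have "?this \<longleftrightarrow> (\<lambda>n. c n * 0 ^ n) summable_on UNIV"
        by (rule summable_on_cong_neutral) auto
      finally show ?thesis using True by simp
    qed (rule c)
    then have sums: "(\<lambda>n. c n * X ^ n) sums (\<Sum>\<^sub>\<infinity>n. c n * X ^ n)" for X
      by (intro has_sum_imp_sums has_sum_infsum)
    have "(\<lambda>X. \<Sum>\<^sub>\<infinity>n. c n * X ^ n) holomorphic_on ball 0 R" for R
      by (rule power_series_holomorphic[where a = c]) (use sums in simp)
    then have "(\<lambda>X. \<Sum>\<^sub>\<infinity>n. c n * X ^ n) field_differentiable at z" for z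
      by (metis holomorphic_on_imp_differentiable_at open_ball mem_ball_0 gt_ex)
    then show ?thesis by (simp add: holomorphic_on_def field_differentiable_at_within)
  qed
  define F where "F = (\<lambda>X. \<Sum>\<^sub>\<infinity>n. a (int n) * X ^ n)"
  define G where "G = (\<lambda>X. \<Sum>\<^sub>\<infinity>n. a (- int n) * X ^ n)"
  have inj: "inj (\<lambda>n. - int n)" by (auto simp: inj_on_def)
  have F: "F holomorphic_on UNIV" unfolding F_def
  proof (rule entire)
    show "(\<lambda>n. a (int n) * X ^ n) summable_on UNIV" if "X \<noteq> 0" for X
      using s[OF that, of "range int"] by (subst (asm) summable_on_reindex) (auto simp: o_def)
  qed
  have G: "G holomorphic_on UNIV" unfolding G_def
  proof (rule entire)
    fix X :: complex assume "X \<noteq> 0"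
    then have "(\<lambda>n. a n * (1 / X) powi n) summable_on range (\<lambda>n. - int n)" by (intro s) simp
    with \<open>X \<noteq> 0\<close> show "(\<lambda>n. a (- int n) * X ^ n) summable_on UNIV"
      unfolding summable_on_reindex[OF inj] by (simp add: o_def power_int_minus power_divide field_simps)
  qed
  have "(G \<circ> (\<lambda>X. 1 / X)) holomorphic_on - {0}"
    by (rule holomorphic_on_compose_gen[OF _ G]) (auto intro!: holomorphic_intros)
  then have "(\<lambda>X. F X + G (1 / X) - a 0) holomorphic_on - {0}"
    using holomorphic_on_subset[OF F] by (intro holomorphic_intros) (auto simp: o_def)
  moreover have "moment a 1 X = F X + G (1 / X) - a 0" if X: "X \<in> - {0}" for X
  proof -
    let ?f = "\<lambda>n. a n * X powi n"
    have "range int \<inter> range (\<lambda>n. - int n) = {0}" by auto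
    moreover have "range int \<union> range (\<lambda>n. - int n) = UNIV"
      by (auto simp: image_def) (metis nonneg_int_cases neg_int_cases not_less)
    ultimately have "infsum ?f UNIV = infsum ?f (range int) + infsum ?f (range (\<lambda>n. - int n)) - infsum ?f {0}"
      using infsum_Un_Int[of ?f "range int" "range (\<lambda>n. - int n)"] s X by auto
    moreover have "infsum ?f (range int) = F X"
      unfolding F_def by (subst infsum_reindex) (auto simp: o_def)
    moreover have "infsum ?f (range (\<lambda>n. - int n)) = G (1 / X)"
      unfolding G_def using X inj
      by (subst infsum_reindex) (auto simp: o_def power_int_minus power_divide field_simps)
    ultimately show ?thesis by (simp add: moment_1)
  qed
  ultimately show ?thesis using holomorphic_cong[of "- {0}" "- {0}" "moment a 1"] by auto
qed

text \<open>A series divisible by every power of \<open>X - 1\<close> with quotients growing at most geometrically is \<open>O((|X - 1| K)\<^sup>m)\<close> for all \<open>m\<close>,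
so it vanishes near \<open>1\<close>, and then on the whole punctured plane by the identity theorem.\<close>

lemma laurent_eq_0_if_divisible_by_all_powers:
  assumes a: "gaussian_decay k a" "k > 0" and K: "K > 0" "C \<ge> 0"
    and b: "\<And>m. \<exists>b. (\<forall>n. norm (b n) \<le> C * K ^ m * gauss k (of_int n))
        \<and> (\<forall>X. X \<noteq> 0 \<longrightarrow> moment a 1 X = (X - 1) ^ m * moment b 1 X)"
    and X: "X \<noteq> 0"
  shows "moment a 1 X = 0"
proof -
  have near: "moment a 1 Y = 0" if Y: "Y \<in> ball 1 (min (1/2) (1 / (2 * K)))" for Y
  proof -
    have d: "norm (Y - 1) < 1/2" "norm (Y - 1) < 1 / (2 * K)"
      using Y by (auto simp: dist_norm norm_minus_commute)
    then have Y0: "Y \<noteq> 0" by auto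
    let ?S = "\<Sum>\<^sub>\<infinity>n::int. gauss k (of_int n) * norm (Y powi n)"
    have "gaussian_decay k (\<lambda>n. of_real (gauss k (of_int n)))"
      unfolding gaussian_decay_def by (intro exI[of _ 1]) auto
    from moment_abs_summable[OF this a(2) Y0, of 1]
    have sS: "(\<lambda>n::int. gauss k (of_int n) * norm (Y powi n)) summable_on UNIV"
      by (simp add: norm_mult)
    have "norm (moment a 1 Y) \<le> (1/2) ^ m * (C * ?S)" for m
    proof -
      obtain b where b1: "\<And>n. norm (b n) \<le> C * K ^ m * gauss k (of_int n)"
        and b2: "moment a 1 Y = (Y - 1) ^ m * moment b 1 Y" using b[of m] Y0 by auto
      have "norm (moment b 1 Y) \<le> (\<Sum>\<^sub>\<infinity>n::int. C * K ^ m * (gauss k (of_int n) * norm (Y powi n)))"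
        unfolding moment_1
      proof (rule summable_on_abs_bound(3))
        show "(\<lambda>n::int. C * K ^ m * (gauss k (of_int n) * norm (Y powi n))) summable_on UNIV"
          by (intro summable_on_cmult_right sS)
        show "norm (b n * Y powi n) \<le> C * K ^ m * (gauss k (of_int n) * norm (Y powi n))" for n
          using mult_right_mono[OF b1[of n] norm_ge_zero[of "Y powi n"]] by (simp add: norm_mult mult_ac)
      qed
      also have "\<dots> = C * K ^ m * ?S" by (rule infsum_cmult_right) (rule sS)
      finally have "norm (moment a 1 Y) \<le> norm (Y - 1) ^ m * (C * K ^ m * ?S)"
        unfolding b2 norm_mult norm_power by (intro mult_left_mono) auto
      also have "\<dots> = (norm (Y - 1) * K) ^ m * (C * ?S)" by (simp add: power_mult_distrib mult_ac)
      also have "\<dots> \<le> (1/2) ^ m * (C * ?S)"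
        using d K by (intro mult_right_mono power_mono mult_nonneg_nonneg infsum_nonneg) (auto simp: field_simps)
      finally show ?thesis .
    qed
    moreover have "(\<lambda>m. (1/2) ^ m * (C * ?S)) \<longlonglongrightarrow> 0 * (C * ?S)"
      by (intro tendsto_intros LIMSEQ_realpow_zero) auto
    ultimately have "norm (moment a 1 Y) \<le> 0 * (C * ?S)"
      by (intro LIMSEQ_le_const[of _ _ "norm (moment a 1 Y)"]) auto
    then show ?thesis by simp
  qed
  let ?U = "ball (1::complex) (min (1/2) (1 / (2 * K)))"
  show ?thesis
  proof (rule analytic_continuation_open[of ?U "- {0}" "moment a 1" "\<lambda>_. 0"])
    show "moment a 1 holomorphic_on - {0}" by (rule moment_holomorphic[OF a])
    show "connected (- {0::complex})" by (rule connected_punctured_universe) simp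
    show "?U \<subseteq> - {0}" by (auto simp: dist_norm)
    show "?U \<noteq> {}" using K by (simp add: min_def)
  qed (use near X in auto)
qed

text \<open>The theta series is not zero at \<open>- 1\<close>, so it can be divided by \<open>X - 1\<close> only finitely often; the last quotient is the desired
series. This replaces the product formula of Jacobi, which shows that the zero at \<open>1\<close> is simple.\<close>

lemma exists_cardinal_laurent:
  assumes "0 < k" "k < r"
  obtains b where "gaussian_decay k b"
    "\<And>l::int. l \<noteq> 0 \<Longrightarrow> moment b 1 (of_real (exp (2 * r * of_int l))) = 0" "moment b 1 1 \<noteq> 0"
proof -
  let ?t = "theta_coeff r"
  have dt: "gaussian_decay k ?t" by (rule theta_coeff_gaussian_decay[OF assms(2)])
  obtain C where C: "C \<ge> 0" "\<And>n. norm (?t n) \<le> C * gauss k (of_int n)"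
    using dt unfolding gaussian_decay_def by blast
  define K where "K = (\<Sum>\<^sub>\<infinity>m::int. gauss k (of_int m))"
  have sK: "(\<lambda>m::int. gauss k (of_int m)) summable_on UNIV" by (rule summable_on_int_gaussian[OF assms(1)])
  have K: "K > 0"
  proof -
    have "K \<ge> (\<Sum>m\<in>{0::int}. gauss k (of_int m))"
      unfolding K_def by (rule finite_sum_le_infsum[OF sK]) auto
    then show ?thesis by simp
  qed
  define P where "P = (\<lambda>m b. (\<forall>n. norm (b n) \<le> C * K ^ m * gauss k (of_int n))
        \<and> (\<forall>X. X \<noteq> 0 \<longrightarrow> moment ?t 1 X = (X - 1) ^ m * moment b 1 X))"
  have "\<exists>m b. P m b \<and> moment b 1 1 \<noteq> 0"
  proof (rule ccontr)
    assume neg: "\<not> ?thesis"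
    have "\<exists>b. P m b" for m
    proof (induction m)
      case 0
      show ?case using C by (intro exI[of _ ?t]) (auto simp: P_def)
    next
      case (Suc m)
      then obtain b where b: "P m b" by blast
      with neg have b0: "moment b 1 1 = 0" by blast
      have bn: "norm (b n) \<le> (C * K ^ m) * gauss k (of_int n)" for n
        using b by (simp add: P_def)
      obtain b' where b': "\<And>n. norm (b' n) \<le> (C * K ^ m) * K * gauss k (of_int n)"
         "\<And>X. X \<noteq> 0 \<Longrightarrow> moment b 1 X = (X - 1) * moment b' 1 X"
        using laurent_divide_linear[OF bn assms(1) b0, folded K_def] by blast
      have "P (Suc m) b'"
        using b b' unfolding P_def by (simp add: mult_ac)
      then show ?case by blast
    qed
    then have "moment ?t 1 (-1) = 0"
      unfolding P_def by (intro laurent_eq_0_if_divisible_by_all_powers[OF dt assms(1) K C(1)]) auto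
    then show False using moment_theta_coeff_at_minus_1 assms by auto
  qed
  then obtain m b where b: "P m b" "moment b 1 1 \<noteq> 0" by blast
  show ?thesis
  proof (rule that[OF _ _ b(2)])
    have "C * K ^ m \<ge> 0" using C K by simp
    then show "gaussian_decay k b" using b(1) unfolding gaussian_decay_def P_def by blast
    fix l :: int assume "l \<noteq> 0"
    let ?X = "of_real (exp (2 * r * of_int l)) :: complex"
    have "?X \<noteq> 1"
    proof
      assume "?X = 1"
      then have "exp (2 * r * of_int l) = 1" by (metis of_real_eq_1_iff)
      then show False using \<open>l \<noteq> 0\<close> assms by simp
    qed
    moreover have "(?X - 1) ^ m * moment b 1 ?X = 0"
      using b(1) moment_theta_coeff_eq_0[of r l] unfolding P_def by simp
    ultimately show "moment b 1 ?X = 0" by simp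
  qed
qed

section \<open>Schur's test for Gaussian kernels\<close>

lemma schur_test:
  fixes M :: "'a \<Rightarrow> 'b \<Rightarrow> complex" and K :: "'a \<Rightarrow> 'b \<Rightarrow> real" and d :: "'b \<Rightarrow> complex"
  assumes M: "\<And>x y. norm (M x y) \<le> K x y"
    and row: "\<And>x. K x summable_on UNIV" "\<And>x. infsum (K x) UNIV \<le> R"
    and col: "\<And>y. (\<lambda>x. K x y) summable_on UNIV" "\<And>y. (\<Sum>\<^sub>\<infinity>x. K x y) \<le> C"
    and d: "square_summable d"
  shows "(\<lambda>x. (norm (\<Sum>\<^sub>\<infinity>y. M x y * d y))^2) summable_on UNIV"
    and "(\<Sum>\<^sub>\<infinity>x. (norm (\<Sum>\<^sub>\<infinity>y. M x y * d y))^2) \<le> R * C * square_sum d"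
proof -
  have K0: "K x y \<ge> 0" for x y using M[of x y] norm_ge_zero order_trans by blast
  have R: "R \<ge> 0" using row(2) infsum_nonneg[of UNIV "K undefined"] K0 order_trans by blast
  have KC: "K x y \<le> C" for x y
  proof -
    have "sum (\<lambda>x. K x y) {x} \<le> (\<Sum>\<^sub>\<infinity>x. K x y)"
      by (rule finite_sum_le_infsum[OF col(1)]) (auto simp: K0)
    then show ?thesis using col(2)[of y] by simp
  qed
  let ?D = "\<lambda>y. norm (d y)"
  have sCd: "(\<lambda>y. C * (?D y)^2) summable_on UNIV" by (rule summable_on_cmult_right[OF d])
  have sKd2: "(\<lambda>y. K x y * (?D y)^2) summable_on UNIV" for x
    by (rule summable_on_comparison_test[OF sCd]) (auto intro!: mult_right_mono KC simp: K0)
  have sKd: "(\<lambda>y. K x y * ?D y) summable_on UNIV" for x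
  proof (rule summable_on_comparison_test)
    show "(\<lambda>y. K x y + K x y * (?D y)^2) summable_on UNIV" by (intro summable_on_add row sKd2)
    fix y
    have "?D y \<le> 1 + (?D y)^2" using zero_le_power2[of "?D y - 1/2"] by (simp add: power2_eq_square algebra_simps)
    from mult_left_mono[OF this K0[of x y]] show "K x y * ?D y \<le> K x y + K x y * (?D y)^2"
      by (simp add: algebra_simps)
  qed (simp add: K0)
  have le: "norm (M x y * d y) \<le> K x y * ?D y" for x y
    unfolding norm_mult by (intro mult_right_mono M) auto
  have sq: "(norm (\<Sum>\<^sub>\<infinity>y. M x y * d y))^2 \<le> R * (\<Sum>\<^sub>\<infinity>y. K x y * (?D y)^2)" for x
  proof -
    let ?E = "\<Sum>\<^sub>\<infinity>y. K x y * (?D y)^2"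
    have E: "?E \<ge> 0" by (intro infsum_nonneg) (simp add: K0)
    have "sum (\<lambda>y. K x y * ?D y) F \<le> sqrt (R * ?E)" if F: "finite F" for F
    proof (rule real_le_rsqrt)
      have "(sum (\<lambda>y. K x y * ?D y) F)^2 = (\<Sum>y\<in>F. sqrt (K x y) * (sqrt (K x y) * ?D y))^2"
        using K0 by (simp flip: mult.assoc)
      also have "\<dots> \<le> (\<Sum>y\<in>F. (sqrt (K x y))^2) * (\<Sum>y\<in>F. (sqrt (K x y) * ?D y)^2)"
        by (rule Cauchy_Schwarz_ineq_sum)
      also have "\<dots> = (\<Sum>y\<in>F. K x y) * (\<Sum>y\<in>F. K x y * (?D y)^2)"
        using K0 by (simp add: power_mult_distrib)
      also have "\<dots> \<le> R * ?E"
      proof (intro mult_mono)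
        show "(\<Sum>y\<in>F. K x y) \<le> R"
          using finite_sum_le_infsum[OF row(1)[of x] F] row(2)[of x] K0 by fastforce
        show "(\<Sum>y\<in>F. K x y * (?D y)^2) \<le> ?E"
          by (rule finite_sum_le_infsum[OF sKd2 F]) (auto simp: K0)
      qed (auto intro!: sum_nonneg R simp: K0)
      finally show "(sum (\<lambda>y. K x y * ?D y) F)^2 \<le> R * ?E" .
    qed
    then have "(\<Sum>\<^sub>\<infinity>y. K x y * ?D y) \<le> sqrt (R * ?E)"
      by (intro infsum_le_finite_sums sKd) auto
    then have "norm (\<Sum>\<^sub>\<infinity>y. M x y * d y) \<le> sqrt (R * ?E)"
      using summable_on_abs_bound(3)[OF sKd le] by (rule order_trans[rotated])
    then have "(norm (\<Sum>\<^sub>\<infinity>y. M x y * d y))^2 \<le> (sqrt (R * ?E))^2" by (intro power_mono) auto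
    then show ?thesis using R E by simp
  qed
  have fin: "(\<Sum>x\<in>F. (norm (\<Sum>\<^sub>\<infinity>y. M x y * d y))^2) \<le> R * C * (\<Sum>\<^sub>\<infinity>y. (?D y)^2)" if F: "finite F" for F
  proof -
    have "(\<Sum>x\<in>F. (norm (\<Sum>\<^sub>\<infinity>y. M x y * d y))^2) \<le> (\<Sum>x\<in>F. R * (\<Sum>\<^sub>\<infinity>y. K x y * (?D y)^2))"
      by (intro sum_mono sq)
    also have "\<dots> = R * (\<Sum>\<^sub>\<infinity>y. \<Sum>x\<in>F. K x y * (?D y)^2)"
      unfolding sum_distrib_left[symmetric] by (subst infsum_finite_sum(2)) (auto simp: sKd2)
    also have "\<dots> \<le> R * (\<Sum>\<^sub>\<infinity>y. C * (?D y)^2)"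
    proof (intro mult_left_mono R infsum_mono)
      show "(\<lambda>y. \<Sum>x\<in>F. K x y * (?D y)^2) summable_on UNIV" by (intro infsum_finite_sum(1) sKd2)
      show "(\<lambda>y. C * (?D y)^2) summable_on UNIV" by (rule sCd)
      show "(\<Sum>x\<in>F. K x y * (?D y)^2) \<le> C * (?D y)^2" for y
      proof -
        have "sum (\<lambda>x. K x y) F \<le> C"
          using finite_sum_le_infsum[OF col(1)[of y] F] col(2)[of y] K0 by fastforce
        then show ?thesis unfolding sum_distrib_right[symmetric] by (intro mult_right_mono) auto
      qed
    qed
    also have "\<dots> = R * C * (\<Sum>\<^sub>\<infinity>y. (?D y)^2)"
      using infsum_cmult_right'[of C "\<lambda>y. (?D y)^2" UNIV] by simp
    finally show ?thesis .
  qed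
  show s: "(\<lambda>x. (norm (\<Sum>\<^sub>\<infinity>y. M x y * d y))^2) summable_on UNIV"
    by (rule nonneg_bdd_above_summable_on) (use fin in \<open>auto intro!: bdd_aboveI2\<close>)
  show "(\<Sum>\<^sub>\<infinity>x. (norm (\<Sum>\<^sub>\<infinity>y. M x y * d y))^2) \<le> R * C * (\<Sum>\<^sub>\<infinity>y. (?D y)^2)"
    by (rule infsum_le_finite_sums[OF s]) (use fin in auto)
qed

lemma gaussian_kernel_sums:
  fixes \<beta> c :: real
  assumes "c > 0" "\<beta> > 0"
  obtains E where "E > 0"
    "\<And>x. (\<lambda>l::int. gauss c (x + of_int l)) summable_on UNIV"
    "\<And>x. (\<Sum>\<^sub>\<infinity>l::int. gauss c (x + of_int l)) \<le> E"
    "\<And>x. (\<lambda>n::int. gauss c (x - \<beta> * of_int n)) summable_on UNIV"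
    "\<And>x. (\<Sum>\<^sub>\<infinity>n::int. gauss c (x - \<beta> * of_int n)) \<le> E"
proof -
  obtain K where K: "K > 0"
    "\<And>x. (\<lambda>n::int. gauss c (x + 1 * of_int n)) summable_on UNIV"
    "\<And>x. (\<Sum>\<^sub>\<infinity>n::int. gauss c (x + 1 * of_int n)) \<le> K"
    using int_gaussian_lattice_sum[OF assms(1), of 1] by auto
  obtain L where L: "L > 0"
    "\<And>x. (\<lambda>n::int. gauss c (x + \<beta> * of_int n)) summable_on UNIV"
    "\<And>x. (\<Sum>\<^sub>\<infinity>n::int. gauss c (x + \<beta> * of_int n)) \<le> L"
    using int_gaussian_lattice_sum[OF assms] by auto
  have eq: "(x - \<beta> * of_int n)^2 = (- x + \<beta> * of_int n)^2" for x and n :: int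
    by (simp add: power2_eq_square algebra_simps)
  show ?thesis
  proof (rule that[of "max K L"])
    show "(\<Sum>\<^sub>\<infinity>l::int. gauss c (x + of_int l)) \<le> max K L" for x using K(3)[of x] by simp
    show "(\<Sum>\<^sub>\<infinity>n::int. gauss c (x - \<beta> * of_int n)) \<le> max K L" for x
      unfolding eq using L(3)[of "- x"] by simp
    show "(\<lambda>n::int. gauss c (x - \<beta> * of_int n)) summable_on UNIV" for x
      unfolding eq by (rule L(2))
  qed (use K in auto)
qed

text \<open>The alternative covers both directions: with the first bound \<open>M\<close> maps sequences on the frequency lattice to sequences on the
sampling lattice, with the second bound it goes back.\<close>

abbreviation (input) gaussian_kernels_bounded :: "real \<Rightarrow> real \<Rightarrow> real \<Rightarrow> real \<Rightarrow> real \<Rightarrow> bool" where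
  "gaussian_kernels_bounded \<nu> \<beta> c D E \<equiv> \<forall>(M :: int \<Rightarrow> int \<Rightarrow> complex) d. square_summable d \<longrightarrow>
      (\<forall>n l. norm (M n l) \<le> D * gauss c (\<nu> + of_int l - \<beta> * of_int n)) \<or>
      (\<forall>n l. norm (M l n) \<le> D * gauss c (\<nu> + of_int l - \<beta> * of_int n)) \<longrightarrow>
      square_summable (\<lambda>n. \<Sum>\<^sub>\<infinity>l. M n l * d l) \<and>
      square_sum (\<lambda>n. \<Sum>\<^sub>\<infinity>l. M n l * d l) \<le> E * square_sum d"

lemma gaussian_schur_test:
  fixes \<nu> \<beta> c D :: real
  assumes "c > 0" "\<beta> > 0" "D \<ge> 0"
  shows "\<exists>E\<ge>0. gaussian_kernels_bounded \<nu> \<beta> c D E"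
proof -
  obtain K where K: "K > 0"
    "\<And>x. (\<lambda>l::int. gauss c (x + of_int l)) summable_on UNIV"
    "\<And>x. (\<Sum>\<^sub>\<infinity>l::int. gauss c (x + of_int l)) \<le> K"
    "\<And>x. (\<lambda>n::int. gauss c (x - \<beta> * of_int n)) summable_on UNIV"
    "\<And>x. (\<Sum>\<^sub>\<infinity>n::int. gauss c (x - \<beta> * of_int n)) \<le> K"
    using gaussian_kernel_sums[OF assms(1,2)] by metis
  let ?G = "\<lambda>(n::int) (l::int). D * gauss c (\<nu> + of_int l - \<beta> * of_int n)"
  have eq: "\<nu> + of_int l - \<beta> * of_int n = (\<nu> - \<beta> * of_int n) + of_int l" for n l :: int by simp
  have r: "?G n summable_on UNIV" "infsum (?G n) UNIV \<le> D * K" for n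
    unfolding eq using K(2,3)[of "\<nu> - \<beta> * of_int n"] assms(3)
    by (auto simp: infsum_cmult_right' intro!: summable_on_cmult_right mult_left_mono)
  have c: "(\<lambda>n. ?G n l) summable_on UNIV" "(\<Sum>\<^sub>\<infinity>n. ?G n l) \<le> D * K" for l
    using K(4,5)[of "\<nu> + of_int l"] assms(3)
    by (auto simp: infsum_cmult_right' intro!: summable_on_cmult_right mult_left_mono)
  show ?thesis
  proof (intro exI[of _ "D * K * (D * K)"] conjI allI impI)
    fix M :: "int \<Rightarrow> int \<Rightarrow> complex" and d :: "int \<Rightarrow> complex"
    assume d: "square_summable d"
      and M: "(\<forall>n l. norm (M n l) \<le> ?G n l) \<or> (\<forall>n l. norm (M l n) \<le> ?G n l)"
    have "square_summable (\<lambda>n. \<Sum>\<^sub>\<infinity>l. M n l * d l) \<and>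
      square_sum (\<lambda>n. \<Sum>\<^sub>\<infinity>l. M n l * d l) \<le> D * K * (D * K) * square_sum d"
      using M
    proof
      assume "\<forall>n l. norm (M n l) \<le> ?G n l"
      then have M': "norm (M n l) \<le> ?G n l" for n l by blast
      show ?thesis using schur_test[where K = ?G and M = M and d = d, OF M' r c d] by simp
    next
      assume "\<forall>n l. norm (M l n) \<le> ?G n l"
      then have M': "norm (M l n) \<le> ?G n l" for n l by blast
      show ?thesis using schur_test[where K = "\<lambda>l n. ?G n l" and M = M and d = d, OF M' c r d] by simp
    qed
    then show "square_summable (\<lambda>n. \<Sum>\<^sub>\<infinity>l. M n l * d l)"
      "square_sum (\<lambda>n. \<Sum>\<^sub>\<infinity>l. M n l * d l) \<le> D * K * (D * K) * square_sum d"
      by blast+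
  qed simp
qed

section \<open>Sampling sums of polynomials times Gaussians\<close>

text \<open>The constant has to be independent of the system, since it will be applied once for every lattice point; this is why only bounds
on the entries enter. It arises by back substitution from the last unknown.\<close>

lemma triangular_system_bound:
  fixes N :: nat and C t :: real
  assumes "t > 0" "C \<ge> 0"
  shows "\<exists>B\<ge>0. \<forall>(d :: nat \<Rightarrow> complex) y T. (\<forall>r<N. y r = (\<Sum>j\<in>{r..<N}. d j * T r j)) \<longrightarrow>
      (\<forall>r<N. norm (T r r) \<ge> t) \<longrightarrow> (\<forall>r<N. \<forall>j<N. norm (T r j) \<le> C) \<longrightarrow>
      (\<forall>r<N. norm (d r) \<le> B * (\<Sum>s<N. norm (y s)))"
proof -
  define Q where "Q = (\<lambda>B m. \<forall>(d :: nat \<Rightarrow> complex) y T r. (\<forall>r<N. y r = (\<Sum>j\<in>{r..<N}. d j * T r j)) \<longrightarrow>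
      (\<forall>r<N. norm (T r r) \<ge> t) \<longrightarrow> (\<forall>r<N. \<forall>j<N. norm (T r j) \<le> C) \<longrightarrow>
      r < N \<longrightarrow> N \<le> r + m \<longrightarrow> norm (d r) \<le> B * (\<Sum>s<N. norm (y s)))"
  have "\<exists>B\<ge>0. Q B m" for m
  proof (induction m)
    case 0
    show ?case unfolding Q_def by (intro exI[of _ 0]) auto
  next
    case (Suc m)
    then obtain B where B: "B \<ge> 0" "Q B m" by blast
    define B' where "B' = B + (1 + real N * B * C) / t"
    have B': "B' \<ge> B" "B' \<ge> 0" using B assms by (auto simp: B'_def)
    have "Q B' (Suc m)"
      unfolding Q_def
    proof (intro allI impI)
      fix d y :: "nat \<Rightarrow> complex" and T :: "nat \<Rightarrow> nat \<Rightarrow> complex" and r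
      assume y: "\<forall>r<N. y r = (\<Sum>j\<in>{r..<N}. d j * T r j)" and t: "\<forall>r<N. norm (T r r) \<ge> t"
        and C: "\<forall>r<N. \<forall>j<N. norm (T r j) \<le> C" and r: "r < N" "N \<le> r + Suc m"
      let ?Y = "\<Sum>s<N. norm (y s)"
      have Y: "?Y \<ge> 0" by (intro sum_nonneg) auto
      have IH: "norm (d j) \<le> B * ?Y" if "j < N" "N \<le> j + m" for j
        using B(2) y t C that unfolding Q_def by blast
      show "norm (d r) \<le> B' * ?Y"
      proof (cases "N \<le> r + m")
        case True
        then show ?thesis using IH[of r] r B'(1) mult_right_mono[OF B'(1) Y] by linarith
      next
        case False
        have "{r..<N} = insert r {Suc r..<N}" using r by auto
        then have "y r = d r * T r r + (\<Sum>j\<in>{Suc r..<N}. d j * T r j)" using y r by simp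
        then have "d r * T r r = y r - (\<Sum>j\<in>{Suc r..<N}. d j * T r j)" by simp
        then have "norm (d r) * norm (T r r) \<le> norm (y r) + norm (\<Sum>j\<in>{Suc r..<N}. d j * T r j)"
          by (metis norm_mult norm_triangle_ineq4)
        also have "\<dots> \<le> ?Y + real N * B * C * ?Y"
        proof (intro add_mono)
          show "norm (y r) \<le> ?Y" using r by (intro member_le_sum) auto
          have "norm (\<Sum>j\<in>{Suc r..<N}. d j * T r j) \<le> (\<Sum>j\<in>{Suc r..<N}. B * ?Y * C)"
            unfolding norm_mult[symmetric]
          proof (rule sum_norm_le)
            fix j assume j: "j \<in> {Suc r..<N}"
            then show "norm (d j * T r j) \<le> B * ?Y * C"
              unfolding norm_mult using r C B Y by (intro mult_mono IH) auto
          qed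
          also have "\<dots> \<le> real N * (B * ?Y * C)"
            using B Y assms by (simp add: mult_right_mono)
          finally show "norm (\<Sum>j\<in>{Suc r..<N}. d j * T r j) \<le> real N * B * C * ?Y" by (simp add: mult_ac)
        qed
        finally have "norm (d r) * t \<le> (1 + real N * B * C) * ?Y"
          using t r mult_left_mono[of t "norm (T r r)" "norm (d r)"] by (auto simp: algebra_simps)
        then have "norm (d r) \<le> (1 + real N * B * C) / t * ?Y"
          using assms by (simp add: field_simps)
        also have "\<dots> \<le> B' * ?Y" using B Y by (intro mult_right_mono) (auto simp: B'_def)
        finally show ?thesis .
      qed
    qed
    then show ?case using B' by blast
  qed
  then obtain B where B: "B \<ge> 0" "Q B N" by blast
  show ?thesis
  proof (intro exI[of _ B] conjI allI impI)
    fix d y :: "nat \<Rightarrow> complex" and T :: "nat \<Rightarrow> nat \<Rightarrow> complex" and r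
    assume "\<forall>r<N. y r = (\<Sum>j\<in>{r..<N}. d j * T r j)" "\<forall>r<N. norm (T r r) \<ge> t"
      "\<forall>r<N. \<forall>j<N. norm (T r j) \<le> C" "r < N"
    then show "norm (d r) \<le> B * (\<Sum>s<N. norm (y s))"
      using B(2)[unfolded Q_def, rule_format, of y d T r] by simp
  qed (rule B(1))
qed

text \<open>The rate \<open>k / N\<close> obtained from the \<open>N\<close>-th power has to exceed \<open>pi * \<beta>\<^sup>2\<close> with \<open>k < pi * \<beta>\<close>, and
\<open>N * pi * \<beta>\<^sup>2 < pi * \<beta>\<close> is the hypothesis \<open>\<beta> < 1 / N\<close>. The midpoint of these two numbers is used.\<close>

lemma exists_dual_sequence:
  fixes \<beta> :: real
  assumes "\<beta> > 0" "N \<ge> 1" "\<beta> < 1 / real N"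
  obtains a k where "gaussian_decay k a" "k > pi * \<beta>^2" "moment a 1 1 \<noteq> 0"
    "\<And>p l. degree p < N \<Longrightarrow> (l::int) \<noteq> 0 \<Longrightarrow> moment a p (of_real (exp (2 * pi * \<beta> * of_int l))) = 0"
proof -
  define r where "r = pi * \<beta>"
  have N: "real N > 0" using assms by simp
  define u where "u = real N * (r * \<beta>)"
  have lt: "u < r"
    using assms N by (simp add: u_def r_def field_simps)
  define k where "k = (u + r) / 2"
  have k: "u < k" and kr: "k < r" using lt unfolding k_def by auto
  have "u > 0" using N assms by (simp add: u_def r_def)
  with k have k0: "k > 0" by linarith
  obtain b where b: "gaussian_decay k b" "moment b 1 1 \<noteq> 0"
    "\<And>l::int. l \<noteq> 0 \<Longrightarrow> moment b 1 (of_real (exp (2 * r * of_int l))) = 0"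
    using exists_cardinal_laurent[OF k0 kr] by metis
  obtain m where m: "N = Suc m" using assms(2) by (cases N) auto
  show ?thesis
  proof (rule that[of "k / real N" "convolution_power b m"])
    show "gaussian_decay (k / real N) (convolution_power b m)"
      using gaussian_decay_convolution_power[OF b(1) k0, of m] m by simp
    show "k / real N > pi * \<beta>^2" using k N by (simp add: field_simps u_def r_def power2_eq_square)
    show "moment (convolution_power b m) 1 1 \<noteq> 0"
      using moment_convolution_power_1[OF b(1) k0, of 1] b(2) by simp
    show "moment (convolution_power b m) p (of_real (exp (2 * pi * \<beta> * of_int l))) = 0"
      if "degree p < N" "l \<noteq> 0" for p and l :: int
      using that m b(3)[of l]
      by (intro moment_convolution_power_eq_0[OF b(1) k0]) (auto simp: r_def mult_ac)
  qed
qed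

lemma complete_square_shifted:
  fixes c s x e :: real
  assumes "c > 0"
  shows "s * (x - e)^2 - (s - c) * x^2 \<ge> - (s * e)\<^sup>2 / c + s * e^2"
proof -
  have "s * (x - e)^2 - (s - c) * x^2 = c * (x - s * e / c)^2 - (s * e)^2 / c + s * e^2"
    using assms by (simp add: power2_eq_square field_simps)
  then show ?thesis using assms by simp
qed

text \<open>With \<open>z = x - \<beta> * n\<close> the index \<open>n - \<lfloor>x / \<beta>\<rfloor>\<close> is \<open>- z / \<beta>\<close> up to a bounded error, so \<open>a\<close> contributes about
\<open>exp (- (k / \<beta>\<^sup>2) * z\<^sup>2)\<close>, which beats \<open>exp (pi * z\<^sup>2)\<close> precisely because \<open>k > pi * \<beta>\<^sup>2\<close>. The remainder
\<open>x - \<beta> * \<lfloor>x / \<beta>\<rfloor>\<close> stays in a bounded interval, hence the constants do not depend on \<open>x\<close>.\<close>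

lemma dual_weight_bound:
  fixes \<beta> :: real
  assumes a: "gaussian_decay k a" and k: "k > pi * \<beta>^2" and \<beta>: "\<beta> > 0"
  obtains c C where "c > 0" "C \<ge> 0"
    "\<And>x n. norm (a (n - \<lfloor>x / \<beta>\<rfloor>) * of_real (exp (pi * (x - \<beta> * of_int n)^2)))
        \<le> C * gauss c (x - \<beta> * of_int n)"
proof -
  obtain A where A: "A \<ge> 0" "\<And>n. norm (a n) \<le> A * gauss k (of_int n)"
    using a by (auto simp: gaussian_decay_def)
  define c where "c = (k / \<beta>^2 - pi) / 2"
  have c: "c > 0" using k \<beta> by (simp add: c_def field_simps)
  define s where "s = k / \<beta>^2"
  have s1: "s = pi + 2 * c" by (simp add: s_def c_def field_simps)
  then have s: "s = pi + 2 * c" "s > 0" using c pi_gt_zero by (auto simp: add_pos_pos)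
  have bnd: "norm (a (n - \<lfloor>x / \<beta>\<rfloor>) * of_real (exp (pi * (x - \<beta> * of_int n)^2)))
        \<le> (A * exp ((s * \<beta>)^2 / c)) * gauss c (x - \<beta> * of_int n)" for x and n :: int
  proof -
    define e where "e = x - \<beta> * of_int \<lfloor>x / \<beta>\<rfloor>"
    define z where "z = x - \<beta> * of_int n"
    have "\<beta> * of_int \<lfloor>x / \<beta>\<rfloor> \<le> \<beta> * (x / \<beta>)" using \<beta> by (intro mult_left_mono) auto
    moreover have "\<beta> * (x / \<beta>) \<le> \<beta> * (of_int \<lfloor>x / \<beta>\<rfloor> + 1)"
      using \<beta> by (intro mult_left_mono) linarith+
    ultimately have e: "0 \<le> e" "e \<le> \<beta>" using \<beta> by (auto simp: e_def algebra_simps)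
    have "(of_int (n - \<lfloor>x / \<beta>\<rfloor>) :: real) = - (z - e) / \<beta>" using \<beta> by (simp add: z_def e_def field_simps)
    then have "k * (of_int (n - \<lfloor>x / \<beta>\<rfloor>) :: real)^2 = s * (z - e)^2"
      by (simp add: s_def power_divide power2_commute)
    then have "norm (a (n - \<lfloor>x / \<beta>\<rfloor>)) \<le> A * exp (- (s * (z - e)^2))"
      using A(2)[of "n - \<lfloor>x / \<beta>\<rfloor>"] by simp
    then have "norm (a (n - \<lfloor>x / \<beta>\<rfloor>) * of_real (exp (pi * z^2))) \<le> (A * exp (- (s * (z - e)^2))) * exp (pi * z^2)"
      unfolding norm_mult by (intro mult_mono) (use A in auto)
    also have "\<dots> = A * exp (pi * z^2 - s * (z - e)^2)" by (simp add: exp_diff exp_minus field_simps)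
    also have "\<dots> \<le> A * exp ((s * \<beta>)^2 / c - c * z^2)"
    proof -
      have "s * (z - e)^2 - (s - c) * z^2 \<ge> - (s * e)\<^sup>2 / c + s * e^2" by (rule complete_square_shifted[OF c])
      moreover have "(s * e)^2 / c \<le> (s * \<beta>)^2 / c"
        using e s c by (intro divide_right_mono power_mono mult_left_mono) auto
      moreover have "s * e^2 \<ge> 0" using s by simp
      moreover have "(s - c) * z^2 = pi * z^2 + c * z^2" using s by (simp add: algebra_simps)
      ultimately have "pi * z^2 - s * (z - e)^2 \<le> (s * \<beta>)^2 / c - c * z^2" by simp
      then show ?thesis using A by (intro mult_left_mono) auto
    qed
    also have "\<dots> = (A * exp ((s * \<beta>)^2 / c)) * gauss c z" by (simp add: exp_diff exp_minus field_simps)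
    finally show ?thesis by (simp add: z_def)
  qed
  show ?thesis by (rule that[OF c _ bnd]) (use A in auto)
qed

text \<open>In the product of the two exponentials the quadratic terms in \<open>n\<close> cancel and leave \<open>X\<^sup>n\<close> with
\<open>X = exp (2 * pi * \<beta> * k)\<close>, so the pairing is a moment of \<open>a\<close>.\<close>

lemma dual_weight_pairing:
  fixes \<beta> x :: real and a :: "int \<Rightarrow> complex" and q :: "complex poly" and k :: int
  shows "(\<Sum>\<^sub>\<infinity>n. (a (n - m) * of_real (exp (pi * (x - \<beta> * of_int n)^2)))
        * (poly q (of_real (x + of_int k - \<beta> * of_int n)) * of_real (gauss pi (x + of_int k - \<beta> * of_int n))))
    = of_real (exp (- pi * (of_int k)^2 - 2 * pi * of_int k * (x - \<beta> * of_int m)))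
      * moment a (pcompose q [:of_real (x + of_int k - \<beta> * of_int m), of_real (- \<beta>):]) (of_real (exp (2 * pi * \<beta> * of_int k)))"
    (is "infsum ?f UNIV = ?E * moment a ?p ?X")
proof -
  have bij: "bij_betw (\<lambda>n. n + m) UNIV (UNIV :: int set)"
    by (rule bij_betwI[where g = "\<lambda>n. n - m"]) auto
  have shift: "?f (n + m) = ?E * (a n * poly ?p (of_int n) * ?X powi n)" for n
  proof -
    let ?u = "x - \<beta> * of_int m"
    have 1: "x - \<beta> * of_int (n + m) = ?u - \<beta> * of_int n"
      "x + of_int k - \<beta> * of_int (n + m) = (?u - \<beta> * of_int n) + of_int k" by (simp_all add: algebra_simps)
    have 2: "exp (pi * (?u - \<beta> * of_int n)^2) * gauss pi ((?u - \<beta> * of_int n) + of_int k)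
      = exp (- pi * (of_int k)^2 - 2 * pi * of_int k * ?u) * exp (of_int n * (2 * pi * \<beta> * of_int k))"
      unfolding exp_add[symmetric] by (simp add: power2_eq_square algebra_simps)
    have 3: "poly ?p (of_int n) = poly q (of_real ((?u - \<beta> * of_int n) + of_int k))"
      by (simp add: poly_pcompose algebra_simps)
    have "?f (n + m) = a n * poly q (of_real ((?u - \<beta> * of_int n) + of_int k))
       * of_real (exp (pi * (?u - \<beta> * of_int n)^2) * gauss pi ((?u - \<beta> * of_int n) + of_int k))"
      unfolding 1 by simp
    also have "\<dots> = a n * poly ?p (of_int n) * (?E * ?X powi n)"
      unfolding 2 3 exp_powi_int by simp
    finally show ?thesis by (simp add: mult_ac)
  qed
  have "infsum ?f UNIV = (\<Sum>\<^sub>\<infinity>n. ?f (n + m))"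
    by (rule infsum_reindex_bij_betw[OF bij, symmetric])
  also have "\<dots> = (\<Sum>\<^sub>\<infinity>n. ?E * (a n * poly ?p (of_int n) * ?X powi n))"
    by (rule infsum_cong) (rule shift)
  also have "\<dots> = ?E * moment a ?p ?X"
    unfolding moment_def by (rule infsum_cmult_right')
  finally show ?thesis .
qed

lemma infsum_swap_bounded_kernel:
  fixes g :: "int \<Rightarrow> complex" and d :: "int \<Rightarrow> complex" and M :: "int \<Rightarrow> int \<Rightarrow> complex"
  assumes g: "(\<lambda>n. norm (g n)) summable_on UNIV" and d: "\<And>l. norm (d l) \<le> S"
    and M: "\<And>n l. norm (M n l) \<le> K n l" and K: "\<And>n. K n summable_on UNIV" "\<And>n. infsum (K n) UNIV \<le> R"
  shows "(\<Sum>\<^sub>\<infinity>n. g n * (\<Sum>\<^sub>\<infinity>l. M n l * d l)) = (\<Sum>\<^sub>\<infinity>l. d l * (\<Sum>\<^sub>\<infinity>n. g n * M n l))"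
proof -
  define F where "F = (\<lambda>(n, l). norm (g n) * (K n l * S))"
  have S: "S \<ge> 0" using d[of 0] norm_ge_zero order_trans by blast
  have K0: "K n l \<ge> 0" for n l using M[of n l] norm_ge_zero order_trans by blast
  have sF: "F summable_on UNIV \<times> UNIV"
  proof (rule summable_on_SigmaI)
    show "((\<lambda>l. F (n, l)) has_sum norm (g n) * (infsum (K n) UNIV * S)) UNIV" for n
      unfolding F_def prod.case by (intro has_sum_cmult_right has_sum_cmult_left has_sum_infsum K)
    show "(\<lambda>n. norm (g n) * (infsum (K n) UNIV * S)) summable_on UNIV"
    proof (rule summable_on_comparison_test)
      show "(\<lambda>n. norm (g n) * (R * S)) summable_on UNIV" by (intro summable_on_cmult_left g)
      show "norm (g n) * (infsum (K n) UNIV * S) \<le> norm (g n) * (R * S)" for n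
        using S K by (intro mult_left_mono mult_right_mono) auto
      show "0 \<le> norm (g n) * (infsum (K n) UNIV * S)" for n
        using S K0 by (intro mult_nonneg_nonneg infsum_nonneg) auto
    qed
  qed (use S K0 in \<open>auto simp: F_def\<close>)
  have s: "(\<lambda>(n, l). g n * (M n l * d l)) summable_on UNIV \<times> UNIV"
  proof (rule summable_on_abs_bound(2)[OF sF])
    fix x :: "int \<times> int"
    show "norm (case x of (n, l) \<Rightarrow> g n * (M n l * d l)) \<le> F x"
      unfolding F_def case_prod_unfold norm_mult
      by (intro mult_left_mono mult_mono M d K0) auto
  qed
  have "(\<Sum>\<^sub>\<infinity>n. g n * (\<Sum>\<^sub>\<infinity>l. M n l * d l)) = (\<Sum>\<^sub>\<infinity>n. \<Sum>\<^sub>\<infinity>l. g n * (M n l * d l))"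
    by (simp add: infsum_cmult_right')
  also have "\<dots> = (\<Sum>\<^sub>\<infinity>l. \<Sum>\<^sub>\<infinity>n. g n * (M n l * d l))"
    by (rule infsum_swap_banach[OF s])
  also have "\<dots> = (\<Sum>\<^sub>\<infinity>l. d l * (\<Sum>\<^sub>\<infinity>n. g n * M n l))"
    by (intro infsum_cong) (simp add: mult_ac flip: infsum_cmult_right')
  finally show ?thesis .
qed

lemma finite_family_gaussian_bound:
  fixes q :: "nat \<Rightarrow> complex poly" and c :: real
  assumes "c < pi"
  obtains D where "D \<ge> 0"
    "\<And>j x. j < N \<Longrightarrow> norm (poly (q j) (of_real x) * of_real (gauss pi x)) \<le> D * gauss c x"
proof -
  have "\<forall>j. \<exists>C>0. \<forall>x::real. norm (poly (q j) (of_real x)) \<le> C * exp ((pi - c) * x^2)"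
    using poly_le_gaussian[of "pi - c"] assms by (metis diff_gt_0_iff_gt)
  then obtain C where C: "\<And>j. C j > 0" "\<And>j x. norm (poly (q j) (of_real x)) \<le> C j * exp ((pi - c) * x^2)"
    by metis
  define D where "D = (\<Sum>j<N. C j)"
  have CD: "C j \<le> D" if "j < N" for j
    unfolding D_def using that C(1) by (intro member_le_sum) (auto simp: less_imp_le)
  have "norm (poly (q j) (of_real x) * of_real (gauss pi x)) \<le> D * gauss c x" if "j < N" for j x
  proof -
    have "D \<ge> 0" using CD[OF that] C(1)[of j] by linarith
    then have "norm (poly (q j) (of_real x) * of_real (gauss pi x)) \<le> (D * exp ((pi - c) * x^2)) * gauss pi x"
      unfolding norm_mult using CD[OF that]
      by (intro mult_mono order_trans[OF C(2)] mult_right_mono) auto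
    also have "\<dots> = D * gauss c x" by (simp add: algebra_simps flip: exp_add)
    finally show ?thesis .
  qed
  moreover have "D \<ge> 0" unfolding D_def using C(1) by (intro sum_nonneg) (auto simp: less_imp_le)
  ultimately show ?thesis using that by blast
qed

lemma norm_sum_squared_le:
  fixes f :: "nat \<Rightarrow> complex"
  shows "(norm (\<Sum>j<N. f j))^2 \<le> real N * (\<Sum>j<N. (norm (f j))^2)"
proof -
  have "(norm (\<Sum>j<N. f j))^2 \<le> (\<Sum>j<N. norm (f j))^2" by (intro power_mono norm_sum) auto
  also have "\<dots> \<le> (\<Sum>j<N. (norm (f j))^2) * real (card {..<N})" by (rule sum_squared_le_sum_of_squares)
  finally show ?thesis by (simp add: mult_ac)
qed

text \<open>Abstractly, \<open>q j\<close> is the polynomial factor in the Fourier transform of the \<open>j\<close>-th Hermite function. Only its exact degree matters,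
because it makes the system for the coefficients triangular.\<close>

locale gaussian_sampling =
  fixes \<nu> \<beta> :: real and N :: nat and q :: "nat \<Rightarrow> complex poly"
  assumes \<beta>: "\<beta> > 0" and N: "N \<ge> 1" and \<beta>N: "\<beta> < 1 / real N"
    and deg: "\<And>j. degree (q j) = j" and q0: "\<And>j. q j \<noteq> 0"
begin

definition sample_kernel :: "nat \<Rightarrow> int \<Rightarrow> int \<Rightarrow> complex" where
  "sample_kernel j n l = poly (q j) (of_real (\<nu> + of_int l - \<beta> * of_int n))
     * of_real (gauss pi (\<nu> + of_int l - \<beta> * of_int n))"

definition samples :: "(nat \<Rightarrow> int \<Rightarrow> complex) \<Rightarrow> int \<Rightarrow> complex" where
  "samples d n = (\<Sum>j<N. \<Sum>\<^sub>\<infinity>l. sample_kernel j n l * d j l)"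

lemma samples_upper_bound:
  obtains B where "B > 0"
    "\<And>d. (\<And>j. j < N \<Longrightarrow> square_summable (d j)) \<Longrightarrow>
       square_summable (samples d) \<and>
       square_sum (samples d) \<le> B * (\<Sum>j<N. square_sum (d j))"
proof -
  have "1 < pi" using pi_gt3 by simp
  obtain D where D: "D \<ge> 0"
    "\<And>j x. j < N \<Longrightarrow> norm (poly (q j) (of_real x) * of_real (gauss pi x)) \<le> D * gauss 1 x"
    using finite_family_gaussian_bound[OF \<open>1 < pi\<close>] by metis
  have Mb: "norm (sample_kernel j n l) \<le> D * gauss 1 (\<nu> + of_int l - \<beta> * of_int n)" if "j < N" for j n l
    unfolding sample_kernel_def by (rule D(2)[OF that])
  obtain E where E: "E \<ge> 0"
    "gaussian_kernels_bounded \<nu> \<beta> 1 D E"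
    using gaussian_schur_test[OF zero_less_one \<beta> D(1), of \<nu>] by (elim exE conjE) (rule that)
  show ?thesis
  proof (rule that[of "real N * E + 1"])
    show "real N * E + 1 > 0" using E(1) by (simp add: add_nonneg_pos)
    fix d :: "nat \<Rightarrow> int \<Rightarrow> complex"
    assume d: "\<And>j. j < N \<Longrightarrow> square_summable (d j)"
    let ?Y = "\<lambda>j n. \<Sum>\<^sub>\<infinity>l. sample_kernel j n l * d j l"
    have Y: "square_summable (?Y j)"
      "square_sum (?Y j) \<le> E * square_sum (d j)" if "j < N" for j
      using E(2)[rule_format, of "d j" "sample_kernel j"] d[OF that] Mb[OF that] by auto
    have sY: "(\<lambda>n. real N * (\<Sum>j<N. (norm (?Y j n))^2)) summable_on UNIV"
      by (intro summable_on_cmult_right infsum_finite_sum(1) Y) auto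
    have le: "(norm (samples d n))^2 \<le> real N * (\<Sum>j<N. (norm (?Y j n))^2)" for n
      unfolding samples_def by (rule norm_sum_squared_le)
    have s: "square_summable (samples d)"
      by (rule summable_on_comparison_test[OF sY le]) auto
    have "square_sum (samples d) \<le> (\<Sum>\<^sub>\<infinity>n. real N * (\<Sum>j<N. (norm (?Y j n))^2))"
      by (rule infsum_mono[OF s sY le])
    also have "\<dots> = real N * (\<Sum>j<N. square_sum (?Y j))"
      unfolding infsum_cmult_right' by (subst infsum_finite_sum(2)) (auto intro: Y(1))
    also have "\<dots> \<le> real N * (\<Sum>j<N. E * square_sum (d j))"
      by (intro mult_left_mono sum_mono Y) auto
    also have "\<dots> = (real N * E) * (\<Sum>j<N. square_sum (d j))" by (simp add: sum_distrib_left mult_ac)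
    also have "\<dots> \<le> (real N * E + 1) * (\<Sum>j<N. square_sum (d j))"
      by (intro mult_right_mono sum_nonneg infsum_nonneg) auto
    finally show "square_summable (samples d) \<and>
       square_sum (samples d) \<le> (real N * E + 1) * (\<Sum>j<N. square_sum (d j))"
      using s by blast
  qed
qed

text \<open>The weights \<open>\<gamma>\<close> built from the differences of the dual sequence recover, up to a triangular system, the coefficients
\<open>d j l\<close> with \<open>j < N\<close> from the samples: \<open>off\<close> removes all other lattice points, and \<open>T0\<close> and \<open>Trr\<close> show that the system is
triangular with a diagonal bounded away from zero.\<close>

lemma samples_lower_bound:
  obtains A where "A > 0"
    "\<And>d. (\<And>j. j < N \<Longrightarrow> square_summable (d j)) \<Longrightarrow>
       A * (\<Sum>j<N. square_sum (d j)) \<le> square_sum (samples d)"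
proof -
  obtain a k where a: "gaussian_decay k a" "k > pi * \<beta>^2" "moment a 1 1 \<noteq> 0"
    and a0: "\<And>p l. degree p < N \<Longrightarrow> (l::int) \<noteq> 0 \<Longrightarrow> moment a p (of_real (exp (2 * pi * \<beta> * of_int l))) = 0"
    using exists_dual_sequence[OF \<beta> N \<beta>N] by metis
  have "pi * \<beta>^2 > 0" using \<beta> by simp
  then have k0: "k > 0" using a(2) by linarith
  define k' where "k' = (k + pi * \<beta>^2) / 2"
  have k': "k' > pi * \<beta>^2" "k' < k" "k' > 0" using a(2) \<open>pi * \<beta>^2 > 0\<close> by (auto simp: k'_def)
  define A where "A = (\<lambda>r. backward_difference r a)"
  have A: "gaussian_decay k' (A r)" for r
    unfolding A_def by (rule gaussian_decay_backward_difference[OF a(1) k'(3,2)])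
  define x where "x = (\<lambda>l::int. \<nu> + of_int l)"
  define m where "m = (\<lambda>l::int. \<lfloor>x l / \<beta>\<rfloor>)"
  define \<gamma> where "\<gamma> = (\<lambda>r l n. A r (n - m l) * of_real (exp (pi * (x l - \<beta> * of_int n)^2)))"
  define T where "T = (\<lambda>l r j. \<Sum>\<^sub>\<infinity>n. \<gamma> r l n * sample_kernel j n l)"
  have "\<forall>r. \<exists>c C. c > 0 \<and> C \<ge> 0 \<and> (\<forall>x n. norm (A r (n - \<lfloor>x / \<beta>\<rfloor>) * of_real (exp (pi * (x - \<beta> * of_int n)^2)))
        \<le> C * gauss c (x - \<beta> * of_int n))"
    using dual_weight_bound[OF A k'(1) \<beta>] by metis
  then obtain cf Cf where cf: "\<And>r. cf r > 0" "\<And>r. Cf r \<ge> (0::real)"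
    "\<And>r x n. norm (A r (n - \<lfloor>x / \<beta>\<rfloor>) * of_real (exp (pi * (x - \<beta> * of_int n)^2)))
        \<le> Cf r * exp (- cf r * (x - \<beta> * of_int n)^2)" by metis
  (* A single exponent c that serves all r < N and, being at most 1 < pi, the sampling kernel as well. *)
  define c where "c = Min (insert 1 (cf ` {..<N}))"
  define C where "C = (\<Sum>r<N. Cf r)"
  have c: "c > 0" unfolding c_def using cf(1) by (subst Min_gr_iff) auto
  have c1: "c \<le> 1" unfolding c_def by (intro Min_le) auto
  have C: "C \<ge> 0" unfolding C_def by (intro sum_nonneg cf)
  have \<gamma>: "norm (\<gamma> r l n) \<le> C * gauss c (\<nu> + of_int l - \<beta> * of_int n)" if "r < N" for r l n
  proof -
    have "norm (\<gamma> r l n) \<le> Cf r * exp (- cf r * (x l - \<beta> * of_int n)^2)"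
      unfolding \<gamma>_def m_def by (rule cf(3))
    also have "\<dots> \<le> C * gauss c (x l - \<beta> * of_int n)"
    proof (intro mult_mono C)
      show "Cf r \<le> C" unfolding C_def using that cf(2) by (intro member_le_sum) auto
      have "c \<le> cf r" unfolding c_def using that by (intro Min_le) auto
      then show "exp (- cf r * (x l - \<beta> * of_int n)^2) \<le> gauss c (x l - \<beta> * of_int n)"
        by (simp add: mult_right_mono)
    qed auto
    finally show ?thesis by (simp add: x_def)
  qed
  have "c < pi" using c1 pi_gt3 by simp
  obtain D where D: "D \<ge> 0"
    "\<And>j x. j < N \<Longrightarrow> norm (poly (q j) (of_real x) * of_real (gauss pi x)) \<le> D * gauss c x"
    using finite_family_gaussian_bound[OF \<open>c < pi\<close>] by metis
  have Mb: "norm (sample_kernel j n l) \<le> D * gauss c (\<nu> + of_int l - \<beta> * of_int n)" if "j < N" for j n l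
    unfolding sample_kernel_def by (rule D(2)[OF that])
  obtain K where K: "K > 0"
    "\<And>x. (\<lambda>l::int. gauss c (x + of_int l)) summable_on UNIV"
    "\<And>x. (\<Sum>\<^sub>\<infinity>l::int. gauss c (x + of_int l)) \<le> K"
    "\<And>x. (\<lambda>n::int. gauss c (x - \<beta> * of_int n)) summable_on UNIV"
    "\<And>x. (\<Sum>\<^sub>\<infinity>n::int. gauss c (x - \<beta> * of_int n)) \<le> K"
    using gaussian_kernel_sums[OF c \<beta>] by metis
  have sG: "(\<lambda>n. C * gauss c (\<nu> + of_int l - \<beta> * of_int n)) summable_on UNIV"
    "(\<Sum>\<^sub>\<infinity>n. C * gauss c (\<nu> + of_int l - \<beta> * of_int n)) \<le> C * K" for l :: int
    using K(4,5)[of "\<nu> + of_int l"] C by (auto simp: infsum_cmult_right' intro!: mult_left_mono summable_on_cmult_right)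
  have s\<gamma>: "(\<lambda>n. norm (\<gamma> r l n)) summable_on UNIV" if "r < N" for r l
    by (rule summable_on_abs_bound(1)[OF sG(1) \<gamma>[OF that]])
  have eqn: "\<nu> + of_int l - \<beta> * of_int n = (\<nu> - \<beta> * of_int n) + of_int l" for n l :: int by simp
  have sM: "(\<lambda>l. D * gauss c (\<nu> + of_int l - \<beta> * of_int n)) summable_on UNIV"
    "(\<Sum>\<^sub>\<infinity>l. D * gauss c (\<nu> + of_int l - \<beta> * of_int n)) \<le> D * K" for n :: int
    unfolding eqn using K(2,3)[of "\<nu> - \<beta> * of_int n"] D(1)
    by (auto simp: infsum_cmult_right' intro!: mult_left_mono summable_on_cmult_right)
  (* Pairing the weights for l with the kernel for l' evaluates moments of A r at exp (2 pi \<beta> (l' - l)). *)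
  let ?P = "\<lambda>j u. pcompose (q j) [:of_real u, of_real (- \<beta>):]"
  have pair: "(\<Sum>\<^sub>\<infinity>n. \<gamma> r l n * sample_kernel j n l')
    = of_real (exp (- pi * (of_int (l' - l))^2 - 2 * pi * of_int (l' - l) * (x l - \<beta> * of_int (m l))))
      * moment (A r) (?P j (x l + of_int (l' - l) - \<beta> * of_int (m l))) (of_real (exp (2 * pi * \<beta> * of_int (l' - l))))"
    for r l j l'
  proof -
    have "\<nu> + of_int l' = x l + of_int (l' - l)" by (simp add: x_def)
    then show ?thesis unfolding \<gamma>_def sample_kernel_def
      by (simp only:) (rule dual_weight_pairing)
  qed
  have off: "(\<Sum>\<^sub>\<infinity>n. \<gamma> r l n * sample_kernel j n l') = 0" if "j < N" "l' \<noteq> l" for r l j l'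
  proof -
    let ?p = "?P j (x l + of_int (l' - l) - \<beta> * of_int (m l))"
    have dp: "degree ?p \<le> N - 1" using that(1) deg[of j] by (auto simp: degree_pcompose)
    have "moment (A r) ?p (of_real (exp (2 * pi * \<beta> * of_int (l' - l)))) = 0"
      unfolding A_def
    proof (rule moment_backward_difference_eq_0[OF a(1) k0])
      show "moment a p (of_real (exp (2 * pi * \<beta> * of_int (l' - l)))) = 0" if "degree p \<le> N - 1" for p
        using that \<open>l' \<noteq> l\<close> N by (intro a0) auto
    qed (use dp in auto)
    then show ?thesis unfolding pair by simp
  qed
  have diag: "T l r j = fact r * coeff (?P j (x l - \<beta> * of_int (m l))) r * moment a 1 1"
    if "j \<le> r" for l r j
  proof -
    have "T l r j = moment (A r) (?P j (x l - \<beta> * of_int (m l))) 1"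
      unfolding T_def pair by simp
    then show ?thesis
      using moment_backward_difference_at_1[OF a(1) k0, of "?P j (x l - \<beta> * of_int (m l))" r]
        that deg[of j] \<beta> by (simp add: A_def degree_pcompose)
  qed
  have T0: "T l r j = 0" if "j < r" for l r j
    using that deg[of j] by (subst diag) (auto simp: coeff_eq_0 degree_pcompose)
  have Trr: "T l r r = fact r * (lead_coeff (q r) * (of_real (- \<beta>)) ^ r) * moment a 1 1" for l r
  proof -
    have "coeff (?P r (x l - \<beta> * of_int (m l))) r
       = lead_coeff (?P r (x l - \<beta> * of_int (m l)))"
      using \<beta> deg[of r] by (simp add: degree_pcompose)
    also have "\<dots> = lead_coeff (q r) * (of_real (- \<beta>)) ^ r"
      using \<beta> deg[of r] by (subst lead_coeff_comp) auto
    finally show ?thesis by (subst diag) auto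
  qed
  define tf where "tf = (\<lambda>r. norm (fact r * (lead_coeff (q r) * (of_real (- \<beta>)) ^ r) * moment a 1 1))"
  define t where "t = Min (tf ` {..<N})"
  have tf: "tf r > 0" for r using q0[of r] \<beta> a(3) by (simp add: tf_def)
  have ne: "{..<N} \<noteq> {}" using N by (auto simp: lessThan_empty_iff)
  have t: "t > 0" unfolding t_def using tf ne by (subst Min_gr_iff) auto
  have tT: "t \<le> norm (T l r r)" if "r < N" for l r
    unfolding Trr tf_def[symmetric] t_def using that by (intro Min_le) (auto simp: tf_def)
  have TC: "norm (T l r j) \<le> D * (C * K)" if "r < N" "j < N" for l r j
  proof -
    have g: "(\<lambda>n. D * (C * gauss c (\<nu> + of_int l - \<beta> * of_int n))) summable_on UNIV"
      by (intro summable_on_cmult_right sG)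
    have "norm (T l r j) \<le> (\<Sum>\<^sub>\<infinity>n. D * (C * gauss c (\<nu> + of_int l - \<beta> * of_int n)))"
      unfolding T_def
    proof (rule summable_on_abs_bound(3)[OF g])
      fix n
      have "norm (sample_kernel j n l) \<le> D * 1"
        using Mb[OF that(2), of n l] c D(1) by (elim order_trans) (intro mult_left_mono, auto)
      then show "norm (\<gamma> r l n * sample_kernel j n l) \<le> D * (C * gauss c (\<nu> + of_int l - \<beta> * of_int n))"
        unfolding norm_mult mult.commute[of D] using C by (intro mult_mono \<gamma>[OF that(1)]) auto
    qed
    also have "\<dots> \<le> D * (C * K)" unfolding infsum_cmult_right'[of D] by (intro mult_left_mono sG D(1))
    finally show ?thesis .
  qed
  have DCK: "D * (C * K) \<ge> 0" using D C K by simp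
  obtain B where B: "B \<ge> 0"
    "\<forall>(d :: nat \<Rightarrow> complex) y T. (\<forall>r<N. y r = (\<Sum>j\<in>{r..<N}. d j * T r j)) \<longrightarrow>
      (\<forall>r<N. norm (T r r) \<ge> t) \<longrightarrow> (\<forall>r<N. \<forall>j<N. norm (T r j) \<le> D * (C * K)) \<longrightarrow>
      (\<forall>r<N. norm (d r) \<le> B * (\<Sum>s<N. norm (y s)))"
    using triangular_system_bound[OF t DCK, of N] by (elim exE conjE) (rule that)
  obtain E where E: "E \<ge> 0"
    "gaussian_kernels_bounded \<nu> \<beta> c C E"
    using gaussian_schur_test[OF c \<beta> C, of \<nu>] by (elim exE conjE) (rule that)
  obtain Bu where Bu: "\<And>d. (\<And>j. j < N \<Longrightarrow> square_summable (d j)) \<Longrightarrow>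
       square_summable (samples d)" using samples_upper_bound by blast
  define F where "F = real N * (B^2 * real N * (real N * E)) + 1"
  have F: "F > 0" using B E by (simp add: F_def add_nonneg_pos)
  show ?thesis
  proof (rule that[of "1 / F"])
    show "1 / F > 0" using F by simp
    fix d :: "nat \<Rightarrow> int \<Rightarrow> complex"
    assume d: "\<And>j. j < N \<Longrightarrow> square_summable (d j)"
    let ?S = "square_sum (samples d)"
    define y where "y = (\<lambda>r l. \<Sum>\<^sub>\<infinity>n. \<gamma> r l n * samples d n)"
    have sS: "square_summable (samples d)" by (rule Bu[OF d])
    have S0: "?S \<ge> 0" by (intro infsum_nonneg) auto
    have ys: "square_summable (y r)" "square_sum (y r) \<le> E * ?S" if "r < N" for r
      using E(2)[rule_format, of "samples d" "\<gamma> r"] sS \<gamma>[OF that] unfolding y_def by auto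
    have db: "norm (d j l) \<le> sqrt (square_sum (d j))" if "j < N" for j l
      using finite_sum_le_infsum[OF d[OF that], of "{l}"] by (intro real_le_rsqrt) auto
    have yeq: "y r l = (\<Sum>j\<in>{r..<N}. d j l * T l r j)" if r: "r < N" for r l
    proof -
      have sj: "(\<lambda>n. \<gamma> r l n * (\<Sum>\<^sub>\<infinity>l'. sample_kernel j n l' * d j l')) summable_on UNIV" if j: "j < N" for j
      proof (rule summable_on_abs_bound(2))
        let ?s = "sqrt (square_sum (d j))"
        have s0: "?s \<ge> 0" by (intro real_sqrt_ge_zero infsum_nonneg) auto
        show "(\<lambda>n. norm (\<gamma> r l n) * (D * K * ?s)) summable_on UNIV"
          by (intro summable_on_cmult_left s\<gamma> r)
        fix n
        have "norm (\<Sum>\<^sub>\<infinity>l'. sample_kernel j n l' * d j l') \<le> (\<Sum>\<^sub>\<infinity>l'. D * gauss c (\<nu> + of_int l' - \<beta> * of_int n) * ?s)"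
        proof (rule summable_on_abs_bound(3))
          show "(\<lambda>l'. D * gauss c (\<nu> + of_int l' - \<beta> * of_int n) * ?s) summable_on UNIV"
            by (intro summable_on_cmult_left sM)
          show "norm (sample_kernel j n l' * d j l') \<le> D * gauss c (\<nu> + of_int l' - \<beta> * of_int n) * ?s" for l'
            unfolding norm_mult using D(1) by (intro mult_mono Mb[OF j] db[OF j]) auto
        qed
        also have "\<dots> \<le> D * K * ?s"
          unfolding infsum_cmult_left' by (intro mult_right_mono sM s0)
        finally show "norm (\<gamma> r l n * (\<Sum>\<^sub>\<infinity>l'. sample_kernel j n l' * d j l')) \<le> norm (\<gamma> r l n) * (D * K * ?s)"
          unfolding norm_mult by (intro mult_left_mono) auto
      qed
      have "y r l = (\<Sum>\<^sub>\<infinity>n. \<Sum>j<N. \<gamma> r l n * (\<Sum>\<^sub>\<infinity>l'. sample_kernel j n l' * d j l'))"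
        unfolding y_def samples_def by (simp add: sum_distrib_left)
      also have "\<dots> = (\<Sum>j<N. \<Sum>\<^sub>\<infinity>n. \<gamma> r l n * (\<Sum>\<^sub>\<infinity>l'. sample_kernel j n l' * d j l'))"
        by (subst infsum_finite_sum(2)) (auto intro: sj)
      also have "\<dots> = (\<Sum>j<N. d j l * T l r j)"
      proof (rule sum.cong[OF refl])
        fix j assume "j \<in> {..<N}"
        then have j: "j < N" by simp
        have "(\<Sum>\<^sub>\<infinity>n. \<gamma> r l n * (\<Sum>\<^sub>\<infinity>l'. sample_kernel j n l' * d j l'))
            = (\<Sum>\<^sub>\<infinity>l'. d j l' * (\<Sum>\<^sub>\<infinity>n. \<gamma> r l n * sample_kernel j n l'))"
          by (rule infsum_swap_bounded_kernel[OF s\<gamma>[OF r] db[OF j] Mb[OF j] sM])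
        also have "\<dots> = (\<Sum>\<^sub>\<infinity>l'\<in>{l}. d j l' * (\<Sum>\<^sub>\<infinity>n. \<gamma> r l n * sample_kernel j n l'))"
          by (rule infsum_cong_neutral) (use off[OF j] in auto)
        also have "\<dots> = d j l * T l r j" by (simp add: T_def)
        finally show "(\<Sum>\<^sub>\<infinity>n. \<gamma> r l n * (\<Sum>\<^sub>\<infinity>l'. sample_kernel j n l' * d j l')) = d j l * T l r j" .
      qed
      also have "\<dots> = (\<Sum>j\<in>{r..<N}. d j l * T l r j)"
        by (rule sum.mono_neutral_right) (auto simp: T0)
      finally show ?thesis .
    qed
    have dy: "norm (d j l) \<le> B * (\<Sum>s<N. norm (y s l))" if "j < N" for j l
      using B(2)[rule_format, of "\<lambda>r. y r l" "\<lambda>j. d j l" "T l" j, OF yeq tT TC that] .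
    have dsum: "square_sum (d j) \<le> B^2 * real N * (real N * E) * ?S" if j: "j < N" for j
    proof -
      have le: "(norm (d j l))^2 \<le> B^2 * real N * (\<Sum>s<N. (norm (y s l))^2)" for l
      proof -
        have "(norm (d j l))^2 \<le> (B * (\<Sum>s<N. norm (y s l)))^2" by (intro power_mono dy[OF j]) auto
        also have "\<dots> = B^2 * (\<Sum>s<N. norm (y s l))^2" by (simp add: power_mult_distrib)
        also have "\<dots> \<le> B^2 * ((\<Sum>s<N. (norm (y s l))^2) * real (card {..<N}))"
          by (intro mult_left_mono sum_squared_le_sum_of_squares) auto
        finally show ?thesis by (simp add: mult_ac)
      qed
      have "square_sum (d j) \<le> (\<Sum>\<^sub>\<infinity>l. B^2 * real N * (\<Sum>s<N. (norm (y s l))^2))"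
        by (intro infsum_mono d[OF j] le summable_on_cmult_right infsum_finite_sum(1) ys) auto
      also have "\<dots> = B^2 * real N * (\<Sum>s<N. square_sum (y s))"
        unfolding infsum_cmult_right' by (subst infsum_finite_sum(2)) (auto intro: ys(1))
      also have "\<dots> \<le> B^2 * real N * (\<Sum>s<N. E * ?S)"
        by (intro mult_left_mono sum_mono ys) auto
      finally show ?thesis by (simp add: mult_ac)
    qed
    have "(\<Sum>j<N. square_sum (d j)) \<le> (\<Sum>j<N. B^2 * real N * (real N * E) * ?S)"
      by (intro sum_mono dsum) auto
    also have "\<dots> \<le> F * ?S" using S0 by (simp add: F_def algebra_simps)
    finally show "1 / F * (\<Sum>j<N. square_sum (d j)) \<le> ?S"
      using F by (simp add: field_simps)
  qed
qed

end

section \<open>Hermite functions and their Fourier transforms\<close>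

text \<open>In terms of the classical Hermite polynomials \<open>H\<^sub>r\<close> this is \<open>(- sqrt (2 * pi))\<^sup>r * H\<^sub>r(sqrt (2 * pi) * t)\<close>.\<close>

fun hermite_poly :: "nat \<Rightarrow> real poly" where
  "hermite_poly 0 = 1"
| "hermite_poly (Suc r) = pderiv (hermite_poly r) - [:0, 4 * pi:] * hermite_poly r"

lemma iterated_deriv_gaussian:
  "(deriv ^^ r) (\<lambda>x. exp (- 2 * pi * x^2)) = (\<lambda>t. poly (hermite_poly r) t * exp (- 2 * pi * t^2))"
proof (induction r)
  case (Suc r)
  have "((\<lambda>t. poly (hermite_poly r) t * exp (- 2 * pi * t^2)) has_real_derivative
      poly (hermite_poly (Suc r)) t * exp (- 2 * pi * t^2)) (at t)" for t
    by (auto intro!: derivative_eq_intros poly_DERIV simp: algebra_simps)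
  then have "deriv (\<lambda>t. poly (hermite_poly r) t * exp (- 2 * pi * t^2)) = (\<lambda>t. poly (hermite_poly (Suc r)) t * exp (- 2 * pi * t^2))"
    by (intro ext DERIV_imp_deriv)
  then show ?case using Suc by simp
qed auto

lemma hermite_poly_degree: "degree (hermite_poly r) = r \<and> hermite_poly r \<noteq> 0"
proof (induction r)
  case (Suc r)
  have 1: "degree ([:0, 4 * pi:] * hermite_poly r) = Suc r"
    using Suc by (subst degree_mult_eq) auto
  have 2: "degree (pderiv (hermite_poly r)) < Suc r" using Suc by (simp add: degree_pderiv)
  have "degree (hermite_poly (Suc r)) = Suc r"
    unfolding hermite_poly.simps diff_conv_add_uminus
    using 1 2 by (subst degree_add_eq_right) (simp_all only: degree_minus)
  then show ?case by (metis degree_0 nat.distinct(1))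
qed simp

lemma hermite_eq: "hermite c r t = c r * of_real (poly (hermite_poly r) t * gauss pi t)"
proof -
  have "exp (pi * t^2) * (poly (hermite_poly r) t * exp (- 2 * pi * t^2)) = poly (hermite_poly r) t * gauss pi t"
    by (simp add: mult.left_commute flip: exp_add)
  then show ?thesis unfolding hermite_def iterated_deriv_gaussian by (simp only:)
qed

lemma poly_times_gaussian_le:
  fixes p :: "real poly"
  assumes "k < a"
  obtains C where "C > 0" "\<And>x. \<bar>poly p x\<bar> * gauss a x \<le> C * gauss k x"
proof -
  obtain C where C: "C > 0" "\<And>x::real. norm (poly (map_poly of_real p :: complex poly) (of_real x)) \<le> C * exp ((a - k) * x^2)"
    using poly_le_gaussian[of "a - k"] assms by (metis diff_gt_0_iff_gt)
  have "poly (map_poly of_real p :: complex poly) (of_real x) = of_real (poly p x)" for x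
    by (induction p) (auto simp: map_poly_pCons)
  then have "\<bar>poly p x\<bar> * gauss a x \<le> (C * exp ((a - k) * x^2)) * gauss a x" for x
    using C(2)[of x] by (intro mult_right_mono) auto
  also have "(C * exp ((a - k) * x^2)) * gauss a x = C * gauss k x" for x
    by (simp add: algebra_simps flip: exp_add)
  finally show ?thesis using that[OF C(1)] by blast
qed

lemma integrable_exp_gaussian:
  fixes a :: real
  assumes "a > 0"
  shows "integrable lborel (\<lambda>t::real. gauss a t)"
proof -
  define s where "s = sqrt (1 / (2 * a))"
  have s: "s > 0" "2 * s^2 = 1 / a" using assms by (auto simp: s_def)
  have "integrable lborel (\<lambda>x. sqrt (2 * pi * s^2) * normal_density 0 s x)"
    using s(1) by (intro integrable_mult_right integrable_normal_density) auto
  moreover have "sqrt (2 * pi * s^2) * normal_density 0 s x = gauss a x" for x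
  proof -
    have "normal_density 0 s x = 1 / sqrt (2 * pi * s^2) * exp (- x\<^sup>2 / (2 * s^2))"
      by (simp add: normal_density_def)
    also have "- x\<^sup>2 / (2 * s^2) = - a * x^2" unfolding s(2) by simp
    finally show ?thesis using s(1) by simp
  qed
  ultimately show ?thesis by simp
qed

lemma integrable_poly_gaussian:
  fixes p :: "real poly" and a b :: real
  assumes "a > 0"
  shows "integrable lborel (\<lambda>t. of_real (poly p t * gauss a t) * cis (b * t))"
proof -
  obtain C where C: "C > 0" "\<And>x. \<bar>poly p x\<bar> * gauss a x \<le> C * gauss (a/2) x"
    using poly_times_gaussian_le[of "a/2" a p] assms by auto
  show ?thesis
  proof (rule Bochner_Integration.integrable_bound)
    show "integrable lborel (\<lambda>t. C * gauss (a/2) t)"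
      using assms by (intro integrable_mult_right integrable_exp_gaussian) auto
    show "(\<lambda>t. complex_of_real (poly p t * gauss a t) * cis (b * t)) \<in> borel_measurable lborel"
      unfolding measurable_lborel2 by (intro borel_measurable_continuous_onI continuous_intros)
    show "AE t in lborel. norm (complex_of_real (poly p t * gauss a t) * cis (b * t)) \<le> norm (C * gauss (a/2) t)"
      by (rule AE_I2) (use C in \<open>simp add: norm_mult abs_mult\<close>)
  qed
qed

definition gaussian_transform :: "real \<Rightarrow> real poly \<Rightarrow> real \<Rightarrow> complex" where
  "gaussian_transform a p b = (LINT t|lborel. of_real (poly p t * gauss a t) * cis (b * t))"

lemma gaussian_transform_add:
  assumes "a > 0"
  shows "gaussian_transform a (p + q) b = gaussian_transform a p b + gaussian_transform a q b"
proof -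
  have eq: "of_real (poly (p + q) t * gauss a t) * cis (b * t)
    = of_real (poly p t * gauss a t) * cis (b * t) + of_real (poly q t * gauss a t) * cis (b * t)" for t
    by (simp add: algebra_simps)
  show ?thesis
    unfolding gaussian_transform_def eq
    by (rule Bochner_Integration.integral_add) (rule integrable_poly_gaussian[OF assms])+
qed

lemma gaussian_transform_smult:
  "gaussian_transform a (smult r p) b = of_real r * gaussian_transform a p b"
  unfolding gaussian_transform_def by (subst integral_mult_right_zero[symmetric]) (simp add: mult_ac)

text \<open>The integral of the derivative of \<open>p(t) * gauss a t * cis (b * t)\<close> over the line is zero. This one identity yields the
orthogonality of the Hermite functions as well as their Fourier transforms, without differentiating under the integral.\<close>

lemma gaussian_transform_by_parts:
  assumes a: "a > 0"
  shows "gaussian_transform a (pderiv p - [:0, 2 * a:] * p) b + \<i> * of_real b * gaussian_transform a p b = 0"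
proof -
  let ?F = "\<lambda>t. complex_of_real (poly p t * gauss a t) * cis (b * t)"
  let ?f = "\<lambda>t. complex_of_real (poly (pderiv p - [:0, 2 * a:] * p) t * gauss a t) * cis (b * t)
     + \<i> * of_real b * (complex_of_real (poly p t * gauss a t) * cis (b * t))"
  have int: "integrable lborel ?f"
    by (intro Bochner_Integration.integrable_add integrable_mult_right integrable_poly_gaussian a)
  have der: "(?F has_vector_derivative ?f t) (at t)" for t
  proof -
    have 1: "((\<lambda>t. poly p t * gauss a t) has_real_derivative poly (pderiv p - [:0, 2 * a:] * p) t * gauss a t) (at t)"
      by (auto intro!: derivative_eq_intros poly_DERIV simp: algebra_simps)
    have 2: "((\<lambda>t. cis (b * t)) has_vector_derivative (\<i> * of_real b * cis (b * t))) (at t)"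
    proof -
      have "((\<lambda>t. cis (b * t)) has_derivative (\<lambda>h. (b * h) *\<^sub>R (\<i> * cis (b * t)))) (at t)"
        by (rule has_derivative_cis) (auto intro!: derivative_eq_intros)
      then show ?thesis unfolding has_vector_derivative_def by (simp add: scaleR_conv_of_real mult_ac)
    qed
    have 3: "((\<lambda>t. complex_of_real (poly p t * gauss a t)) has_vector_derivative
       complex_of_real (poly (pderiv p - [:0, 2 * a:] * p) t * gauss a t)) (at t)"
      using has_vector_derivative_of_real[OF 1] .
    show ?thesis
      using has_vector_derivative_mult[OF 3 2] by (simp add: algebra_simps)
  qed
  obtain C where C: "C > 0" "\<And>x. \<bar>poly p x\<bar> * gauss a x \<le> C * gauss (a/2) x"
    using poly_times_gaussian_le[of "a/2" a p] a by auto
  then have bound: "norm (?F t) \<le> C * gauss (a/2) t" for t by (simp add: norm_mult abs_mult)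
  have g: "((\<lambda>t. C * gauss (a/2) t) \<longlongrightarrow> 0) at_top" "((\<lambda>t. C * gauss (a/2) t) \<longlongrightarrow> 0) at_bot"
    using a C(1) by real_asymp+
  have lim: "(?F \<longlongrightarrow> 0) at_top" "(?F \<longlongrightarrow> 0) at_bot"
    by (rule Lim_null_comparison[OF always_eventually g(1)], use bound in blast)
       (rule Lim_null_comparison[OF always_eventually g(2)], use bound in blast)
  have "(LBINT t=-\<infinity>..\<infinity>. ?f t) = 0 - 0"
  proof (rule interval_integral_FTC_integrable)
    have "continuous_on UNIV ?f" by (intro continuous_intros)
    then show "isCont ?f t" for t by (simp only: continuous_on_eq_continuous_at[OF open_UNIV])  blast
    show "set_integrable lborel (einterval (- \<infinity>) \<infinity>) ?f"
      using int by (simp add: set_integrable_def)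
    show "((?F \<circ> real_of_ereal) \<longlongrightarrow> 0) (at_right (- \<infinity>))" "((?F \<circ> real_of_ereal) \<longlongrightarrow> 0) (at_left \<infinity>)"
      unfolding ereal_tendsto_simps1 using lim by auto
  qed (use der in auto)
  then have "(LINT t|lborel. ?f t) = 0"
    by (simp add: interval_lebesgue_integral_def set_lebesgue_integral_def)
  moreover have "(LINT t|lborel. ?f t) = gaussian_transform a (pderiv p - [:0, 2 * a:] * p) b + \<i> * of_real b * gaussian_transform a p b"
    unfolding gaussian_transform_def integral_mult_right_zero[symmetric]
    by (rule Bochner_Integration.integral_add) (intro integrable_mult_right integrable_poly_gaussian a)+
  ultimately show ?thesis by simp
qed

text \<open>A rescaling of the characteristic function of the standard normal distribution.\<close>

lemma gaussian_transform_1: "gaussian_transform pi 1 (2 * pi * \<xi>) = of_real (gauss pi \<xi>)"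
proof -
  define s where "s = sqrt (2 * pi)"
  have s: "s > 0" "s^2 = 2 * pi" by (auto simp: s_def)
  have "of_real (exp (- ((s * \<xi>)^2) / 2)) = char std_normal_distribution (s * \<xi>)"
    by (simp add: char_std_normal_distribution)
  also have "\<dots> = (LINT x|lborel. std_normal_density x *\<^sub>R iexp (s * \<xi> * x))"
    unfolding char_def by (subst integral_density) (auto simp: normal_density_nonneg)
  also have "\<dots> = s *\<^sub>R (LINT x|lborel. std_normal_density (s * x) *\<^sub>R iexp (s * \<xi> * (s * x)))"
    using lborel_integral_real_affine[of s "\<lambda>x. std_normal_density x *\<^sub>R iexp (s * \<xi> * x)" 0] s(1) by simp
  also have "\<dots> = (LINT x|lborel. s *\<^sub>R (std_normal_density (s * x) *\<^sub>R iexp (s * \<xi> * (s * x))))"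
    by (rule integral_scaleR_right[symmetric])
  also have "\<dots> = gaussian_transform pi 1 (2 * pi * \<xi>)"
    unfolding gaussian_transform_def
  proof (rule Bochner_Integration.integral_cong[OF refl])
    fix x
    have 1: "s * \<xi> * (s * x) = 2 * pi * \<xi> * x" using s(2) by (simp add: power2_eq_square mult_ac)
    have 2: "s * std_normal_density (s * x) = gauss pi x"
      using s by (simp add: std_normal_density_def power_mult_distrib s_def[symmetric])
    show "s *\<^sub>R (std_normal_density (s * x) *\<^sub>R iexp (s * \<xi> * (s * x)))
      = complex_of_real (poly 1 x * gauss pi x) * cis (2 * pi * \<xi> * x)"
      unfolding scaleR_scaleR 1 2 by (simp only: cis_conv_exp scaleR_conv_of_real poly_1 mult_1)
  qed
  finally show ?thesis using s(2) by (simp add: power_mult_distrib)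
qed

text \<open>Integration by parts expresses the transform of \<open>t * p'(t)\<close> through those of \<open>p'\<close> and its derivative; the leading coefficient is
multiplied by \<open>\<i>\<close> in each step, so the degree is preserved exactly.\<close>

lemma gaussian_transform_poly:
  assumes "degree p \<le> n"
  shows "\<exists>q. degree q \<le> n \<and> coeff q n = \<i> ^ n * of_real (coeff p n) \<and>
    (\<forall>\<xi>. gaussian_transform pi p (2 * pi * \<xi>) = poly q (of_real \<xi>) * of_real (gauss pi \<xi>))"
  using assms
proof (induction n arbitrary: p)
  case 0
  then obtain c where c: "p = [:c:]" by (metis degree_eq_zeroE le_zero_eq)
  have "gaussian_transform pi p b = of_real c * gaussian_transform pi 1 b" for b
    using gaussian_transform_smult[of pi c 1 b] c by simp
  then show ?case
    by (intro exI[of _ "[:of_real c:]"]) (simp add: c gaussian_transform_1)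
next
  case (Suc n)
  obtain a p' where p: "p = pCons a p'" by (cases p)
  have d': "degree p' \<le> n" using Suc.prems p by (cases "p' = 0") auto
  obtain q where q: "degree q \<le> n" "coeff q n = \<i> ^ n * of_real (coeff p' n)"
    "\<And>\<xi>. gaussian_transform pi p' (2 * pi * \<xi>) = poly q (of_real \<xi>) * of_real (gauss pi \<xi>)"
    using Suc.IH[OF d'] by auto
  have "degree (pderiv p') \<le> n" using d' by (simp add: degree_pderiv)
  then obtain q' where q': "degree q' \<le> n"
    "\<And>\<xi>. gaussian_transform pi (pderiv p') (2 * pi * \<xi>) = poly q' (of_real \<xi>) * of_real (gauss pi \<xi>)"
    using Suc.IH by blast
  define Q where "Q = [:of_real a:] + smult (1 / (2 * of_real pi)) q' + smult \<i> (pCons 0 q)"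
  have "gaussian_transform pi p (2 * pi * \<xi>) = poly Q (of_real \<xi>) * of_real (gauss pi \<xi>)" for \<xi>
  proof -
    let ?G = "\<lambda>p. gaussian_transform pi p (2 * pi * \<xi>)"
    have "pderiv p' - [:0, 2 * pi:] * p' = pderiv p' + smult (- (2 * pi)) (pCons 0 p')" by simp
    then have "?G (pderiv p') - 2 * of_real pi * ?G (pCons 0 p') + \<i> * of_real (2 * pi * \<xi>) * ?G p' = 0"
      using gaussian_transform_by_parts[OF pi_gt_zero, of p' "2 * pi * \<xi>"]
      by (simp only: gaussian_transform_add[OF pi_gt_zero] gaussian_transform_smult) simp
    then have "?G (pCons 0 p') = ?G (pderiv p') / (2 * of_real pi) + \<i> * of_real \<xi> * ?G p'"
      by (simp add: field_simps)
    moreover have "?G p = of_real a * ?G 1 + ?G (pCons 0 p')"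
    proof -
      have "p = smult a 1 + pCons 0 p'" by (simp add: p)
      then show ?thesis by (metis gaussian_transform_add[OF pi_gt_zero] gaussian_transform_smult)
    qed
    ultimately show ?thesis
      unfolding q(3) q'(2) gaussian_transform_1 Q_def by (simp add: field_simps)
  qed
  moreover have "degree Q \<le> Suc n"
    unfolding Q_def using q(1) q'(1)
    by (intro degree_add_le) (auto intro: order_trans[OF degree_smult_le] simp: degree_pCons_eq_if)
  moreover have "coeff Q (Suc n) = \<i> ^ Suc n * of_real (coeff p (Suc n))"
    unfolding Q_def p using q q'(1) by (simp add: coeff_eq_0 coeff_pCons)
  ultimately show ?case by blast
qed

text \<open>Moving the \<open>r\<close> derivatives in the Rodrigues formula onto a polynomial of degree below \<open>r\<close> annihilates it.\<close>

lemma hermite_poly_orthogonal: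
  assumes "degree p < r \<or> p = 0"
  shows "gaussian_transform (2 * pi) (p * hermite_poly r) 0 = 0"
  using assms
proof (induction r arbitrary: p)
  case 0
  then show ?case by (simp add: gaussian_transform_def)
next
  case (Suc r)
  have pos: "2 * pi > 0" by simp
  let ?H = "hermite_poly r"
  have "degree (pderiv p) < r \<or> pderiv p = 0"
    using Suc.prems by (cases "degree p = 0") (auto simp: degree_pderiv pderiv_eq_0_iff)
  then have 1: "gaussian_transform (2 * pi) (pderiv p * ?H) 0 = 0" by (rule Suc.IH)
  have "pderiv (p * ?H) - [:0, 2 * (2 * pi):] * (p * ?H) = pderiv p * ?H + p * hermite_poly (Suc r)"
    by (simp add: pderiv_mult algebra_simps)
  then have "gaussian_transform (2 * pi) (pderiv p * ?H) 0 + gaussian_transform (2 * pi) (p * hermite_poly (Suc r)) 0 = 0"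
    using gaussian_transform_by_parts[OF pos, of "p * ?H" 0] gaussian_transform_add[OF pos] by simp
  then show ?case using 1 by simp
qed

lemma integral_lebesgue_continuous:
  fixes f :: "real \<Rightarrow> 'a::euclidean_space"
  assumes "continuous_on UNIV f"
  shows "integral\<^sup>L lebesgue f = integral\<^sup>L lborel f" "integrable lebesgue f \<longleftrightarrow> integrable lborel f"
    "f \<in> borel_measurable lebesgue"
proof -
  have "f \<in> borel_measurable borel" using assms by (rule borel_measurable_continuous_onI)
  then have m: "f \<in> borel_measurable lborel" by simp
  show "integral\<^sup>L lebesgue f = integral\<^sup>L lborel f" by (rule integral_completion[OF m])
  show "integrable lebesgue f \<longleftrightarrow> integrable lborel f" by (rule integrable_completion[OF m])
  show "f \<in> borel_measurable lebesgue" using m by (rule measurable_completion)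
qed

lemma hermite_continuous: "continuous_on UNIV (hermite c r)"
  unfolding hermite_eq[abs_def] by (intro continuous_intros)

lemma hermite_in_L2R: "hermite c r \<in> L2R"
proof -
  have eq: "(cmod (hermite c r t))^2 = (cmod (c r))^2 * (poly (hermite_poly r * hermite_poly r) t * gauss (2 * pi) t)" for t
    unfolding hermite_eq
    by (simp add: norm_mult power_mult_distrib abs_mult power2_eq_square mult_ac flip: exp_add)
  have "integrable lborel (\<lambda>t. of_real (poly (hermite_poly r * hermite_poly r) t * gauss (2 * pi) t) * cis (0 * t))"
    by (rule integrable_poly_gaussian) simp
  from integrable_Re[OF this] have "integrable lborel (\<lambda>t. (cmod (hermite c r t))^2)"
    unfolding eq by (intro integrable_mult_right) simp
  moreover have "continuous_on UNIV (\<lambda>t. (cmod (hermite c r t))^2)"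
    by (intro continuous_intros hermite_continuous)
  ultimately show ?thesis
    unfolding L2R_def using integral_lebesgue_continuous(2,3) hermite_continuous by auto
qed

lemma inner_hermite:
  "inner_L2R (hermite c i) (hermite c j) = c i * cnj (c j) * gaussian_transform (2 * pi) (hermite_poly i * hermite_poly j) 0"
proof -
  have eq: "hermite c i t * cnj (hermite c j t)
    = c i * cnj (c j) * (of_real (poly (hermite_poly i * hermite_poly j) t * gauss (2 * pi) t) * cis (0 * t))" for t
  proof -
    have "gauss pi t * gauss pi t = gauss (2 * pi) t" by (simp flip: exp_add)
    then have "of_real (gauss (2 * pi) t) = (of_real (gauss pi t) * of_real (gauss pi t) :: complex)"
      by (metis of_real_mult)
    then show ?thesis unfolding hermite_eq by simp
  qed
  have "continuous_on UNIV (\<lambda>t. hermite c i t * cnj (hermite c j t))"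
    by (intro continuous_intros hermite_continuous)
  then have "inner_L2R (hermite c i) (hermite c j) = (LINT t|lborel. hermite c i t * cnj (hermite c j t))"
    unfolding inner_L2R_def by (rule integral_lebesgue_continuous)
  then show ?thesis unfolding eq gaussian_transform_def by simp
qed

lemma hermite_orthonormal:
  assumes "\<And>r. norm_L2R (hermite c r) = 1"
  shows "inner_L2R (hermite c i) (hermite c j) = (if i = j then 1 else 0)"
proof (cases "i = j")
  case True
  have "inner_L2R (hermite c j) (hermite c j) = of_real (LINT t|lebesgue. (cmod (hermite c j t))^2)"
    unfolding inner_L2R_def integral_complex_of_real[symmetric] by (simp only: complex_norm_square)
  moreover have "(LINT t|lebesgue. (cmod (hermite c j t))^2) = 1"
    using assms[of j] by (simp add: norm_L2R_def)
  ultimately show ?thesis using True by simp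
next
  case False
  then consider "i < j" | "j < i" by linarith
  then have "gaussian_transform (2 * pi) (hermite_poly i * hermite_poly j) 0 = 0"
  proof cases
    case 1
    then show ?thesis using hermite_poly_degree[of i] by (intro hermite_poly_orthogonal) auto
  next
    case 2
    then have "gaussian_transform (2 * pi) (hermite_poly j * hermite_poly i) 0 = 0"
      using hermite_poly_degree[of j] by (intro hermite_poly_orthogonal) auto
    then show ?thesis by (simp add: mult.commute)
  qed
  then show ?thesis using False by (simp add: inner_hermite)
qed

lemma hermite_const_nonzero:
  assumes "norm_L2R (hermite c r) = 1"
  shows "c r \<noteq> 0"
  using assms by (auto simp: norm_L2R_def hermite_eq)

text \<open>The conjugate is taken because it appears in the inner product of a function with the frame elements.\<close>

lemma hermite_fourier_transform:
  assumes "\<And>r. norm_L2R (hermite c r) = 1"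
  obtains q where "\<And>j. degree (q j) = j" "\<And>j. q j \<noteq> 0"
    "\<And>j \<xi>. (LINT t|lborel. cnj (hermite c j t) * cis (2 * pi * \<xi> * t)) = poly (q j) (of_real \<xi>) * of_real (gauss pi \<xi>)"
proof -
  have "\<forall>j. \<exists>q. degree q = j \<and> q \<noteq> 0 \<and> (\<forall>\<xi>. (LINT t|lborel. cnj (hermite c j t) * cis (2 * pi * \<xi> * t))
      = poly q (of_real \<xi>) * of_real (gauss pi \<xi>))"
  proof
    fix j
    have dj: "degree (hermite_poly j) \<le> j" using hermite_poly_degree[of j] by simp
    have lj: "coeff (hermite_poly j) j \<noteq> 0" using hermite_poly_degree[of j] by (metis leading_coeff_0_iff)
    obtain q where q: "degree q \<le> j" "coeff q j = \<i> ^ j * of_real (coeff (hermite_poly j) j)"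
      "\<And>\<xi>. gaussian_transform pi (hermite_poly j) (2 * pi * \<xi>) = poly q (of_real \<xi>) * of_real (gauss pi \<xi>)"
      using gaussian_transform_poly[OF dj] by auto
    have c0: "coeff q j \<noteq> 0" unfolding q(2) using lj by simp
    then have "degree q = j" using q(1) le_degree by (metis le_antisym)
    moreover have "(LINT t|lborel. cnj (hermite c j t) * cis (2 * pi * \<xi> * t))
      = poly (smult (cnj (c j)) q) (of_real \<xi>) * of_real (gauss pi \<xi>)" for \<xi>
    proof -
      have "(LINT t|lborel. cnj (hermite c j t) * cis (2 * pi * \<xi> * t)) = cnj (c j) * gaussian_transform pi (hermite_poly j) (2 * pi * \<xi>)"
        unfolding gaussian_transform_def integral_mult_right_zero[symmetric] hermite_eq by (simp add: mult_ac)
      then show ?thesis by (simp add: q(3))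
    qed
    ultimately show "\<exists>q. degree q = j \<and> q \<noteq> 0 \<and> (\<forall>\<xi>. (LINT t|lborel. cnj (hermite c j t) * cis (2 * pi * \<xi> * t))
      = poly q (of_real \<xi>) * of_real (gauss pi \<xi>))"
      using hermite_const_nonzero[OF assms[of j]] c0 by (intro exI[of _ "smult (cnj (c j)) q"]) auto
  qed
  then show ?thesis using that by metis
qed

section \<open>Fourier series in L2(0,1)\<close>

abbreviation character :: "int \<Rightarrow> real \<Rightarrow> complex" where
  "character l t \<equiv> cis (2 * pi * of_int l * t)"

abbreviation unit_interval :: "real measure" where
  "unit_interval \<equiv> restrict_space lebesgue {0<..<1}"

definition square_integrable :: "(real \<Rightarrow> complex) \<Rightarrow> bool" where
  "square_integrable f \<longleftrightarrow> f \<in> borel_measurable unit_interval \<and> integrable unit_interval (\<lambda>t. (cmod (f t))^2)"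

definition fourier_coeff :: "(real \<Rightarrow> complex) \<Rightarrow> int \<Rightarrow> complex" where
  "fourier_coeff f l = (LINT t|unit_interval. f t * cnj (character l t))"

lemma finite_measure_unit_interval: "finite_measure unit_interval"
  by (rule finite_measureI) (simp add: emeasure_restrict_space space_restrict_space)

lemma measurable_unit_interval:
  "f \<in> borel_measurable lebesgue \<Longrightarrow> f \<in> borel_measurable unit_interval"
  by (rule measurable_restrict_space1)

lemma continuous_measurable_unit_interval:
  fixes f :: "real \<Rightarrow> 'b::euclidean_space"
  assumes "continuous_on UNIV f"
  shows "f \<in> borel_measurable unit_interval"
proof -
  have "f \<in> borel_measurable lborel" using borel_measurable_continuous_onI[OF assms] by simp
  then show ?thesis by (intro measurable_unit_interval measurable_completion)
qed

lemma integrable_bounded_unit_interval: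
  fixes f :: "real \<Rightarrow> 'b::{banach, second_countable_topology}"
  assumes "f \<in> borel_measurable unit_interval" "\<And>t. norm (f t) \<le> B"
  shows "integrable unit_interval f"
  using assms by (intro finite_measure.integrable_const_bound[OF finite_measure_unit_interval, of _ B]) auto

lemma square_integrable_bounded:
  assumes "f \<in> borel_measurable unit_interval" "\<And>t. norm (f t) \<le> B"
  shows "square_integrable f"
proof -
  have "(\<lambda>t. (cmod (f t))^2) \<in> borel_measurable unit_interval" using assms(1) by measurable
  moreover have "norm ((cmod (f t))^2) \<le> B^2" for t using assms(2)[of t] by (simp add: power_mono)
  ultimately show ?thesis unfolding square_integrable_def using assms(1)
    by (auto intro!: integrable_bounded_unit_interval[of "\<lambda>t. (cmod (f t))^2" "B^2"])
qed

lemma borel_measurable_cnj: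
  "f \<in> borel_measurable M \<Longrightarrow> (\<lambda>t. cnj (f t)) \<in> borel_measurable M"
  by (rule borel_measurable_continuous_on[where f = cnj]) (intro continuous_intros)

lemma square_integrable_mult:
  assumes f: "square_integrable f" and g: "square_integrable g"
  shows "integrable unit_interval (\<lambda>t. f t * cnj (g t))"
proof (rule Bochner_Integration.integrable_bound)
  show "integrable unit_interval (\<lambda>t. (cmod (f t))^2 + (cmod (g t))^2)"
    using f g by (auto simp: square_integrable_def)
  have "f \<in> borel_measurable unit_interval" "g \<in> borel_measurable unit_interval"
    using f g by (auto simp: square_integrable_def)
  then show "(\<lambda>t. f t * cnj (g t)) \<in> borel_measurable unit_interval"
    by (intro borel_measurable_times borel_measurable_cnj)
  show "AE t in unit_interval. norm (f t * cnj (g t)) \<le> norm ((cmod (f t))^2 + (cmod (g t))^2)"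
  proof (rule AE_I2)
    fix t
    have "cmod (f t) * cmod (g t) \<le> (cmod (f t))^2 + (cmod (g t))^2"
      using sum_squares_bound[of "cmod (f t)" "cmod (g t)"]
        mult_nonneg_nonneg[OF norm_ge_zero norm_ge_zero, of "f t" "g t"] by linarith
    then show "norm (f t * cnj (g t)) \<le> norm ((cmod (f t))^2 + (cmod (g t))^2)"
      by (simp add: norm_mult)
  qed
qed

lemma norm_add_squared_le: "(norm (a + b :: complex))^2 \<le> 2 * (norm a)^2 + 2 * (norm b)^2"
proof -
  have "(norm (a + b))^2 \<le> (norm a + norm b)^2" by (intro power_mono norm_triangle_ineq) auto
  also have "\<dots> \<le> 2 * (norm a)^2 + 2 * (norm b)^2"
    using sum_squares_bound[of "norm a" "norm b"] by (simp add: power2_sum)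
  finally show ?thesis .
qed

lemma square_integrable_add:
  assumes f: "square_integrable f" and g: "square_integrable g"
  shows "square_integrable (\<lambda>t. f t + g t)"
proof -
  have m: "f \<in> borel_measurable unit_interval" "g \<in> borel_measurable unit_interval"
    using f g by (auto simp: square_integrable_def)
  have "integrable unit_interval (\<lambda>t. (cmod (f t + g t))^2)"
  proof (rule Bochner_Integration.integrable_bound)
    show "integrable unit_interval (\<lambda>t. 2 * (cmod (f t))^2 + 2 * (cmod (g t))^2)"
      using f g by (auto simp: square_integrable_def)
    show "(\<lambda>t. (cmod (f t + g t))^2) \<in> borel_measurable unit_interval" using m by measurable
    show "AE t in unit_interval. norm ((cmod (f t + g t))^2) \<le> norm (2 * (cmod (f t))^2 + 2 * (cmod (g t))^2)"
      by (rule AE_I2) (use norm_add_squared_le in simp)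
  qed
  then show ?thesis using m by (simp add: square_integrable_def)
qed

lemma square_integrable_cmult:
  assumes f: "square_integrable f"
  shows "square_integrable (\<lambda>t. c * f t)"
  using assms unfolding square_integrable_def by (auto simp: norm_mult power_mult_distrib)

lemma square_integrable_cis:
  assumes f: "square_integrable f"
  shows "square_integrable (\<lambda>t. f t * cis (b * t))"
proof -
  have "(\<lambda>t. cis (b * t)) \<in> borel_measurable unit_interval"
    by (intro continuous_measurable_unit_interval continuous_intros)
  then show ?thesis using assms unfolding square_integrable_def
    by (auto simp: norm_mult)
qed

lemma square_integrable_continuous_bounded:
  assumes "continuous_on UNIV f" "\<And>t. norm (f t) \<le> B"
  shows "square_integrable f"
  by (rule square_integrable_bounded[OF continuous_measurable_unit_interval[OF assms(1)] assms(2)])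

lemma square_integrable_character: "square_integrable (\<lambda>t. character l t)"
  by (rule square_integrable_continuous_bounded[of _ 1]) (auto intro!: continuous_intros)

definition trig_poly :: "int set \<Rightarrow> (int \<Rightarrow> complex) \<Rightarrow> real \<Rightarrow> complex" where
  "trig_poly F c t = (\<Sum>l\<in>F. c l * character l t)"

lemma square_integrable_trig_poly: "finite F \<Longrightarrow> square_integrable (trig_poly F c)"
  unfolding trig_poly_def[abs_def]
  by (rule square_integrable_continuous_bounded[of _ "\<Sum>l\<in>F. norm (c l)"])
     (auto intro!: continuous_intros sum_norm_le simp: norm_mult)

lemma integral_unit_interval: "(LINT t|unit_interval. f t) = (LINT t:{0<..<1}|lebesgue. (f t :: complex))"
  by (simp add: integral_restrict_space set_lebesgue_integral_def)

lemma integral_character: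
  "(LINT t|unit_interval. character l t) = (if l = 0 then 1 else 0)"
proof -
  have 1: "(LINT t|unit_interval. character l t) = (LBINT t=0..1. character l t)"
  proof -
    have m: "(\<lambda>t. indicator {0<..<1} t *\<^sub>R character l t) \<in> borel_measurable lborel"
      by (intro borel_measurable_scaleR borel_measurable_indicator)
         (auto intro!: borel_measurable_continuous_onI continuous_intros)
    have "einterval 0 1 = {0<..<1::real}" by (simp add: zero_ereal_def one_ereal_def)
    then show ?thesis
      unfolding integral_unit_interval interval_lebesgue_integral_def set_lebesgue_integral_def
      using integral_completion[OF m] by simp
  qed
  show ?thesis
  proof (cases "l = 0")
    case True
    then show ?thesis by (simp add: measure_restrict_space)
  next
    case False
    let ?b = "2 * pi * of_int l"
    have b: "?b \<noteq> 0" using False by simp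
    have "(LBINT t=0..1. cis (?b * t)) = cis (?b * 1) / (\<i> * of_real ?b) - cis (?b * 0) / (\<i> * of_real ?b)"
      unfolding zero_ereal_def one_ereal_def
    proof (rule interval_integral_FTC_finite)
      show "continuous_on {min 0 1..max 0 1} (\<lambda>t. cis (?b * t))" by (intro continuous_intros)
      fix x :: real
      have "((\<lambda>t. cis (?b * t)) has_derivative (\<lambda>h. (?b * h) *\<^sub>R (\<i> * cis (?b * x)))) (at x within {min 0 1..max 0 1})"
        by (rule has_derivative_cis) (auto intro!: derivative_eq_intros)
      then have "((\<lambda>t. cis (?b * t)) has_vector_derivative (\<i> * of_real ?b * cis (?b * x))) (at x within {min 0 1..max 0 1})"
        unfolding has_vector_derivative_def by (simp add: scaleR_conv_of_real mult_ac)
      from has_vector_derivative_divide[OF this, of "\<i> * of_real ?b"]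
      show "((\<lambda>t. cis (?b * t) / (\<i> * of_real ?b)) has_vector_derivative cis (?b * x)) (at x within {min 0 1..max 0 1})"
        using b by simp
    qed
    also have "cis (?b * 1) = 1" using cis_multiple_2pi[of "of_int l"] by simp
    finally show ?thesis unfolding 1 using False by simp
  qed
qed

lemma fourier_coeff_trig_poly_inner:
  assumes F: "finite F" and f: "square_integrable f"
  shows "(LINT t|unit_interval. f t * cnj (trig_poly F c t)) = (\<Sum>l\<in>F. cnj (c l) * fourier_coeff f l)"
proof -
  have "(LINT t|unit_interval. f t * cnj (trig_poly F c t))
    = (LINT t|unit_interval. (\<Sum>l\<in>F. cnj (c l) * (f t * cnj (character l t))))"
    by (simp add: trig_poly_def sum_distrib_left mult_ac)
  also have "\<dots> = (\<Sum>l\<in>F. (LINT t|unit_interval. cnj (c l) * (f t * cnj (character l t))))"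
    by (intro Bochner_Integration.integral_sum integrable_mult_right square_integrable_mult f square_integrable_character)
  finally show ?thesis by (simp add: fourier_coeff_def)
qed

lemma fourier_coeff_trig_poly:
  assumes "finite F"
  shows "fourier_coeff (trig_poly F c) l = (if l \<in> F then c l else 0)"
proof -
  have eq: "trig_poly F c t * cnj (character l t) = (\<Sum>k\<in>F. c k * cis (2 * pi * of_int (k - l) * t))" for t
    unfolding trig_poly_def sum_distrib_right cis_cnj mult.assoc[of "c _"] cis_mult
    by (simp add: algebra_simps)
  have "fourier_coeff (trig_poly F c) l = (LINT t|unit_interval. (\<Sum>k\<in>F. c k * cis (2 * pi * of_int (k - l) * t)))"
    unfolding fourier_coeff_def eq ..
  also have "\<dots> = (\<Sum>k\<in>F. c k * (LINT t|unit_interval. cis (2 * pi * of_int (k - l) * t)))"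
    by (subst Bochner_Integration.integral_sum)
       (auto intro!: integrable_mult_right integrable_bounded_unit_interval[of _ 1] continuous_measurable_unit_interval continuous_intros)
  also have "\<dots> = (\<Sum>k\<in>F. if k = l then c k else 0)"
    unfolding integral_character by (intro sum.cong) auto
  also have "\<dots> = (if l \<in> F then c l else 0)" using assms by (simp add: sum.delta)
  finally show ?thesis .
qed

text \<open>With \<open>c\<close> the Fourier coefficients this is Bessel's inequality; for arbitrary \<open>c\<close> it shows that the partial sums approximate at least
as well as any trigonometric polynomial with the same frequencies.\<close>

lemma best_approximation_identity:
  assumes F: "finite F" and f: "square_integrable f"
  shows "(LINT t|unit_interval. (cmod (f t - trig_poly F c t))^2)
    = (LINT t|unit_interval. (cmod (f t))^2) - (\<Sum>l\<in>F. (cmod (fourier_coeff f l))^2)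
      + (\<Sum>l\<in>F. (cmod (fourier_coeff f l - c l))^2)"
proof -
  let ?p = "trig_poly F c"
  note p = square_integrable_trig_poly[OF F, of c]
  have "complex_of_real (LINT t|unit_interval. (cmod (f t - ?p t))^2)
     = (LINT t|unit_interval. f t * cnj (f t) - f t * cnj (?p t) - ?p t * cnj (f t) + ?p t * cnj (?p t))"
    unfolding integral_complex_of_real[symmetric] complex_norm_square
    by (simp add: algebra_simps)
  also have "\<dots> = (LINT t|unit_interval. f t * cnj (f t)) - (LINT t|unit_interval. f t * cnj (?p t))
      - (LINT t|unit_interval. ?p t * cnj (f t)) + (LINT t|unit_interval. ?p t * cnj (?p t))"
    using square_integrable_mult[OF f f] square_integrable_mult[OF f p] square_integrable_mult[OF p f] square_integrable_mult[OF p p]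
    by simp
  also have "(LINT t|unit_interval. f t * cnj (f t)) = complex_of_real (LINT t|unit_interval. (cmod (f t))^2)"
    unfolding integral_complex_of_real[symmetric] complex_norm_square ..
  also have "(LINT t|unit_interval. ?p t * cnj (f t)) = cnj (LINT t|unit_interval. f t * cnj (?p t))"
    using integral_bounded_linear[OF bounded_linear_cnj square_integrable_mult[OF f p]] by (simp add: mult.commute)
  also have "(LINT t|unit_interval. f t * cnj (?p t)) = (\<Sum>l\<in>F. cnj (c l) * fourier_coeff f l)"
    by (rule fourier_coeff_trig_poly_inner[OF F f])
  also have "(LINT t|unit_interval. ?p t * cnj (?p t)) = (\<Sum>l\<in>F. cnj (c l) * c l)"
    unfolding fourier_coeff_trig_poly_inner[OF F p] fourier_coeff_trig_poly[OF F] by (intro sum.cong) auto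
  finally have "complex_of_real (LINT t|unit_interval. (cmod (f t - ?p t))^2)
     = complex_of_real (LINT t|unit_interval. (cmod (f t))^2)
       - (\<Sum>l\<in>F. cnj (c l) * fourier_coeff f l) - cnj (\<Sum>l\<in>F. cnj (c l) * fourier_coeff f l) + (\<Sum>l\<in>F. cnj (c l) * c l)" .
  also have "\<dots> = complex_of_real ((LINT t|unit_interval. (cmod (f t))^2) - (\<Sum>l\<in>F. (cmod (fourier_coeff f l))^2)
      + (\<Sum>l\<in>F. (cmod (fourier_coeff f l - c l))^2))"
    unfolding of_real_add of_real_diff of_real_sum complex_norm_square
    by (simp add: algebra_simps sum.distrib sum_subtractf)
  finally show ?thesis by (simp only: of_real_eq_iff)
qed

lemma trig_poly_add:
  assumes "finite F" "finite G"
  shows "trig_poly F c t + z * trig_poly G d t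
    = trig_poly (F \<union> G) (\<lambda>l. (if l \<in> F then c l else 0) + z * (if l \<in> G then d l else 0)) t"
proof -
  have "trig_poly F c t = trig_poly (F \<union> G) (\<lambda>l. if l \<in> F then c l else 0) t"
    "trig_poly G d t = trig_poly (F \<union> G) (\<lambda>l. if l \<in> G then d l else 0) t"
    unfolding trig_poly_def using assms by (auto intro!: sum.mono_neutral_cong_left)
  then show ?thesis
    by (simp only:) (simp add: trig_poly_def sum.distrib sum_distrib_left distrib_right mult.assoc)
qed

text \<open>The restrictions of the polynomials of the Stone-Weierstrass theorem to the unit circle are trigonometric polynomials.\<close>

lemma real_polynomial_function_on_circle:
  assumes "real_polynomial_function p"
  shows "\<exists>F c. finite F \<and> (\<forall>t. complex_of_real (p (cis (2 * pi * t))) = trig_poly F c t)"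
  using assms
proof (induction p rule: real_polynomial_function.induct)
  case (linear f)
  interpret bounded_linear f by fact
  define A where "A = complex_of_real (f 1)"
  define B where "B = complex_of_real (f \<i>)"
  have "complex_of_real (f (cis (2 * pi * t))) = trig_poly {1, -1} (\<lambda>l. if l = 1 then (A - \<i> * B) / 2 else (A + \<i> * B) / 2) t" for t
  proof -
    have "cis (2 * pi * t) = cos (2 * pi * t) *\<^sub>R 1 + sin (2 * pi * t) *\<^sub>R \<i>"
      by (simp add: complex_eq_iff)
    then have "f (cis (2 * pi * t)) = cos (2 * pi * t) * f 1 + sin (2 * pi * t) * f \<i>"
      by (simp add: add scaleR)
    moreover have "trig_poly {1, -1} (\<lambda>l. if l = 1 then (A - \<i> * B) / 2 else (A + \<i> * B) / 2) t
       = (A - \<i> * B) / 2 * cis (2 * pi * t) + (A + \<i> * B) / 2 * cis (- (2 * pi * t))"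
      by (simp add: trig_poly_def)
    moreover have "\<dots> = of_real (cos (2 * pi * t)) * A + of_real (sin (2 * pi * t)) * B"
      by (simp add: A_def B_def complex_eq_iff field_simps)
    ultimately show ?thesis by (simp add: A_def B_def)
  qed
  then show ?case by (intro exI[of _ "{1, -1}"]) auto
next
  case (const r)
  show ?case by (intro exI[of _ "{0}"] exI[of _ "\<lambda>_. of_real r"]) (simp add: trig_poly_def)
next
  case (add f g)
  then obtain F c G d where 1: "finite F" "\<And>t. complex_of_real (f (cis (2 * pi * t))) = trig_poly F c t"
    "finite G" "\<And>t. complex_of_real (g (cis (2 * pi * t))) = trig_poly G d t" by blast
  have "complex_of_real (f (cis (2 * pi * t)) + g (cis (2 * pi * t)))
      = trig_poly (F \<union> G) (\<lambda>l. (if l \<in> F then c l else 0) + 1 * (if l \<in> G then d l else 0)) t" for t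
    unfolding trig_poly_add[OF 1(1,3), symmetric] of_real_add 1(2,4) by simp
  then show ?case using 1 by (intro exI[of _ "F \<union> G"]) auto
next
  case (mult f g)
  then obtain F c G d where 1: "finite F" "\<And>t. complex_of_real (f (cis (2 * pi * t))) = trig_poly F c t"
    "finite G" "\<And>t. complex_of_real (g (cis (2 * pi * t))) = trig_poly G d t" by blast
  define S where "S = (\<lambda>(k, l). k + l) ` (F \<times> G)"
  have S: "finite S" using 1 by (simp add: S_def)
  have "complex_of_real (f (cis (2 * pi * t)) * g (cis (2 * pi * t)))
     = trig_poly S (\<lambda>m. \<Sum>(k, l)\<in>{x \<in> F \<times> G. (case x of (k, l) \<Rightarrow> k + l) = m}. c k * d l) t" for t
  proof -
    have "complex_of_real (f (cis (2 * pi * t)) * g (cis (2 * pi * t)))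
      = (\<Sum>(k, l)\<in>F \<times> G. c k * d l * cis (2 * pi * of_int (k + l) * t))"
      unfolding of_real_mult 1 trig_poly_def sum_product sum.cartesian_product
      by (intro sum.cong) (auto simp: cis_mult algebra_simps)
    also have "\<dots> = (\<Sum>m\<in>S. \<Sum>x\<in>{x \<in> F \<times> G. (case x of (k, l) \<Rightarrow> k + l) = m}. case x of (k, l) \<Rightarrow> c k * d l * cis (2 * pi * of_int (k + l) * t))"
      unfolding S_def using 1 by (intro sum.image_gen) auto
    also have "\<dots> = trig_poly S (\<lambda>m. \<Sum>(k, l)\<in>{x \<in> F \<times> G. (case x of (k, l) \<Rightarrow> k + l) = m}. c k * d l) t"
      unfolding trig_poly_def sum_distrib_right by (intro sum.cong) auto
    finally show ?thesis .
  qed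
  then show ?case using S by (intro exI[of _ S]) auto
qed

lemma polynomial_function_on_circle:
  fixes p :: "complex \<Rightarrow> complex"
  assumes "polynomial_function p"
  shows "\<exists>F c. finite F \<and> (\<forall>t. p (cis (2 * pi * t)) = trig_poly F c t)"
proof -
  have "real_polynomial_function (Re \<circ> p)" "real_polynomial_function (Im \<circ> p)"
    using assms bounded_linear_Re bounded_linear_Im by (auto simp: polynomial_function_def)
  then obtain F c G d where 1: "finite F" "\<And>t. complex_of_real (Re (p (cis (2 * pi * t)))) = trig_poly F c t"
    "finite G" "\<And>t. complex_of_real (Im (p (cis (2 * pi * t)))) = trig_poly G d t"
    using real_polynomial_function_on_circle[of "Re \<circ> p"] real_polynomial_function_on_circle[of "Im \<circ> p"] by auto
  have "p (cis (2 * pi * t)) = trig_poly (F \<union> G) (\<lambda>l. (if l \<in> F then c l else 0) + \<i> * (if l \<in> G then d l else 0)) t" for t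
    unfolding trig_poly_add[OF 1(1,3), symmetric] 1(2,4)[symmetric] by (rule complex_eq)
  then show ?thesis using 1 by (intro exI[of _ "F \<union> G"]) auto
qed

text \<open>Since \<open>u\<close> vanishes near both ends of the interval, it becomes a continuous function \<open>G\<close> on the circle although the argument jumps
at \<open>1\<close>.\<close>

lemma continuous_approx_trig_poly:
  fixes u :: "real \<Rightarrow> complex"
  assumes u: "continuous_on UNIV u" and d: "0 < d" and u0: "\<And>t. t \<le> d \<or> t \<ge> 1 - d \<Longrightarrow> u t = 0" and e: "e > 0"
  shows "\<exists>F c. finite F \<and> (\<forall>t\<in>{0<..<1}. norm (u t - trig_poly F c t) < e)"
proof -
  define G where "G = (\<lambda>z. u (Arg2pi z / (2 * pi)))"
  have Arg: "Arg2pi (cis (2 * pi * t)) = 2 * pi * t" if "t \<in> {0<..<1}" for t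
    using that by (intro Arg2pi_unique[of 1]) (auto simp: cis_conv_exp)
  have "isCont G z" if z: "z \<in> sphere 0 1" for z
  proof (cases "z \<in> \<real>\<^sub>\<ge>\<^sub>0")
    case False
    have cu: "continuous (at x) u" for x using u by (simp add: continuous_on_eq_continuous_at)
    have "continuous (at z) (u \<circ> (\<lambda>z. Arg2pi z / (2 * pi)))"
      by (intro continuous_at_compose continuous_divide continuous_at_Arg2pi[OF False] continuous_const cu) auto
    then show ?thesis by (simp add: G_def o_def)
  next
    case True
    then have z1: "z = 1" using z by (auto simp: complex_nonneg_Reals_iff norm_complex_def complex_eq_iff cmod_def)
    define S where "S = {w. Re w > cos (2 * pi * d) * norm w}"
    have "open S" unfolding S_def by (intro open_Collect_less continuous_intros)
    show ?thesis
    proof (cases "d < 1/2")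
      case False
      then have "u t = 0" for t using u0[of t] by (cases "t \<le> 1/2") auto
      then show ?thesis by (simp add: G_def)
    next
      case dh: True
      have "cos (2 * pi * d) < cos 0"
        using d dh by (intro cos_monotone_0_pi) (auto simp: field_simps)
      then have "z \<in> S" by (simp add: S_def z1)
      moreover have "G w = 0" if "w \<in> S" for w
      proof -
        have "norm w > 0" using that by (auto simp: S_def)
        have "cos (2 * pi * d) * norm w < norm w * cos (Arg2pi w)"
          using that by (simp add: S_def cos_Arg2pi)
        then have c: "cos (2 * pi * d) < cos (Arg2pi w)" using \<open>norm w > 0\<close> by (simp add: mult.commute)
        have A: "0 \<le> Arg2pi w" "Arg2pi w < 2 * pi" using Arg2pi[of w] by auto
        have "Arg2pi w \<le> 2 * pi * d \<or> Arg2pi w \<ge> 2 * pi * (1 - d)"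
        proof (rule ccontr)
          assume neg: "\<not> ?thesis"
          show False
          proof (cases "Arg2pi w \<le> pi")
            case True
            then have "cos (Arg2pi w) < cos (2 * pi * d)"
              using neg d by (intro cos_monotone_0_pi) auto
            then show False using c by simp
          next
            case False
            have "cos (2 * pi - Arg2pi w) < cos (2 * pi * d)"
              using neg d False by (intro cos_monotone_0_pi) (auto simp: algebra_simps)
            then show False using c by (simp add: cos_diff)
          qed
        qed
        then have "Arg2pi w / (2 * pi) \<le> d \<or> Arg2pi w / (2 * pi) \<ge> 1 - d"
          by (auto simp: field_simps)
        then show ?thesis unfolding G_def by (rule u0)
      qed
      ultimately have "eventually (\<lambda>w. G w = 0) (nhds z)"
        using \<open>open S\<close> eventually_nhds by blast
      then have "isCont G z \<longleftrightarrow> isCont (\<lambda>_. 0 :: complex) z" by (rule isCont_cong)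
      then show ?thesis by simp
    qed
  qed
  then have "continuous_on (sphere 0 1) G" by (intro continuous_at_imp_continuous_on) auto
  then obtain p where p: "polynomial_function p" "\<And>z. z \<in> sphere 0 1 \<Longrightarrow> norm (G z - p z) < e"
    using Stone_Weierstrass_polynomial_function[of "sphere 0 1" G e] e by auto
  obtain F c where F: "finite F" "\<And>t. p (cis (2 * pi * t)) = trig_poly F c t"
    using polynomial_function_on_circle[OF p(1)] by blast
  have "norm (u t - trig_poly F c t) < e" if "t \<in> {0<..<1}" for t
    using p(2)[of "cis (2 * pi * t)"] Arg[OF that] unfolding F(2) by (simp add: G_def)
  then show ?thesis using F(1) by blast
qed

text \<open>The radial retraction onto the disc of radius \<open>K\<close>.\<close>

definition clamp_norm :: "real \<Rightarrow> complex \<Rightarrow> complex" where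
  "clamp_norm K z = z / of_real (max 1 (norm z / K))"

lemma clamp_norm_continuous: "K > 0 \<Longrightarrow> continuous_on UNIV (clamp_norm K)"
  unfolding clamp_norm_def[abs_def] by (intro continuous_intros) auto

lemma norm_clamp_norm:
  assumes "K > 0"
  shows "norm (clamp_norm K z) \<le> K" "norm (clamp_norm K z) \<le> norm z" "norm z \<le> K \<Longrightarrow> clamp_norm K z = z"
proof -
  have "norm z \<le> K * max 1 (norm z / K)" using assms by (auto simp: max_def field_simps)
  then show "norm (clamp_norm K z) \<le> K" by (simp add: clamp_norm_def norm_divide divide_le_eq)
  have "norm z * 1 \<le> norm z * max 1 (norm z / K)" by (intro mult_left_mono) auto
  then show "norm (clamp_norm K z) \<le> norm z" by (simp add: clamp_norm_def norm_divide divide_le_eq)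
  show "norm z \<le> K \<Longrightarrow> clamp_norm K z = z" using assms by (simp add: clamp_norm_def max_def)
qed

definition cutoff :: "nat \<Rightarrow> real \<Rightarrow> real" where
  "cutoff n t = max 0 (min 1 (real n * min t (1 - t) - 1))"

lemma square_integrable_clamp_approx:
  assumes f: "square_integrable f"
  shows "(\<lambda>n. LINT t|unit_interval. (cmod (f t - clamp_norm (real (Suc n)) (f t)))^2) \<longlonglongrightarrow> 0"
proof -
  let ?D = "\<lambda>n t. (cmod (f t - clamp_norm (real (Suc n)) (f t)))^2"
  have m: "f \<in> borel_measurable unit_interval" using f by (simp add: square_integrable_def)
  have mc: "(\<lambda>t. clamp_norm (real (Suc n)) (f t)) \<in> borel_measurable unit_interval" for n
    by (rule measurable_compose[OF m]) (intro borel_measurable_continuous_onI clamp_norm_continuous, simp)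
  have "(\<lambda>n. LINT t|unit_interval. ?D n t) \<longlonglongrightarrow> (LINT t|unit_interval. 0)"
  proof (rule integral_dominated_convergence[where w = "\<lambda>t. 4 * (cmod (f t))^2"])
    show "(\<lambda>t. ?D n t) \<in> borel_measurable unit_interval" for n
      using m mc by measurable
    show "integrable unit_interval (\<lambda>t. 4 * (cmod (f t))^2)" using f by (auto simp: square_integrable_def)
    show "AE t in unit_interval. (\<lambda>n. ?D n t) \<longlonglongrightarrow> 0"
    proof (rule AE_I2)
      fix t
      obtain n0 where "cmod (f t) \<le> real n0" using real_arch_simple by blast
      then have "\<forall>n\<ge>n0. ?D n t = 0"
        by (auto simp: norm_clamp_norm(3))
      then show "(\<lambda>n. ?D n t) \<longlonglongrightarrow> 0"
        by (intro tendsto_eventually) (auto simp: eventually_sequentially)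
    qed
    show "AE t in unit_interval. norm (?D n t) \<le> 4 * (cmod (f t))^2" for n
    proof (rule AE_I2)
      fix t
      have "cmod (f t - clamp_norm (real (Suc n)) (f t)) \<le> cmod (f t) + cmod (clamp_norm (real (Suc n)) (f t))"
        by (rule norm_triangle_ineq4)
      also have "\<dots> \<le> 2 * cmod (f t)" using norm_clamp_norm(2)[of "real (Suc n)" "f t"] by simp
      finally have "?D n t \<le> (2 * cmod (f t))^2" by (intro power_mono) auto
      then show "norm (?D n t) \<le> 4 * (cmod (f t))^2"
        by (simp add: power_mult_distrib)
    qed
  qed auto
  then show ?thesis by simp
qed

text \<open>The function is first truncated in size; the truncation is the almost everywhere limit of bounded continuous functions, which are
cut off near the ends of the interval. Both limits are in \<open>L2\<close> by dominated convergence.\<close>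

lemma trig_poly_dense:
  assumes f: "f \<in> borel_measurable lebesgue" "square_integrable f" and e: "e > 0"
  shows "\<exists>F c. finite F \<and> (LINT t|unit_interval. (cmod (f t - trig_poly F c t))^2) < e"
proof -
  have m: "f \<in> borel_measurable unit_interval" using f by (simp add: square_integrable_def)
  obtain K0 where K0: "(LINT t|unit_interval. (cmod (f t - clamp_norm (real (Suc K0)) (f t)))^2) < e / 8"
  proof -
    have "\<forall>\<^sub>F n in sequentially. (LINT t|unit_interval. (cmod (f t - clamp_norm (real (Suc n)) (f t)))^2) < e / 8"
      using square_integrable_clamp_approx[OF f(2)] e by (intro order_tendstoD(2)[where a = "e/8"]) auto
    then show ?thesis using that by (auto simp: eventually_sequentially)
  qed
  define K where "K = real (Suc K0)"
  have K: "K > 0" by (simp add: K_def)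
  have cc: "continuous_on UNIV (clamp_norm K)" by (rule clamp_norm_continuous[OF K])
  let ?k = "\<lambda>t. clamp_norm K (f t)"
  obtain Z g where Z: "negligible Z" and g: "\<And>n. continuous_on UNIV (g n)"
    and lim: "\<And>x. x \<notin> Z \<Longrightarrow> (\<lambda>n. g n x) \<longlonglongrightarrow> f x"
    using lebesgue_measurable_imp_measurable_on[OF f(1), of UNIV] unfolding measurable_on_def by auto
  define u where "u = (\<lambda>n t. of_real (cutoff n t) * clamp_norm K (g n t))"
  let ?e = "\<lambda>n t. (cmod (?k t - u n t))^2"
  have uc: "continuous_on UNIV (u n)" for n
    unfolding u_def cutoff_def
    by (intro continuous_intros continuous_on_compose2[OF cc g]) auto
  have cut: "0 \<le> cutoff n t" "cutoff n t \<le> 1" for n t by (auto simp: cutoff_def)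
  have ub: "norm (u n t) \<le> K" for n t
  proof -
    have "norm (u n t) \<le> 1 * K"
      unfolding u_def norm_mult using cut[of n t] norm_clamp_norm(1)[OF K] K by (intro mult_mono) auto
    then show ?thesis by simp
  qed
  have mk: "?k \<in> borel_measurable unit_interval"
    by (rule measurable_compose[OF m]) (rule borel_measurable_continuous_onI[OF cc])
  have "(\<lambda>n. LINT t|unit_interval. ?e n t) \<longlonglongrightarrow> (LINT t|unit_interval. 0)"
  proof (rule integral_dominated_convergence[where w = "\<lambda>t. (2 * K)^2"])
    show "(\<lambda>t. ?e n t) \<in> borel_measurable unit_interval" for n
      using mk continuous_measurable_unit_interval[OF uc[of n]] by measurable
    show "integrable unit_interval (\<lambda>t. (2 * K)^2)"
      by (rule finite_measure.integrable_const[OF finite_measure_unit_interval])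
    show "AE t in unit_interval. norm (?e n t) \<le> (2 * K)^2" for n
    proof (rule AE_I2)
      fix t
      have "cmod (?k t - u n t) \<le> cmod (?k t) + cmod (u n t)" by (rule norm_triangle_ineq4)
      also have "\<dots> \<le> 2 * K" using norm_clamp_norm(1)[OF K, of "f t"] ub[of n t] by simp
      finally have "?e n t \<le> (2 * K)^2" by (intro power_mono) auto
      then show "norm (?e n t) \<le> (2 * K)^2" by simp
    qed
    have "AE t in lebesgue. t \<notin> Z"
      using Z by (intro AE_not_in) (simp add: negligible_iff_null_sets)
    then have "AE t in lebesgue. t \<in> {0<..<1} \<longrightarrow> (\<lambda>n. ?e n t) \<longlonglongrightarrow> 0"
    proof eventually_elim
      case (elim t)
      show ?case
      proof
        assume t: "t \<in> {0<..<1}"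
        have "(\<lambda>n. clamp_norm K (g n t)) \<longlonglongrightarrow> clamp_norm K (f t)"
          using lim[OF elim] cc by (intro isCont_tendsto_compose[of _ "clamp_norm K"]) (auto simp: continuous_on_eq_continuous_at)
        moreover have "(\<lambda>n. cutoff n t) \<longlonglongrightarrow> 1"
        proof -
          obtain n0 where n0: "2 / min t (1 - t) \<le> real n0" using real_arch_simple by blast
          have "cutoff n t = 1" if "n \<ge> n0" for n
          proof -
            have "2 / min t (1 - t) \<le> real n" using n0 that by linarith
            then have "2 \<le> real n * min t (1 - t)" using t by (simp add: divide_le_eq split: if_splits)
            then show ?thesis by (simp add: cutoff_def)
          qed
          then show ?thesis by (intro tendsto_eventually) (auto simp: eventually_sequentially)
        qed
        ultimately have "(\<lambda>n. ?e n t) \<longlonglongrightarrow> (cmod (?k t - of_real 1 * clamp_norm K (f t)))^2"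
          unfolding u_def by (intro tendsto_intros)
        then show "(\<lambda>n. ?e n t) \<longlonglongrightarrow> 0" by simp
      qed
    qed
    then show "AE t in unit_interval. (\<lambda>n. ?e n t) \<longlonglongrightarrow> 0"
      by (subst AE_restrict_space_iff) auto
  qed auto
  then have "(\<lambda>n. LINT t|unit_interval. ?e n t) \<longlonglongrightarrow> 0" by simp
  then have "\<forall>\<^sub>F n in sequentially. (LINT t|unit_interval. ?e n t) < e / 16"
    using e by (intro order_tendstoD(2)[where a = "e/16"]) auto
  then obtain n where n: "n > 0" "(LINT t|unit_interval. ?e n t) < e / 16"
    by (metis (mono_tags, lifting) eventually_sequentially le_add1 zero_less_Suc le_SucI add_Suc_right)
  have u0: "u n t = 0" if "t \<le> 1 / real n \<or> t \<ge> 1 - 1 / real n" for t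
  proof -
    have "min t (1 - t) \<le> 1 / real n" using that by auto
    then have "real n * min t (1 - t) \<le> real n * (1 / real n)" by (intro mult_left_mono) auto
    then have "real n * min t (1 - t) \<le> 1" using n(1) by simp
    then show ?thesis by (simp add: u_def cutoff_def)
  qed
  define s where "s = sqrt (e / 16)"
  have s: "s > 0" "s^2 = e / 16" using e by (auto simp: s_def)
  have n0: "1 / real n > 0" using n(1) by simp
  have "\<exists>F c. finite F \<and> (\<forall>t\<in>{0<..<1}. norm (u n t - trig_poly F c t) < s)"
    by (rule continuous_approx_trig_poly[OF uc n0 _ s(1)]) (rule u0)
  then obtain F c where F: "finite F" and Fs: "\<forall>t\<in>{0<..<1}. norm (u n t - trig_poly F c t) < s" by (elim exE conjE)
  have sk: "square_integrable ?k" by (rule square_integrable_bounded[OF mk norm_clamp_norm(1)[OF K]])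
  have su: "square_integrable (u n)" by (rule square_integrable_continuous_bounded[OF uc ub])
  have sp: "square_integrable (trig_poly F c)" by (rule square_integrable_trig_poly[OF F])
  have diff: "square_integrable (\<lambda>t. a t - b t)" if "square_integrable a" "square_integrable b" for a b
    using square_integrable_add[OF that(1) square_integrable_cmult[OF that(2), of "-1"]] by simp
  have i1: "integrable unit_interval (\<lambda>t. (cmod (f t - ?k t))^2)" using diff[OF f(2) sk] by (simp add: square_integrable_def)
  have i2: "integrable unit_interval (\<lambda>t. ?e n t)" using diff[OF sk su] by (simp add: square_integrable_def)
  have i3: "integrable unit_interval (\<lambda>t. (cmod (f t - trig_poly F c t))^2)" using diff[OF f(2) sp] by (simp add: square_integrable_def)
  have i4: "integrable unit_interval (\<lambda>t. 4 * s^2)"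
    by (rule finite_measure.integrable_const[OF finite_measure_unit_interval])
  have "(LINT t|unit_interval. (cmod (f t - trig_poly F c t))^2)
    \<le> (LINT t|unit_interval. 2 * (cmod (f t - ?k t))^2 + 4 * ?e n t + 4 * s^2)"
  proof (rule integral_mono_AE)
    show "AE t in unit_interval. (cmod (f t - trig_poly F c t))^2 \<le> 2 * (cmod (f t - ?k t))^2 + 4 * ?e n t + 4 * s^2"
    proof (rule AE_I2)
      fix t assume "t \<in> space unit_interval"
      then have t: "t \<in> {0<..<1}" by (simp add: space_restrict_space)
      have "(cmod (f t - trig_poly F c t))^2 \<le> 2 * (cmod (f t - ?k t))^2 + 2 * (cmod (?k t - trig_poly F c t))^2"
        using norm_add_squared_le[of "f t - ?k t" "?k t - trig_poly F c t"] by simp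
      also have "(cmod (?k t - trig_poly F c t))^2 \<le> 2 * ?e n t + 2 * (cmod (u n t - trig_poly F c t))^2"
        using norm_add_squared_le[of "?k t - u n t" "u n t - trig_poly F c t"] by simp
      also have "(cmod (u n t - trig_poly F c t))^2 \<le> s^2"
        by (intro power_mono less_imp_le[OF bspec[OF Fs t]]) auto
      finally show "(cmod (f t - trig_poly F c t))^2 \<le> 2 * (cmod (f t - ?k t))^2 + 4 * ?e n t + 4 * s^2"
        by simp
    qed
  qed (use i1 i2 i3 i4 in auto)
  also have "\<dots> = 2 * (LINT t|unit_interval. (cmod (f t - ?k t))^2) + 4 * (LINT t|unit_interval. ?e n t) + (LINT t|unit_interval. 4 * s^2)"
    using i1 i2 i4 by simp
  also have "(LINT t|unit_interval. 4 * s^2) = 4 * s^2"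
    by (simp add: measure_restrict_space)
  also have "2 * (LINT t|unit_interval. (cmod (f t - ?k t))^2) + 4 * (LINT t|unit_interval. ?e n t) + 4 * s^2 < e"
    using K0 n(2) s(2) e unfolding K_def[symmetric] by linarith
  finally show ?thesis using F by blast
qed

text \<open>Bessel's inequality gives one bound, the density of the trigonometric polynomials the other.\<close>

theorem parseval:
  assumes f: "f \<in> borel_measurable lebesgue" "square_integrable f"
  shows "((\<lambda>l. (cmod (fourier_coeff f l))^2) has_sum (LINT t|unit_interval. (cmod (f t))^2)) UNIV"
proof -
  let ?I = "LINT t|unit_interval. (cmod (f t))^2"
  have bessel: "(\<Sum>l\<in>F. (cmod (fourier_coeff f l))^2) \<le> ?I" if "finite F" for F
  proof -
    have "0 \<le> (LINT t|unit_interval. (cmod (f t - trig_poly F (fourier_coeff f) t))^2)"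
      by (intro integral_nonneg_AE) auto
    then show ?thesis using best_approximation_identity[OF that f(2), of "fourier_coeff f"] by simp
  qed
  have s: "square_summable (fourier_coeff f)"
    by (rule nonneg_bdd_above_summable_on) (use bessel in \<open>auto intro!: bdd_aboveI2\<close>)
  have "infsum (\<lambda>l. (cmod (fourier_coeff f l))^2) UNIV = ?I"
  proof (rule antisym)
    show "infsum (\<lambda>l. (cmod (fourier_coeff f l))^2) UNIV \<le> ?I"
      by (rule infsum_le_finite_sums[OF s]) (use bessel in auto)
    show "?I \<le> infsum (\<lambda>l. (cmod (fourier_coeff f l))^2) UNIV"
    proof (rule field_le_epsilon)
      fix e :: real assume "e > 0"
      then obtain F c where F: "finite F" "(LINT t|unit_interval. (cmod (f t - trig_poly F c t))^2) < e"
        using trig_poly_dense[OF f] by blast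
      have "0 \<le> (\<Sum>l\<in>F. (cmod (fourier_coeff f l - c l))^2)" by (intro sum_nonneg) auto
      then have "?I \<le> (\<Sum>l\<in>F. (cmod (fourier_coeff f l))^2) + e"
        using best_approximation_identity[OF F(1) f(2), of c] F(2) by simp
      also have "(\<Sum>l\<in>F. (cmod (fourier_coeff f l))^2) \<le> infsum (\<lambda>l. (cmod (fourier_coeff f l))^2) UNIV"
        by (rule finite_sum_le_infsum[OF s F(1)]) auto
      finally show "?I \<le> infsum (\<lambda>l. (cmod (fourier_coeff f l))^2) UNIV + e" by simp
    qed
  qed
  then show ?thesis using s by (metis has_sum_infsum)
qed

lemma fourier_coeff_linear:
  assumes "square_integrable f" "square_integrable g"
  shows "fourier_coeff (\<lambda>t. f t + c * g t) l = fourier_coeff f l + c * fourier_coeff g l"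
proof -
  have "fourier_coeff (\<lambda>t. f t + c * g t) l = (LINT t|unit_interval. f t * cnj (character l t) + c * (g t * cnj (character l t)))"
    by (simp add: fourier_coeff_def algebra_simps)
  also have "\<dots> = fourier_coeff f l + c * fourier_coeff g l"
    unfolding fourier_coeff_def
    by (subst Bochner_Integration.integral_add)
       (auto intro!: integrable_mult_right square_integrable_mult square_integrable_character assms)
  finally show ?thesis .
qed

lemma complex_polarization:
  "x * cnj y = (of_real ((cmod (x + 1 * y))^2) - of_real ((cmod (x + (-1) * y))^2)
     + \<i> * of_real ((cmod (x + \<i> * y))^2) - \<i> * of_real ((cmod (x + (- \<i>) * y))^2)) / 4"
  unfolding complex_norm_square by (simp add: algebra_simps)

text \<open>Polarization of Parseval's identity.\<close>

theorem parseval_inner: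
  assumes f: "f \<in> borel_measurable lebesgue" "square_integrable f"
    and g: "g \<in> borel_measurable lebesgue" "square_integrable g"
  shows "((\<lambda>l. fourier_coeff f l * cnj (fourier_coeff g l)) has_sum (LINT t|unit_interval. f t * cnj (g t))) UNIV"
proof -
  let ?h = "\<lambda>c t. f t + c * g t"
  have sq: "square_integrable (?h c)" for c by (intro square_integrable_add square_integrable_cmult f g)
  have me: "?h c \<in> borel_measurable lebesgue" for c using f g by measurable
  have P: "((\<lambda>l. complex_of_real ((cmod (fourier_coeff f l + c * fourier_coeff g l))^2)) has_sum
     (LINT t|unit_interval. complex_of_real ((cmod (f t + c * g t))^2))) UNIV" for c
    using has_sum_of_real[OF parseval[OF me sq, of c], where 'a = complex]
    unfolding fourier_coeff_linear[OF f(2) g(2)] integral_complex_of_real by simp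
  have I: "integrable unit_interval (\<lambda>t. complex_of_real ((cmod (f t + c * g t))^2))" for c
    using sq[of c] by (intro integrable_of_real) (simp add: square_integrable_def)
  let ?J = "\<lambda>c. LINT t|unit_interval. complex_of_real ((cmod (f t + c * g t))^2)"
  let ?A = "\<lambda>c l. complex_of_real ((cmod (fourier_coeff f l + c * fourier_coeff g l))^2)"
  have "((\<lambda>l. (?A 1 l + - ?A (-1) l + \<i> * ?A \<i> l + - (\<i> * ?A (- \<i>) l)) * (1/4)) has_sum
     ((?J 1 + - ?J (-1) + \<i> * ?J \<i> + - (\<i> * ?J (- \<i>))) * (1/4))) UNIV"
    by (intro has_sum_cmult_left has_sum_cmult_right has_sum_add has_sum_uminusI P)
  moreover have "(?A 1 l + - ?A (-1) l + \<i> * ?A \<i> l + - (\<i> * ?A (- \<i>) l)) * (1/4) = fourier_coeff f l * cnj (fourier_coeff g l)" for l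
    by (subst complex_polarization) simp
  moreover have "(?J 1 + - ?J (-1) + \<i> * ?J \<i> + - (\<i> * ?J (- \<i>))) * (1/4) = (LINT t|unit_interval. f t * cnj (g t))"
    unfolding complex_polarization[of "f _"] using I[of 1] I[of "-1"] I[of \<i>] I[of "- \<i>"] by simp
  ultimately show ?thesis by simp
qed

section \<open>Periodizations and their Fourier coefficients\<close>

lemma infsum_int_eq_suminf:
  fixes F :: "int \<Rightarrow> 'a::{comm_monoid_add, t2_space}"
  assumes "F summable_on UNIV"
  shows "(\<lambda>n. F (int_decode n)) sums infsum F UNIV"
proof -
  have "((\<lambda>n. F (int_decode n)) has_sum infsum F UNIV) UNIV"
    using has_sum_reindex_bij_betw[OF bij_int_decode, of F] assms by simp
  then show ?thesis by (rule has_sum_imp_sums)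
qed

lemma gaussian_translate_le:
  fixes t c :: real and k :: int
  assumes "c > 0" "0 \<le> t" "t \<le> 1"
  shows "gauss c (t - of_int k) \<le> exp c * gauss (c/2) (of_int k)"
proof -
  have "(t - of_int k)^2 - (of_int k)^2 / 2 + 1 = (of_int k - 2 * t)^2 / 2 + (1 - t^2)"
    by (simp add: power2_eq_square field_simps)
  moreover have "t^2 \<le> 1" using assms by (simp add: abs_square_le_1)
  ultimately have "(of_int k)^2 / 2 - 1 \<le> (t - of_int k)^2"
    by (smt (verit) zero_le_power2 divide_nonneg_pos)
  then have "c * ((of_int k)^2 / 2 - 1) \<le> c * (t - of_int k)^2" using assms by (intro mult_left_mono) auto
  then show ?thesis by (simp add: algebra_simps flip: exp_add)
qed

lemma integral_unit_interval_lborel: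
  fixes f :: "real \<Rightarrow> complex"
  assumes "f \<in> borel_measurable borel"
  shows "(LINT t|unit_interval. f t) = (LINT t|lborel. indicator {0..<1} t *\<^sub>R f t)"
proof -
  have m: "(\<lambda>t. indicator {0<..<1} t *\<^sub>R f t) \<in> borel_measurable lborel"
    using assms by measurable
  have "(LINT t|unit_interval. f t) = (LINT t|lborel. indicator {0<..<1} t *\<^sub>R f t)"
    using integral_completion[OF m] by (simp add: integral_restrict_space)
  also have "\<dots> = (LINT t|lborel. indicator {0..<1} t *\<^sub>R f t)"
  proof (rule integral_cong_AE)
    show "AE t in lborel. indicator {0<..<1} t *\<^sub>R f t = indicator {0..<1} t *\<^sub>R f t"
      using AE_lborel_singleton[of "0::real"] by eventually_elim (auto simp: indicator_def)
  qed (use assms in measurable)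
  finally show ?thesis .
qed

text \<open>The translates of the half-open unit interval tile the line. The Gaussian bound allows both interchanges of sum and integral.\<close>

lemma integral_unit_interval_periodization:
  fixes \<phi> :: "real \<Rightarrow> complex"
  assumes cont: "continuous_on UNIV \<phi>" and c: "c > 0"
    and bound: "\<And>t. norm (\<phi> t) \<le> C * gauss c t"
  shows "(LINT t|unit_interval. (\<Sum>\<^sub>\<infinity>k::int. \<phi> (t - of_int k))) = (LINT t|lborel. \<phi> t)"
proof -
  have C: "C \<ge> 0" using bound[of 0] by simp (metis norm_ge_zero order_trans)
  have m[measurable]: "\<phi> \<in> borel_measurable borel" by (rule borel_measurable_continuous_onI[OF cont])
  have bC: "norm (\<phi> t) \<le> C" for t
  proof -
    have "norm (\<phi> t) \<le> C * 1" using c C by (intro order_trans[OF bound] mult_left_mono) auto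
    then show ?thesis by simp
  qed
  define w where "w = (\<lambda>k::int. C * (exp c * gauss (c/2) (of_int k)))"
  have w: "w summable_on UNIV" unfolding w_def using c by (intro summable_on_cmult_right summable_on_int_gaussian) auto
  have ws: "summable (\<lambda>n. w (int_decode n))" using infsum_int_eq_suminf[OF w] by (rule sums_summable)
  have le: "norm (\<phi> (t - of_int k)) \<le> w k" if "0 \<le> t" "t \<le> 1" for t and k :: int
    unfolding w_def using gaussian_translate_le[OF c that, of k] C by (intro order_trans[OF bound] mult_left_mono) auto
  let ?g = "\<lambda>n t. \<phi> (t - of_int (int_decode n))"
  let ?A = "\<lambda>k::int. {- of_int k..<1 - of_int k :: real}"
  have g_int: "integrable unit_interval (?g n)" for n
    by (rule integrable_bounded_unit_interval[of _ C])
       (auto intro!: bC continuous_measurable_unit_interval continuous_on_compose2[OF cont] continuous_intros)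
  have g_norm: "(LINT t|unit_interval. norm (?g n t)) \<le> w (int_decode n)" for n
  proof -
    have "(LINT t|unit_interval. norm (?g n t)) \<le> (LINT t|unit_interval. w (int_decode n))"
    proof (rule integral_mono_AE)
      show "AE t in unit_interval. norm (?g n t) \<le> w (int_decode n)"
        by (rule AE_I2) (use le in \<open>auto simp: space_restrict_space\<close>)
    qed (use g_int in \<open>auto intro: finite_measure.integrable_const[OF finite_measure_unit_interval]\<close>)
    also have "\<dots> = w (int_decode n)" by (simp add: measure_restrict_space)
    finally show ?thesis .
  qed
  have shift: "(LINT t|unit_interval. ?g n t) = (LINT t:?A (int_decode n)|lborel. \<phi> t)" for n
  proof -
    let ?k = "of_int (int_decode n) :: real"
    have "(LINT t|unit_interval. ?g n t) = (LINT t|lborel. indicator {0..<1} t *\<^sub>R ?g n t)"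
      by (rule integral_unit_interval_lborel) measurable
    also have "\<dots> = (LINT t|lborel. indicator {0..<1} (?k + 1 * t) *\<^sub>R \<phi> (?k + 1 * t - ?k))"
      by (subst lborel_integral_real_affine[of 1 _ ?k]) auto
    also have "\<dots> = (LINT t:?A (int_decode n)|lborel. \<phi> t)"
      unfolding set_lebesgue_integral_def by (rule Bochner_Integration.integral_cong) (auto simp: indicator_def)
    finally show ?thesis .
  qed
  have tile: "t \<in> ?A k \<longleftrightarrow> k = - \<lfloor>t\<rfloor>" for t and k :: int
    by auto linarith+
  have "integrable lborel \<phi>"
  proof (rule Bochner_Integration.integrable_bound)
    show "integrable lborel (\<lambda>t. C * gauss c t)" by (intro integrable_mult_right integrable_exp_gaussian c)
    show "AE t in lborel. norm (\<phi> t) \<le> norm (C * gauss c t)"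
      by (rule AE_I2) (use bound C in \<open>simp add: abs_mult\<close>)
  qed measurable
  moreover have UN: "(\<Union>n. ?A (int_decode n)) = UNIV"
  proof -
    have "\<exists>n. t \<in> ?A (int_decode n)" for t
      unfolding tile by (metis int_encode_inverse)
    then show ?thesis by blast
  qed
  ultimately have "(LINT t:(\<Union>n. ?A (int_decode n))|lborel. \<phi> t) = (\<Sum>n. LINT t:?A (int_decode n)|lborel. \<phi> t)"
  proof (intro lebesgue_integral_countable_add)
    show "?A (int_decode i) \<inter> ?A (int_decode j) = {}" if "i \<noteq> j" for i j
      using that tile by (metis disjoint_iff int_decode_eq)
  qed (auto simp: set_integrable_def)
  then have tiles: "(LINT t|lborel. \<phi> t) = (\<Sum>n. LINT t|unit_interval. ?g n t)"
    unfolding UN shift by (simp add: set_lebesgue_integral_def)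
  have "(LINT t|unit_interval. (\<Sum>\<^sub>\<infinity>k::int. \<phi> (t - of_int k))) = (LINT t|unit_interval. (\<Sum>n. ?g n t))"
  proof (rule Bochner_Integration.integral_cong[OF refl])
    fix t assume "t \<in> space unit_interval"
    then have t: "0 \<le> t" "t \<le> 1" by (auto simp: space_restrict_space)
    have "(\<lambda>k::int. \<phi> (t - of_int k)) summable_on UNIV"
      by (rule summable_on_abs_bound(2)[OF w]) (use le t in auto)
    then show "(\<Sum>\<^sub>\<infinity>k::int. \<phi> (t - of_int k)) = (\<Sum>n. ?g n t)"
      using sums_unique[OF infsum_int_eq_suminf] by blast
  qed
  also have "\<dots> = (\<Sum>n. LINT t|unit_interval. ?g n t)"
  proof (rule integral_suminf[OF g_int])
    show "AE t in unit_interval. summable (\<lambda>n. norm (?g n t))"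
      by (rule AE_I2) (rule summable_comparison_test[OF _ ws], use le in \<open>auto simp: space_restrict_space\<close>)
    show "summable (\<lambda>n. LINT t|unit_interval. norm (?g n t))"
      by (rule summable_comparison_test[OF _ ws]) (use g_norm in \<open>auto\<close>)
  qed
  finally show ?thesis using tiles by simp
qed

lemma periodization_props:
  fixes g :: "real \<Rightarrow> complex"
  assumes cont: "continuous_on UNIV g" and c: "c > 0"
    and bound: "\<And>t. norm (g t) \<le> C * gauss c t"
  shows "periodization \<nu> g \<in> L2nu \<nu>" "square_integrable (periodization \<nu> g)"
    "periodization \<nu> g \<in> borel_measurable lebesgue"
proof -
  have C: "C \<ge> 0" using bound[of 0] by simp (metis norm_ge_zero order_trans)
  obtain K where K: "K > 0"
    "\<And>x. (\<lambda>n::int. gauss c (x - 1 * of_int n)) summable_on UNIV"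
    "\<And>x. (\<Sum>\<^sub>\<infinity>n::int. gauss c (x - 1 * of_int n)) \<le> K"
    using gaussian_kernel_sums[OF c zero_less_one] by metis
  let ?f = "\<lambda>t (k::int). cis (2 * pi * of_int k * \<nu>) * g (t - of_int k)"
  have w: "(\<lambda>k::int. C * gauss c (t - 1 * of_int k)) summable_on UNIV" for t
    by (intro summable_on_cmult_right K)
  have le: "norm (?f t k) \<le> C * gauss c (t - 1 * of_int k)" for t k
    using bound[of "t - of_int k"] by (simp add: norm_mult)
  have s: "?f t summable_on UNIV" for t by (rule summable_on_abs_bound(2)[OF w le])
  have bd: "norm (periodization \<nu> g t) \<le> C * K" for t
  proof -
    have "norm (periodization \<nu> g t) \<le> (\<Sum>\<^sub>\<infinity>k::int. C * gauss c (t - 1 * of_int k))"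
      unfolding periodization_def by (rule summable_on_abs_bound(3)[OF w le])
    also have "\<dots> \<le> C * K" unfolding infsum_cmult_right'[of C] by (intro mult_left_mono K C)
    finally show ?thesis .
  qed
  have eq: "periodization \<nu> g = (\<lambda>t. \<Sum>n. ?f t (int_decode n))"
    unfolding periodization_def using sums_unique[OF infsum_int_eq_suminf[OF s]] by auto
  have "periodization \<nu> g \<in> borel_measurable lborel"
    unfolding eq
    by (intro borel_measurable_suminf) (auto intro!: borel_measurable_continuous_onI continuous_intros continuous_on_compose2[OF cont])
  then show m: "periodization \<nu> g \<in> borel_measurable lebesgue" by (rule measurable_completion)
  show sq: "square_integrable (periodization \<nu> g)"
    by (rule square_integrable_bounded[OF measurable_unit_interval[OF m] bd])
  have quasi: "periodization \<nu> g (t + of_int m) = cis (2 * pi * of_int m * \<nu>) * periodization \<nu> g t" for t and m :: int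
  proof -
    have bij: "bij_betw (\<lambda>k. k + m) UNIV (UNIV :: int set)"
      by (rule bij_betwI[where g = "\<lambda>k. k - m"]) auto
    have "periodization \<nu> g (t + of_int m) = (\<Sum>\<^sub>\<infinity>k. ?f (t + of_int m) (k + m))"
      unfolding periodization_def by (rule infsum_reindex_bij_betw[OF bij, symmetric])
    also have "\<dots> = (\<Sum>\<^sub>\<infinity>k. cis (2 * pi * of_int m * \<nu>) * ?f t k)"
    proof (rule infsum_cong)
      fix k
      have "cis (2 * pi * of_int (k + m) * \<nu>) = cis (2 * pi * of_int m * \<nu>) * cis (2 * pi * of_int k * \<nu>)"
        unfolding cis_mult by (simp add: algebra_simps)
      moreover have "t + of_int m - of_int (k + m) = t - of_int k" by simp
      ultimately show "?f (t + of_int m) (k + m) = cis (2 * pi * of_int m * \<nu>) * ?f t k"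
        by (simp only: mult.assoc)
    qed
    also have "\<dots> = cis (2 * pi * of_int m * \<nu>) * periodization \<nu> g t"
      unfolding periodization_def by (rule infsum_cmult_right')
    finally show ?thesis .
  qed
  show "periodization \<nu> g \<in> L2nu \<nu>"
    unfolding L2nu_def set_integrable_def
    using m quasi sq by (auto simp: square_integrable_def integrable_restrict_space)
qed

text \<open>The coefficients with respect to \<open>t \<mapsto> cis (2 * pi * (\<nu> + l) * t)\<close>, the characters that have the quasi-periodicity of
\<open>L2nu \<nu>\<close>; in this basis periodized functions have values of a Fourier transform as coefficients.\<close>

definition twisted_coeff :: "real \<Rightarrow> (real \<Rightarrow> complex) \<Rightarrow> int \<Rightarrow> complex" where
  "twisted_coeff \<nu> f = fourier_coeff (\<lambda>t. f t * cis (- 2 * pi * \<nu> * t))"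

lemma L2nu_square_integrable:
  assumes "f \<in> L2nu \<nu>"
  shows "f \<in> borel_measurable lebesgue" "square_integrable f"
proof -
  show m: "f \<in> borel_measurable lebesgue" using assms by (simp add: L2nu_def)
  show "square_integrable f"
    using assms measurable_unit_interval[OF m]
    by (auto simp: L2nu_def square_integrable_def set_integrable_def integrable_restrict_space)
qed

lemma twisted_parseval_inner:
  assumes f: "f \<in> borel_measurable lebesgue" "square_integrable f"
    and g: "g \<in> borel_measurable lebesgue" "square_integrable g"
  shows "((\<lambda>l. twisted_coeff \<nu> f l * cnj (twisted_coeff \<nu> g l)) has_sum inner_L2nu f g) UNIV"
proof -
  let ?e = "\<lambda>t. cis (- 2 * pi * \<nu> * t)"
  have me: "?e \<in> borel_measurable lebesgue"
    by (intro integral_lebesgue_continuous(3) continuous_intros)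
  have "(LINT t|unit_interval. (f t * ?e t) * cnj (g t * ?e t)) = inner_L2nu f g"
    unfolding inner_L2nu_def integral_unit_interval[symmetric]
  proof (rule Bochner_Integration.integral_cong[OF refl])
    fix t
    have "?e t * cnj (?e t) = 1" by (simp add: cis_cnj cis_mult)
    then show "(f t * ?e t) * cnj (g t * ?e t) = f t * cnj (g t)"
      by (metis (no_types, lifting) complex_cnj_mult mult.assoc mult.left_commute mult.right_neutral)
  qed
  moreover have "((\<lambda>l. twisted_coeff \<nu> f l * cnj (twisted_coeff \<nu> g l)) has_sum (LINT t|unit_interval. (f t * ?e t) * cnj (g t * ?e t))) UNIV"
    unfolding twisted_coeff_def
    using f g me by (intro parseval_inner borel_measurable_times square_integrable_cis) auto
  ultimately show ?thesis by simp
qed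

lemma twisted_coeff_periodization:
  fixes g :: "real \<Rightarrow> complex"
  assumes cont: "continuous_on UNIV g" and c: "c > 0"
    and bound: "\<And>t. norm (g t) \<le> C * gauss c t"
  shows "twisted_coeff \<nu> (periodization \<nu> g) l = (LINT t|lborel. g t * cis (- 2 * pi * (\<nu> + of_int l) * t))"
proof -
  let ?\<phi> = "\<lambda>t. g t * cis (- 2 * pi * (\<nu> + of_int l) * t)"
  have "twisted_coeff \<nu> (periodization \<nu> g) l = (LINT t|unit_interval. (\<Sum>\<^sub>\<infinity>k::int. ?\<phi> (t - of_int k)))"
    unfolding twisted_coeff_def fourier_coeff_def
  proof (rule Bochner_Integration.integral_cong[OF refl])
    fix t
    have eq: "cis (2 * pi * of_int k * \<nu>) * g (t - of_int k) * (cis (- 2 * pi * \<nu> * t) * cnj (character l t)) = ?\<phi> (t - of_int k)" for k :: int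
    proof -
      have "2 * pi * of_int k * \<nu> + (- 2 * pi * \<nu> * t + - (2 * pi * of_int l * t))
        = - 2 * pi * (\<nu> + of_int l) * (t - of_int k) + 2 * pi * of_int (- l * k)"
        by (simp add: algebra_simps)
      then have "cis (2 * pi * of_int k * \<nu>) * (cis (- 2 * pi * \<nu> * t) * cnj (character l t))
        = cis (- 2 * pi * (\<nu> + of_int l) * (t - of_int k)) * cis (2 * pi * of_int (- l * k))"
        unfolding cis_cnj cis_mult by simp
      also have "cis (2 * pi * of_int (- l * k)) = 1" by (rule cis_multiple_2pi) simp
      finally show ?thesis by (simp add: mult_ac)
    qed
    have "periodization \<nu> g t * cis (- 2 * pi * \<nu> * t) * cnj (character l t)
      = (\<Sum>\<^sub>\<infinity>k::int. cis (2 * pi * of_int k * \<nu>) * g (t - of_int k) * (cis (- 2 * pi * \<nu> * t) * cnj (character l t)))"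
      unfolding periodization_def mult.assoc[of "infsum _ _"] by (rule infsum_cmult_left'[symmetric])
    also have "\<dots> = (\<Sum>\<^sub>\<infinity>k::int. ?\<phi> (t - of_int k))"
      by (rule infsum_cong) (rule eq)
    finally show "periodization \<nu> g t * cis (- 2 * pi * \<nu> * t) * cnj (character l t) = (\<Sum>\<^sub>\<infinity>k::int. ?\<phi> (t - of_int k))" .
  qed
  also have "\<dots> = (LINT t|lborel. ?\<phi> t)"
    by (rule integral_unit_interval_periodization[OF _ c, of _ C])
       (use bound in \<open>auto intro!: continuous_intros cont simp: norm_mult\<close>)
  finally show ?thesis .
qed

lemma hermite_gaussian_bound:
  obtains C where "\<And>t. norm (hermite c r t) \<le> C * gauss 1 t"
proof -
  have "1 < pi" using pi_gt3 by simp
  then obtain C where C: "C > 0" "\<And>x. \<bar>poly (hermite_poly r) x\<bar> * gauss pi x \<le> C * gauss 1 x"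
    using poly_times_gaussian_le by metis
  have "norm (hermite c r t) \<le> norm (c r) * (C * gauss 1 t)" for t
    unfolding hermite_eq norm_mult norm_of_real abs_mult abs_exp_cancel by (intro mult_left_mono C) simp
  then show ?thesis using that[of "norm (c r) * C"] by (simp add: mult.assoc)
qed

section \<open>The superframe inequality\<close>

lemma norm_L2nu_vec_squared:
  assumes "f \<in> L2nu_vec \<nu> N"
  shows "(norm_L2nu_vec N f)^2 = (\<Sum>i<N. square_sum (twisted_coeff \<nu> (f i)))"
    and "\<And>i. i < N \<Longrightarrow> square_summable (twisted_coeff \<nu> (f i))"
proof -
  have f: "f i \<in> borel_measurable lebesgue" "square_integrable (f i)" if "i < N" for i
    using assms that L2nu_square_integrable by (auto simp: L2nu_vec_def)
  have hs: "((\<lambda>l. (norm (twisted_coeff \<nu> (f i) l))^2) has_sum Re (inner_L2nu (f i) (f i))) UNIV" if "i < N" for i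
  proof -
    have "((\<lambda>l. complex_of_real ((norm (twisted_coeff \<nu> (f i) l))^2)) has_sum inner_L2nu (f i) (f i)) UNIV"
      using twisted_parseval_inner[OF f[OF that] f[OF that], of \<nu>] unfolding complex_norm_square .
    from has_sum_Re[OF this] show ?thesis by simp
  qed
  show "\<And>i. i < N \<Longrightarrow> square_summable (twisted_coeff \<nu> (f i))"
    using hs has_sum_imp_summable by blast
  have "Re (inner_L2nu_vec N f f) = (\<Sum>i<N. square_sum (twisted_coeff \<nu> (f i)))"
    unfolding inner_L2nu_vec_def Re_sum using infsumI[OF hs] by (intro sum.cong) auto
  moreover have "\<dots> \<ge> 0" by (intro sum_nonneg infsum_nonneg) auto
  ultimately show "(norm_L2nu_vec N f)^2 = (\<Sum>i<N. square_sum (twisted_coeff \<nu> (f i)))"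
    by (simp add: norm_L2nu_vec_def)
qed

text \<open>Conjugation in the inner product turns the coefficients of the frame elements into the sampling kernel, and both
frame bounds become statements about \<open>samples\<close>.\<close>

theorem theorem5:
  fixes \<nu> \<beta> :: real and N :: nat and c :: "nat \<Rightarrow> complex"
  assumes "N \<ge> 1"
    and "\<beta> > 0"
    and "\<And>r. norm_L2R (hermite c r) = 1"
    and "\<beta> < 1 / real N"
  shows "gabor_superframe \<nu> N (hermite c) \<beta>"
proof -
  obtain q where q: "\<And>j. degree (q j) = j" "\<And>j. q j \<noteq> 0"
    and ft: "\<And>j \<xi>. (LINT t|lborel. cnj (hermite c j t) * cis (2 * pi * \<xi> * t)) = poly (q j) (of_real \<xi>) * of_real (gauss pi \<xi>)"
    using hermite_fourier_transform[OF assms(3)] by metis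
  interpret gaussian_sampling \<nu> \<beta> N q
    by unfold_locales (use assms q in auto)
  let ?h = "\<lambda>n i. modulation (\<beta> * of_int n) (hermite c i)"
  have hc: "continuous_on UNIV (?h n i)" for n :: int and i
    unfolding modulation_def[abs_def] by (intro continuous_intros hermite_continuous)
  have hb: "\<exists>C. \<forall>t. norm (?h n i t) \<le> C * gauss 1 t" for n :: int and i
    unfolding modulation_def norm_mult norm_cis mult_1 using hermite_gaussian_bound[of c i] by metis
  have coeff: "cnj (twisted_coeff \<nu> (periodization \<nu> (?h n i)) l) = sample_kernel i n l" for n :: int and i l
  proof -
    obtain C where C: "\<And>t. norm (?h n i t) \<le> C * gauss 1 t" using hb by blast
    let ?\<xi> = "\<nu> + of_int l - \<beta> * of_int n"
    have "cnj (twisted_coeff \<nu> (periodization \<nu> (?h n i)) l) = (LINT t|lborel. cnj (?h n i t * cis (- 2 * pi * (\<nu> + of_int l) * t)))"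
      unfolding twisted_coeff_periodization[OF hc zero_less_one C] by (rule Bochner_Integration.integral_cnj[symmetric])
    also have "\<dots> = (LINT t|lborel. cnj (hermite c i t) * cis (2 * pi * ?\<xi> * t))"
    proof (rule Bochner_Integration.integral_cong[OF refl])
      fix t
      have "- (2 * pi * (\<beta> * of_int n) * t) + - (- 2 * pi * (\<nu> + of_int l) * t) = 2 * pi * ?\<xi> * t"
        by (simp add: algebra_simps)
      then have eq: "cnj (cis (2 * pi * (\<beta> * of_int n) * t)) * cnj (cis (- 2 * pi * (\<nu> + of_int l) * t)) = cis (2 * pi * ?\<xi> * t)"
        unfolding cis_cnj cis_mult by simp
      show "cnj (?h n i t * cis (- 2 * pi * (\<nu> + of_int l) * t)) = cnj (hermite c i t) * cis (2 * pi * ?\<xi> * t)"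
        unfolding modulation_def complex_cnj_mult eq[symmetric] by (simp only: mult_ac)
    qed
    finally show ?thesis unfolding ft sample_kernel_def .
  qed
  have gmem: "gabor_system \<nu> \<beta> (hermite c) n i \<in> L2nu \<nu>" for n i
    unfolding gabor_system_def using hb[of n i] periodization_props(1)[OF hc zero_less_one] by blast
  have inner: "inner_L2nu_vec N f (gabor_system \<nu> \<beta> (hermite c) n) = samples (\<lambda>j. twisted_coeff \<nu> (f j)) n"
    if f: "f \<in> L2nu_vec \<nu> N" for f n
    unfolding inner_L2nu_vec_def samples_def
  proof (rule sum.cong[OF refl])
    fix i assume "i \<in> {..<N}"
    then have fi: "f i \<in> borel_measurable lebesgue" "square_integrable (f i)"
      using f L2nu_square_integrable by (auto simp: L2nu_vec_def)
    have "((\<lambda>l. twisted_coeff \<nu> (f i) l * sample_kernel i n l) has_sum inner_L2nu (f i) (gabor_system \<nu> \<beta> (hermite c) n i)) UNIV"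
      using twisted_parseval_inner[OF fi L2nu_square_integrable[OF gmem], of \<nu> n i]
      unfolding gabor_system_def coeff .
    from infsumI[OF this]
    show "inner_L2nu (f i) (gabor_system \<nu> \<beta> (hermite c) n i) = (\<Sum>\<^sub>\<infinity>l. sample_kernel i n l * twisted_coeff \<nu> (f i) l)"
      by (simp add: mult.commute)
  qed
  obtain A where A: "A > 0"
    "\<And>d. (\<And>j. j < N \<Longrightarrow> square_summable (d j)) \<Longrightarrow>
       A * (\<Sum>j<N. square_sum (d j)) \<le> square_sum (samples d)"
    using samples_lower_bound by blast
  obtain B where B: "B > 0"
    "\<And>d. (\<And>j. j < N \<Longrightarrow> square_summable (d j)) \<Longrightarrow>
       square_summable (samples d) \<and>
       square_sum (samples d) \<le> B * (\<Sum>j<N. square_sum (d j))"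
    using samples_upper_bound by blast
  let ?Y = "\<lambda>f n. inner_L2nu_vec N f (gabor_system \<nu> \<beta> (hermite c) n)"
  show ?thesis
    unfolding gabor_superframe_def
  proof (intro conjI allI impI)
    show "hermite c i \<in> L2R" for i by (rule hermite_in_L2R)
    show "inner_L2R (hermite c i) (hermite c j) = (if i = j then 1 else 0)" for i j
      by (rule hermite_orthonormal[OF assms(3)])
    show "gabor_system \<nu> \<beta> (hermite c) n \<in> L2nu_vec \<nu> N" for n
      using gmem by (simp add: L2nu_vec_def)
    show "\<exists>A>0. \<exists>B>0. \<forall>f\<in>L2nu_vec \<nu> N.
        square_summable (?Y f) \<and>
        A * (norm_L2nu_vec N f)^2
          \<le> square_sum (?Y f) \<and>
        square_sum (?Y f)
          \<le> B * (norm_L2nu_vec N f)^2"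
    proof (rule exI[of _ A], rule conjI[OF A(1)], rule exI[of _ B], rule conjI[OF B(1)], intro ballI conjI)
      fix f assume f: "f \<in> L2nu_vec \<nu> N"
      let ?d = "\<lambda>j. twisted_coeff \<nu> (f j)"
      note d = norm_L2nu_vec_squared(2)[OF f] and nrm = norm_L2nu_vec_squared(1)[OF f]
      show "square_summable (?Y f)"
        "square_sum (?Y f) \<le> B * (norm_L2nu_vec N f)^2"
        unfolding inner[OF f] nrm using B(2)[of ?d, OF d] by blast+
      show "A * (norm_L2nu_vec N f)^2 \<le> square_sum (?Y f)"
        unfolding inner[OF f] nrm using A(2)[of ?d, OF d] by blast
    qed
  qed
qed

end
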